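(* Let $q,r\geq 2$ be integers with $q$ even. Then there exists $n_0=n_0(q,r)$ such that for all $n\geq n_0$, up to isomorphism, $${\rm SPEX}_{3}(n,\theta(1,q,r))=\begin{cases} \{K_{\lceil\frac{n-1}{2}\rceil,\lfloor\frac{n-1}{2}\rfloor}\bullet K_3\} & \text{if } r \text{ is even},\\ \{SK_{\lceil\frac{n-1}{2}\rceil,\lfloor\frac{n-1}{2}\rfloor}\} & \text{if } r \text{ is odd and } q=2,\\ \{K_{\lceil\frac{n-2}{2}\rceil,\lfloor\frac{n-2}{2}\rfloor}\circ K_3\} & \text{if } r \text{ is odd and } q\geq 4. \end{cases}$$
   Context: All graphs are finite and simple. The spectral radius $\rho(G)$ of a graph $G$ is the largest eigenvalue of its adjacency matrix. A graph is $H$-free if it contains no subgraph isomorphic to $H$. The generalized theta graph $\theta(\ell_1,\dots,\ell_t)$ is formed by $t$ internally vertex-disjoint paths of lengths $\ell_1,\dots,\ell_t$ sharing the same two endpoints; in particular $\theta(1,q,r)$ consists of an edge $uv$ together with two further internally disjoint $(u,v)$-paths of lengths $q$ and $r$. ${\rm SPEX}_3(n,H)$ denotes the family of all $n$-vertex $H$-free non-bipartite graphs having the maximum spectral radius among all $n$-vertex $H$-free non-bipartite graphs. $K_{a,b}$ is the complete bipartite graph with parts of sizes $a$ and $b$. $K_{a,b}\circ K_3$ is obtained by identifying a vertex of $K_{a,b}$ lying in the part of size $b$ with a vertex of a triangle $K_3$. $K_{a,b}\bullet K_3$ is obtained by identifying an edge of $K_{a,b}$ with an edge of a triangle $K_3$.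 $SK_{a,b}$ is the graph obtained from $K_{a,b}$ by subdividing one edge (replacing it by a path of length 2 through a new vertex). *)

theory Defs
  imports
    Complex_Main
    "Graph_Theory.Kuratowski"
    "Graph_Theory.Digraph_Isomorphism"
    "Jordan_Normal_Form.Spectral_Radius"
begin

text \<open>
  A finite simple graph is a \<^locale>\<open>pair_graph\<close>: a finite loopless digraph with symmetric arc
  set, each edge being represented by its two opposite arcs.
\<close>

section \<open>Spectral radius\<close>

text \<open>
  The rows and columns are indexed by the vertices in increasing order; the eigenvalues do not
  depend on this choice.
\<close>

definition adjacency_matrix :: "'a::linorder pair_pre_digraph \<Rightarrow> real mat" where
  "adjacency_matrix G =
    (let vs = sorted_list_of_set (pverts G); n = card (pverts G)
     in mat n n (\<lambda>(i, j). if (vs ! i, vs ! j) \<in> parcs G then 1 else 0))"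

text \<open>
  For a real matrix, \<^const>\<open>spectrum\<close> is the set of real eigenvalues. It is finite, and
  nonempty for the adjacency matrix of a graph with at least one vertex.
\<close>

definition graph_spectral_radius :: "'a::linorder pair_pre_digraph \<Rightarrow> real" where
  "graph_spectral_radius G = Max (spectrum (adjacency_matrix G))"

section \<open>Bipartite graphs and forbidden subgraphs\<close>

definition bipartite :: "'a pair_pre_digraph \<Rightarrow> bool" where
  "bipartite G \<longleftrightarrow>
    (\<exists>U V. pverts G = U \<union> V \<and> U \<inter> V = {} \<and> parcs G \<subseteq> U \<times> V \<union> V \<times> U)"

definition graph_iso :: "'a pair_pre_digraph \<Rightarrow> 'b pair_pre_digraph \<Rightarrow> bool" where
  "graph_iso G H \<longleftrightarrow> digraph_iso (with_proj G) (with_proj H)"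

definition free_of :: "'b pair_pre_digraph \<Rightarrow> 'a pair_pre_digraph \<Rightarrow> bool" where
  "free_of H G \<longleftrightarrow>
    \<not> (\<exists>H'. pair_graph H' \<and> subgraph (with_proj H') (with_proj G) \<and> graph_iso H H')"

text \<open>
  Vertex sets are arbitrary finite sets of natural numbers, so every finite graph is represented,
  by all its copies.
\<close>

definition nonbipartite_free_graphs :: "nat \<Rightarrow> 'b pair_pre_digraph \<Rightarrow> nat pair_pre_digraph set" where
  "nonbipartite_free_graphs n H =
    {G. pair_graph G \<and> card (pverts G) = n \<and> free_of H G \<and> \<not> bipartite G}"

definition SPEX3 :: "nat \<Rightarrow> 'b pair_pre_digraph \<Rightarrow> nat pair_pre_digraph set" where
  "SPEX3 n H =
    {G \<in> nonbipartite_free_graphs n H.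
      \<forall>G' \<in> nonbipartite_free_graphs n H. graph_spectral_radius G' \<le> graph_spectral_radius G}"

definition copies :: "'b pair_pre_digraph \<Rightarrow> nat pair_pre_digraph set" where
  "copies K = {G. pair_graph G \<and> graph_iso K G}"

section \<open>Generalized theta graphs\<close>

datatype theta_vertex = Source | Sink | Inner nat nat

text \<open>
  \<open>theta_at ls i j\<close> is the vertex at distance \<open>j\<close> from the source along the \<open>i\<close>-th path, whose
  length is \<open>ls ! i\<close>. The lengths must be positive and at most one of them may be \<open>1\<close>.
\<close>

definition theta_at :: "nat list \<Rightarrow> nat \<Rightarrow> nat \<Rightarrow> theta_vertex" where
  "theta_at ls i j = (if j = 0 then Source else if j = ls ! i then Sink else Inner i j)"

definition theta_graph :: "nat list \<Rightarrow> theta_vertex pair_pre_digraph" where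
  "theta_graph ls = mk_symmetric (with_proj
    \<lparr> pverts = {theta_at ls i j | i j. i < length ls \<and> j \<le> ls ! i},
      parcs = {(theta_at ls i j, theta_at ls i (Suc j)) | i j. i < length ls \<and> j < ls ! i} \<rparr>)"

section \<open>The extremal graphs\<close>

datatype ext_vertex = Left nat | Right nat | New nat

definition complete_bipartite :: "nat \<Rightarrow> nat \<Rightarrow> ext_vertex pair_pre_digraph" where
  "complete_bipartite a b =
    (let U = Left ` {..<a}; V = Right ` {..<b}
     in \<lparr> pverts = U \<union> V, parcs = U \<times> V \<union> V \<times> U \<rparr>)"

text \<open>
  The union of \<open>G\<close> with the complete graph on \<open>S\<close>. If \<open>S\<close> meets the vertices of \<open>G\<close> exactly in a
  vertex, or exactly in the two ends of an edge, this identifies that vertex or edge with one of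
  the complete graph.
\<close>

definition glue_complete :: "'a pair_pre_digraph \<Rightarrow> 'a set \<Rightarrow> 'a pair_pre_digraph" where
  "glue_complete G S =
    \<lparr> pverts = pverts G \<union> S, parcs = parcs G \<union> {(x, y). x \<in> S \<and> y \<in> S \<and> x \<noteq> y} \<rparr>"

text \<open>
  The choice of the vertex in the part of size \<open>b\<close>, or of the edge, is immaterial up to
  isomorphism. The definitions are meaningful for \<open>b > 0\<close>, respectively \<open>a, b > 0\<close>.
\<close>

definition K_circ_K3 :: "nat \<Rightarrow> nat \<Rightarrow> ext_vertex pair_pre_digraph" where
  "K_circ_K3 a b = glue_complete (complete_bipartite a b) {Right 0, New 0, New 1}"

definition K_bullet_K3 :: "nat \<Rightarrow> nat \<Rightarrow> ext_vertex pair_pre_digraph" where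
  "K_bullet_K3 a b = glue_complete (complete_bipartite a b) {Left 0, Right 0, New 0}"

definition SK :: "nat \<Rightarrow> nat \<Rightarrow> ext_vertex pair_pre_digraph" where
  "SK a b = subdivide (complete_bipartite a b) (Left 0, Right 0) (New 0)"

section \<open>Consistency checks\<close>

lemma complete_bipartite_is_complete_bipartite_digraph:
  "complete_bipartite_digraph a b (with_proj (complete_bipartite a b))"
proof -
  have "card (Left ` {..<a}) = a" "card (Right ` {..<b}) = b"
    by (simp_all add: card_image inj_on_def)
  then show ?thesis
    unfolding complete_bipartite_digraph_pair_def complete_bipartite_def Let_def
    by (intro conjI exI[of _ "Left ` {..<a}"] exI[of _ "Right ` {..<b}"]) auto
qed

lemma pair_graph_glue_complete:
  assumes "pair_graph G" "finite S"
  shows "pair_graph (glue_complete G S)"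
proof -
  interpret pair_graph G by fact
  have "finite (S \<times> S)" using assms(2) by simp
  then have fin: "finite {(x, y). x \<in> S \<and> y \<in> S \<and> x \<noteq> y}"
    by (rule rev_finite_subset) auto
  show ?thesis
    using assms(2) fin pair_finite_verts pair_finite_arcs pair_sym_arcs
    by unfold_locales
      (auto simp: glue_complete_def symmetric_def sym_def wellformed' dest: pair_no_loops)
qed

lemma parcs_SK:
  assumes "a > 0" "b > 0"
  shows "parcs (SK a b) =
    parcs (complete_bipartite a b) - {(Left 0, Right 0), (Right 0, Left 0)}
      \<union> {(Left 0, New 0), (New 0, Left 0), (Right 0, New 0), (New 0, Right 0)}"
  by (auto simp: SK_def complete_bipartite_def Let_def subdivide.simps)

lemma pair_graph_theta_graph: "pair_graph (theta_graph ls)"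
proof -
  let ?G = "theta_graph ls"
  have pv: "pverts ?G = {theta_at ls i j | i j. i < length ls \<and> j \<le> ls ! i}"
    by (simp add: theta_graph_def mk_symmetric_def)
  have pa: "(x, y) \<in> parcs ?G \<longleftrightarrow> (\<exists>i j. i < length ls \<and> j < ls ! i \<and>
      ((x, y) = (theta_at ls i j, theta_at ls i (Suc j)) \<or>
       (y, x) = (theta_at ls i j, theta_at ls i (Suc j))))" for x y
    by (auto simp: theta_graph_def mk_symmetric_def)
  have "pverts ?G = (\<Union>i<length ls. theta_at ls i ` {..ls ! i})"
    unfolding pv by auto
  then have fv: "finite (pverts ?G)" by simp
  have sub: "x \<in> pverts ?G \<and> y \<in> pverts ?G" if "(x, y) \<in> parcs ?G" for x y
    using that unfolding pa pv by (auto intro: less_imp_le_nat Suc_leI)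
  then have "parcs ?G \<subseteq> pverts ?G \<times> pverts ?G" by auto
  then have fa: "finite (parcs ?G)"
    using fv by (meson finite_SigmaI rev_finite_subset)
  have "theta_at ls i j \<noteq> theta_at ls i (Suc j)" if "i < length ls" "j < ls ! i" for i j
    using that by (auto simp: theta_at_def)
  then have "x \<noteq> y" if "(x, y) \<in> parcs ?G" for x y
    using that unfolding pa by auto
  moreover have "symmetric (with_proj ?G)"
    by (auto simp: symmetric_def sym_def pa)
  ultimately show ?thesis
    using fv fa sub by unfold_locales auto
qed

lemma graph_iso_iff:
  assumes "pair_graph G" "pair_graph H"
  shows "graph_iso G H \<longleftrightarrow>
    (\<exists>f. bij_betw f (pverts G) (pverts H) \<and>
      (\<forall>u \<in> pverts G. \<forall>v \<in> pverts G. (u, v) \<in> parcs G \<longleftrightarrow> (f u, f v) \<in> parcs H))"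
    (is "_ \<longleftrightarrow> (\<exists>f. ?P f)")
proof
  interpret G: pair_graph G by fact
  interpret H: pair_graph H by fact
  assume "graph_iso G H"
  then obtain f where f: "pre_digraph.digraph_isomorphism (with_proj G) f"
    and eq: "with_proj H = app_iso f (with_proj G)"
    by (auto simp: graph_iso_def digraph_iso_def)
  note defs = f[unfolded pre_digraph.digraph_isomorphism_def]
  have "pverts H = iso_verts f ` pverts G" "parcs H = iso_arcs f ` parcs G"
    "iso_tail f = fst" "iso_head f = snd"
    using arg_cong[OF eq, of verts] arg_cong[OF eq, of arcs]
      arg_cong[OF eq, of tail] arg_cong[OF eq, of head] by simp_all
  note H = this
  have arc: "iso_arcs f (u, v) = (iso_verts f u, iso_verts f v)" if "(u, v) \<in> parcs G" for u v
    using defs H(3,4) that by (metis with_proj_simps fst_conv snd_conv prod.collapse)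
  have inj: "inj_on (iso_verts f) (pverts G)" using defs by simp
  have "(u, v) \<in> parcs G"
    if "u \<in> pverts G" "v \<in> pverts G" "(iso_verts f u, iso_verts f v) \<in> parcs H" for u v
  proof -
    from that(3) H(2) obtain x y where xy: "(x, y) \<in> parcs G"
      "(iso_verts f u, iso_verts f v) = iso_arcs f (x, y)" by auto
    then have "u = x" "v = y"
      using arc[OF xy(1)] inj that(1,2) G.wellformed'[OF xy(1)] by (auto dest: inj_onD)
    then show ?thesis using xy(1) by simp
  qed
  moreover have "(iso_verts f u, iso_verts f v) \<in> parcs H" if "(u, v) \<in> parcs G" for u v
    using H(2) arc that by force
  ultimately have "?P (iso_verts f)" using inj H(1) by (auto simp: bij_betw_def)
  then show "\<exists>f. ?P f" by (intro exI[of _ "iso_verts f"])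
next
  interpret G: pair_graph G by fact
  interpret H: pair_graph H by fact
  assume "\<exists>f. ?P f"
  then obtain f where bij: "bij_betw f (pverts G) (pverts H)"
    and arc: "\<And>u v. u \<in> pverts G \<Longrightarrow> v \<in> pverts G \<Longrightarrow>
      (u, v) \<in> parcs G \<longleftrightarrow> (f u, f v) \<in> parcs H" by blast
  let ?h = "\<lparr> iso_verts = f, iso_arcs = map_prod f f, iso_head = snd, iso_tail = fst \<rparr>"
  have inj: "inj_on f (pverts G)" and img: "f ` pverts G = pverts H"
    using bij by (auto simp: bij_betw_def)
  have "inj_on (map_prod f f) (parcs G)"
    by (rule inj_on_subset[OF map_prod_inj_on[OF inj inj]]) (auto dest: G.wellformed')
  then have "G.digraph_isomorphism ?h"
    using inj G.wf_digraph by (auto simp: pre_digraph.digraph_isomorphism_def)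
  moreover have "map_prod f f ` parcs G = parcs H"
  proof
    show "map_prod f f ` parcs G \<subseteq> parcs H"
      by (auto simp: arc[symmetric] G.wellformed')
    show "parcs H \<subseteq> map_prod f f ` parcs G"
    proof
      fix e assume "e \<in> parcs H"
      then obtain x y where e: "e = (x, y)" "(x, y) \<in> parcs H" by (cases e) auto
      moreover obtain u v where "u \<in> pverts G" "v \<in> pverts G" "x = f u" "y = f v"
        using H.wellformed'[OF e(2)] img by blast
      ultimately show "e \<in> map_prod f f ` parcs G" using arc by force
    qed
  qed
  then have "with_proj H = app_iso ?h (with_proj G)"
    using img by (simp add: with_proj_def app_iso_def)
  ultimately show "graph_iso G H" by (auto simp: graph_iso_def digraph_iso_def)
qed

end

theory Submission
  imports Defs "HOL-Analysis.Function_Topology" "HOL-Analysis.Convex"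
begin

text \<open>
  Let \<open>G\<close> be a non-bipartite graph without \<open>\<theta>(1,q,r)\<close> whose spectral radius \<open>\<lambda>\<close> is at least that of
  the candidate, and scale its Perron vector \<open>x\<close> to have maximum \<open>1\<close>, attained at \<open>u\<close>. The
  neighbourhood of \<open>u\<close> contains no path on \<open>q + r - 1\<close> vertices, so it spans \<open>O(n)\<close> edges; expanding
  \<open>\<lambda>\<^sup>2 x(u)\<close> over walks of length two shows that \<open>G\<close> misses only \<open>O(n)\<close> edges of a nearly balanced
  complete bipartite graph on its vertices, and that \<open>x\<close> is nearly constant.

  Classify a vertex by the side in which it has at least \<open>0.26 n\<close> neighbours. Two such vertices on
  the same side have many common neighbours, hence are not adjacent, because an edge inside a side
  of a nearly complete bipartite graph creates \<open>\<theta>(1,q,r)\<close>. The remaining vertices \<open>W\<close> have degree at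
  most \<open>0.262 n\<close>, hence Perron weight at most about \<open>0.53\<close>, so that deleting one of them costs little:
  comparing \<open>\<lambda>\<^sup>2\<close> with the number of edges between the two sides gives \<open>\<bar>W\<bar> \<le> 1\<close>, respectively
  \<open>\<bar>W\<bar> \<le> 2\<close> if \<open>r\<close> is odd and \<open>q \<ge> 4\<close>. Each excess edge at \<open>W\<close> forces, by \<open>\<theta>\<close>-freeness, missing edges
  between the sides, and these cost more than the excess edges gain.

  The threshold \<open>0.26\<close> has to exceed \<open>1/4\<close> for the common neighbours, and to be small enough for the
  bound on \<open>W\<close>.
\<close>


section \<open>Embedding theta graphs in nearly complete bipartite graphs\<close>

text \<open>Counting cross edges settles a case when the candidate contains the complete bipartite
  graph on its two sides, for then its \<open>l\<^sup>2\<close> reaches the balanced product.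
  \<open>SK\<close> lacks one edge and guarantees only \<open>l \<ge> p - 1 / p\<close>, where
  \<open>p\<^sup>2\<close> is the balanced product: a deficit of \<open>2\<close> in
  \<open>l\<^sup>2\<close>, so that counting would tolerate two missing pairs instead of one. There
  missing pairs are weighed with the Perron vector, which charges nearly \<open>2\<close> for each
  where the count charges about \<open>1\<close>. For \<open>K_circ_K3\<close>, counting cannot see
  which side carries the triangle; if the sizes differ by one, an exact equation for the spectral
  radius decides. The three cases share one stability argument. It starts from
  \<open>l\<^sup>2 \<ge> n\<^sup>2 / 4 - 2 * n\<close>, a weak bound that every candidate satisfies.
  The factor \<open>10^8\<close> in the lower bound on \<open>n\<close> turns errors linear in
  \<open>n\<close> into tiny multiples of \<open>n\<^sup>2\<close>.\<close>

lemma card_Collect_diff_nonempty: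
  assumes "finite Z" "card Z < card S"
  shows "\<exists>s. s \<in> S \<and> s \<notin> Z"
  using assms by (metis card_mono not_le subsetI)

lemma even_ge_2E:
  assumes "even (n :: nat)" "n \<ge> 2"
  obtains i where "n = 2 * i + 2"
proof -
  from assms(1) obtain m where "n = 2 * m" by (rule evenE)
  then show ?thesis using assms(2) by (intro that[of "m - 1"]) simp
qed

lemma even_ge_4E:
  assumes "even (n :: nat)" "n \<ge> 4"
  obtains i where "n = 2 * i + 4"
proof -
  from assms(1) obtain m where "n = 2 * m" by (rule evenE)
  then show ?thesis using assms(2) by (intro that[of "m - 2"]) simp
qed

lemma odd_ge_2E:
  assumes "odd (n :: nat)" "n \<ge> 2"
  obtains i where "n = 2 * i + 3"
proof -
  from assms(1) obtain m where "n = 2 * m + 1" by (rule oddE)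
  then show ?thesis using assms(2) by (intro that[of "m - 1"]) simp
qed

lemma successively_join:
  "successively E (u # P @ y # Q @ [v]) \<longleftrightarrow>
     successively E (u # P @ [y]) \<and> successively E (y # Q @ [v])"
  by (induction P arbitrary: u) (auto simp: successively_Cons)

text \<open>The lists hold the inner vertices only, so a path of length \<open>q\<close> contributes
  \<open>q - 1\<close> of them. Further adjacencies are allowed, as subgraphs may be
  non-induced.\<close>

definition has_theta :: "('a \<Rightarrow> 'a \<Rightarrow> bool) \<Rightarrow> nat \<Rightarrow> nat \<Rightarrow> bool" where
  "has_theta E q r \<longleftrightarrow> (\<exists>u v P Q. E u v \<and> length P + 1 = q \<and> length Q + 1 = r \<and>
     distinct (u # v # P @ Q) \<and> successively E (u # P @ [v]) \<and> successively E (u # Q @ [v]))"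

text \<open>
  Nothing prevents the ends from occurring among the inner vertices; in applications \<open>Z\<close> contains them.
\<close>

definition inner_path :: "('a \<Rightarrow> 'a \<Rightarrow> bool) \<Rightarrow> 'a set \<Rightarrow> 'a \<Rightarrow> 'a list \<Rightarrow> 'a \<Rightarrow> bool" where
  "inner_path E Z u P v \<longleftrightarrow> distinct P \<and> set P \<inter> Z = {} \<and> successively E (u # P @ [v])"

lemma has_thetaI:
  assumes "E u v" "u \<noteq> v" "length P + 1 = q" "length Q + 1 = r"
    "inner_path E {u, v} u P v" "inner_path E ({u, v} \<union> set P) u Q v"
  shows "has_theta E q r"
  unfolding has_theta_def
  using assms by (intro exI[of _ u] exI[of _ v] exI[of _ P] exI[of _ Q]) (auto simp: inner_path_def)

text \<open>
  \<open>h\<close> bounds the non-neighbours of a vertex in the other part, and \<open>K\<close> the number of vertices to be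
  avoided while paths are chosen greedily. The graph may have further vertices and edges.
\<close>

locale near_complete =
  fixes E :: "'a \<Rightarrow> 'a \<Rightarrow> bool" and X Y :: "'a set" and h K :: nat
  assumes E_sym: "E u v \<Longrightarrow> E v u"
    and E_irrefl: "\<not> E u u"
    and finX: "finite X" and finY: "finite Y"
    and disj: "X \<inter> Y = {}"
    and missX: "x \<in> X \<Longrightarrow> card {y \<in> Y. \<not> E x y} \<le> h"
    and missY: "y \<in> Y \<Longrightarrow> card {x \<in> X. \<not> E y x} \<le> h"
    and cardX: "2 * h + K \<le> card X"
    and cardY: "2 * h + K \<le> card Y"
begin

lemma near_complete_swap: "near_complete E Y X h K"
  using E_sym E_irrefl finX finY disj missX missY cardX cardY by unfold_locales auto

section \<open>Greedy paths of prescribed parity between given ends\<close>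

lemma degX: "x \<in> X \<Longrightarrow> card Y \<le> card {y \<in> Y. E x y} + h"
proof -
  assume x: "x \<in> X"
  have "card Y = card {y \<in> Y. E x y} + card {y \<in> Y. \<not> E x y}"
    using finY by (subst card_Un_disjoint[symmetric]) (auto intro: arg_cong[where f=card])
  then show ?thesis using missX[OF x] by linarith
qed

lemma degY: "y \<in> Y \<Longrightarrow> card X \<le> card {x \<in> X. E y x} + h"
  by (rule near_complete.degX[OF near_complete_swap])

text \<open>The vertex \<open>y\<close> misses at most \<open>h\<close> vertices of
  \<open>X\<close>, so at least \<open>K\<close> of the neighbours of \<open>v\<close> remain, more
  than \<open>Z\<close> can block.\<close>

lemma common_neighbour:
  assumes "h + K \<le> card {x \<in> X. E v x}" "y \<in> Y" "finite Z" "card Z < K"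
  shows "\<exists>x\<in>X. E v x \<and> E x y \<and> x \<notin> Z"
proof -
  have "card {x \<in> X. E v x} \<le> card ({x \<in> X. E v x \<and> E y x} \<union> {x \<in> X. \<not> E y x})"
    using finX by (intro card_mono) auto
  also have "\<dots> \<le> card {x \<in> X. E v x \<and> E y x} + card {x \<in> X. \<not> E y x}" by (rule card_Un_le)
  finally have "card Z < card {x \<in> X. E v x \<and> E y x}" using assms missY[OF assms(2)] by linarith
  from card_Collect_diff_nonempty[OF assms(3) this] show ?thesis using E_sym by blast
qed

text \<open>Only the degree of \<open>v\<close> into \<open>X\<close> matters, so \<open>v\<close>
  may lie outside both sides. Each round walks to \<open>X\<close> and on to a new vertex of
  \<open>Y\<close>, which again has large degree into \<open>X\<close>; \<open>Z\<close> gains two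
  vertices while \<open>i\<close> drops by one, so the budget \<open>card Z + 2 * i\<close> is
  kept.\<close>

lemma even_path:
  assumes "h + K \<le> card {x \<in> X. E v x}" "y \<in> Y" "finite Z" "v \<in> Z" "y \<in> Z"
    "card Z + 2 * i < K"
  shows "\<exists>P. length P = 2 * i + 1 \<and> inner_path E Z v P y"
  using assms
proof (induction i arbitrary: v Z)
  case 0
  then obtain x where "x \<in> X" "E v x" "E x y" "x \<notin> Z"
    using common_neighbour by force
  then show ?case by (intro exI[of _ "[x]"]) (auto simp: inner_path_def)
next
  case (Suc i)
  have "card Z < card {x \<in> X. E v x}" using Suc.prems by linarith
  from card_Collect_diff_nonempty[OF \<open>finite Z\<close> this]
  obtain x where x: "x \<in> X" "E v x" "x \<notin> Z" by blast
  have "card Z < card {y \<in> Y. E x y}" using Suc.prems degX[OF x(1)] cardY by linarith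
  from card_Collect_diff_nonempty[OF \<open>finite Z\<close> this]
  obtain y' where y': "y' \<in> Y" "E x y'" "y' \<notin> Z" by blast
  have xy: "x \<noteq> y'" using x y' disj by blast
  let ?Z = "insert x (insert y' Z)"
  have "card ?Z = card Z + 2" using x y' xy Suc.prems by simp
  then have "\<exists>P. length P = 2 * i + 1 \<and> inner_path E ?Z y' P y"
    using Suc.prems degY[OF y'(1)] cardX by (intro Suc.IH) auto
  then obtain P where "length P = 2 * i + 1" "inner_path E ?Z y' P y" by blast
  then show ?case using x y' xy
    by (intro exI[of _ "x # y' # P"]) (auto simp: inner_path_def successively_Cons)
qed

text \<open>A first step into \<open>Y\<close> shifts the parity of
  \<open>even_path\<close>.\<close>

lemma odd_path:
  assumes "K \<le> card {y \<in> Y. E v y}" "y \<in> Y" "finite Z" "v \<in> Z" "y \<in> Z"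
    "card Z + 2 * i + 1 < K"
  shows "\<exists>P. length P = 2 * i + 2 \<and> inner_path E Z v P y"
proof -
  have "card Z < card {y \<in> Y. E v y}" using assms by linarith
  from card_Collect_diff_nonempty[OF assms(3) this]
  obtain y' where y': "y' \<in> Y" "E v y'" "y' \<notin> Z" by blast
  have "\<exists>P. length P = 2 * i + 1 \<and> inner_path E (insert y' Z) y' P y"
    using assms y' degY[OF y'(1)] cardX by (intro even_path) auto
  then obtain P where "length P = 2 * i + 1" "inner_path E (insert y' Z) y' P y" by blast
  then show ?thesis using y'
    by (intro exI[of _ "y' # P"]) (auto simp: inner_path_def successively_Cons)
qed

lemma inner_path_snoc:
  assumes "inner_path E (insert y Z) v P y" "y \<notin> Z" "E y a"
  shows "inner_path E Z v (P @ [y]) a"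
  using assms successively_join[of E v P y "[]" a] by (auto simp: inner_path_def)

text \<open>Both ends may lie outside the sides: the path leaves \<open>b\<close> through
  \<open>X\<close> and reaches \<open>a\<close> through a neighbour in \<open>Y\<close> that is
  reserved beforehand.\<close>

lemma odd_path_across:
  assumes "h + K \<le> card {x \<in> X. E b x}" "K \<le> card {y \<in> Y. E a y}" "finite Z" "a \<in> Z" "b \<in> Z"
    "card Z + 2 * i + 1 < K"
  shows "\<exists>P. length P = 2 * i + 2 \<and> inner_path E Z b P a"
proof -
  have "card Z < card {y \<in> Y. E a y}" using assms by linarith
  from card_Collect_diff_nonempty[OF assms(3) this]
  obtain y where y: "y \<in> Y" "E a y" "y \<notin> Z" by blast
  have "\<exists>P. length P = 2 * i + 1 \<and> inner_path E (insert y Z) b P y"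
    using assms y by (intro even_path) auto
  then obtain P where "length P = 2 * i + 1" "inner_path E (insert y Z) b P y" by blast
  then show ?thesis using inner_path_snoc[of y Z b P a] y E_sym by (intro exI[of _ "P @ [y]"]) auto
qed

text \<open>A reserved common neighbour \<open>y\<close> is the last inner vertex, and for
  \<open>i = 0\<close> the only one.\<close>

lemma even_path_common:
  assumes "K \<le> card {y \<in> Y. E v y \<and> E v' y}" "finite Z" "v \<in> Z" "v' \<in> Z"
    "card Z + 2 * i < K"
  shows "\<exists>P. length P = 2 * i + 1 \<and> inner_path E Z v P v'"
proof -
  have "card Z < card {y \<in> Y. E v y \<and> E v' y}" using assms by linarith
  from card_Collect_diff_nonempty[OF assms(2) this]
  obtain y where y: "y \<in> Y" "E v y" "E v' y" "y \<notin> Z" by blast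
  show ?thesis
  proof (cases i)
    case 0
    then show ?thesis using y E_sym by (intro exI[of _ "[y]"]) (auto simp: inner_path_def)
  next
    case (Suc j)
    have "card {y \<in> Y. E v y \<and> E v' y} \<le> card {y \<in> Y. E v y}"
      using finY by (intro card_mono) auto
    then have "\<exists>P. length P = 2 * j + 2 \<and> inner_path E (insert y Z) v P y"
      using assms y Suc by (intro odd_path) auto
    then obtain P where "length P = 2 * j + 2" "inner_path E (insert y Z) v P y" by blast
    then show ?thesis using inner_path_snoc[of y Z v P v'] y E_sym Suc
      by (intro exI[of _ "P @ [y]"]) auto
  qed
qed

text \<open>If \<open>r\<close> is even, \<open>v v'\<close> is the edge of the theta graph, since
  paths of both even lengths join two vertices of one side. If \<open>r\<close> is odd, the edge is
  \<open>v z\<close> with a common neighbour \<open>z\<close>: the path of even length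
  \<open>q\<close> starts with \<open>v v'\<close>, which corrects its parity, and the path of odd
  length \<open>r\<close> simply crosses between the sides.\<close>

lemma theta_same_side:
  assumes vv: "E v v'" and common: "K \<le> card {y \<in> Y. E v y \<and> E v' y}"
    and q: "even q" "q \<ge> 2" "r \<ge> 2" and K: "q + r + 4 \<le> K"
  shows "has_theta E q r"
proof (cases "even r")
  case True
  obtain i where i: "q = 2 * i + 2" using q even_ge_2E by blast
  obtain j where j: "r = 2 * j + 2" using q True even_ge_2E by blast
  have ne: "v \<noteq> v'" using vv E_irrefl by blast
  obtain P where P: "length P = 2 * i + 1" "inner_path E {v, v'} v P v'"
    using even_path_common[OF common, of "{v, v'}" i] ne K i by auto
  have "card ({v, v'} \<union> set P) \<le> 2 + length P"
    by (rule order_trans[OF card_Un_le]) (use card_length[of P] ne in auto)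
  then obtain Q where Q: "length Q = 2 * j + 1" "inner_path E ({v, v'} \<union> set P) v Q v'"
    using even_path_common[OF common, of "{v, v'} \<union> set P" j] K i j P by auto
  show ?thesis using has_thetaI[OF vv ne _ _ P(2) Q(2)] P Q i j by simp
next
  case False
  then obtain j where j: "r = 2 * j + 3" using q odd_ge_2E by blast
  obtain i where i: "q = 2 * i + 2" using q even_ge_2E by blast
  have ne: "v \<noteq> v'" using vv E_irrefl by blast
  have "card {v, v'} < card {y \<in> Y. E v y \<and> E v' y}" using common K ne q by simp
  from card_Collect_diff_nonempty[OF _ this]
  obtain z where z: "z \<in> Y" "E v z" "E v' z" "z \<noteq> v" "z \<noteq> v'" by auto
  have c: "K \<le> card {y \<in> Y. E v y}" "K \<le> card {y \<in> Y. E v' y}"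
    using finY by (auto intro!: order_trans[OF common] card_mono)
  obtain P where P: "length P = 2 * i" "inner_path E {v, v', z} v' P z"
  proof (cases i)
    case 0
    then show ?thesis using that[of "[]"] z by (auto simp: inner_path_def)
  next
    case (Suc k)
    then show ?thesis
      using odd_path[OF c(2) z(1), of "{v, v', z}" k] that z ne K i by auto
  qed
  have P': "inner_path E {v, z} v (v' # P) z"
    using P vv ne z by (auto simp: inner_path_def successively_Cons)
  have "card ({v, z} \<union> set (v' # P)) \<le> 2 + length (v' # P)"
    by (rule order_trans[OF card_Un_le]) (use card_length[of "v' # P"] z in auto)
  then obtain Q where Q: "length Q = 2 * j + 2" "inner_path E ({v, z} \<union> set (v' # P)) v Q z"
    using odd_path[OF c(1) z(1), of "{v, z} \<union> set (v' # P)" j] K i j P by auto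
  show ?thesis using has_thetaI[OF z(2) z(4)[symmetric] _ _ P' Q(2)] P Q i j by simp
qed

text \<open>Here \<open>w a\<close> is the edge, and the two paths leave \<open>w\<close> through
  \<open>b\<close> and \<open>b'\<close> and then cross to \<open>a\<close> with odd length. If
  \<open>q\<close> or \<open>r\<close> is \<open>2\<close>, the crossing is a single edge; this is
  the purpose of \<open>adj\<close>.\<close>

lemma theta_even_branch:
  assumes wa: "E w a" and wb: "E w b" "E w b'" "b \<noteq> b'"
    and rich: "K \<le> card {y \<in> Y. E a y}" "h + K \<le> card {x \<in> X. E b x}" "h + K \<le> card {x \<in> X. E b' x}"
    and ab: "a \<noteq> b" "a \<noteq> b'"
    and q: "even q" "q \<ge> 2" and r: "even r" "r \<ge> 2" and K: "q + r + 4 \<le> K"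
    and adj: "q = 2 \<Longrightarrow> E a b" "r = 2 \<Longrightarrow> E a b'"
  shows "has_theta E q r"
proof -
  obtain i where i: "q = 2 * i + 2" using q even_ge_2E by blast
  obtain j where j: "r = 2 * j + 2" using r even_ge_2E by blast
  have ne: "w \<noteq> a" "w \<noteq> b" "w \<noteq> b'" using wa wb E_irrefl by metis+
  obtain P where P: "length P = 2 * i" "inner_path E {w, a, b, b'} b P a"
  proof (cases i)
    case 0
    then show ?thesis using that[of "[]"] adj i E_sym by (auto simp: inner_path_def)
  next
    case (Suc k)
    have "card {w, a, b, b'} \<le> 4" by (auto simp: card_insert_if)
    then show ?thesis
      using odd_path_across[OF rich(2) rich(1), of "{w, a, b, b'}" k] that K i Suc by auto
  qed
  let ?Z = "{w, a, b, b'} \<union> set P"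
  have cZ: "card ?Z \<le> 4 + length P"
    by (rule order_trans[OF card_Un_le]) (use card_length[of P] in \<open>auto simp: card_insert_if\<close>)
  obtain Q where Q: "length Q = 2 * j" "inner_path E ?Z b' Q a"
  proof (cases j)
    case 0
    then show ?thesis using that[of "[]"] adj j E_sym by (auto simp: inner_path_def)
  next
    case (Suc k)
    then show ?thesis
      using odd_path_across[OF rich(3) rich(1), of ?Z k] that K i j cZ P by auto
  qed
  have P': "inner_path E {w, a} w (b # P) a"
    using P wb ne ab by (auto simp: inner_path_def successively_Cons)
  have Q': "inner_path E ({w, a} \<union> set (b # P)) w (b' # Q) a"
    using P Q wb ne ab by (auto simp: inner_path_def successively_Cons)
  show ?thesis using has_thetaI[OF wa ne(1) _ _ P' Q'] P Q i j by simp
qed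

text \<open>The edge is \<open>b a\<close>, the path of length \<open>2\<close> runs through
  \<open>w\<close>, and the odd path crosses between the sides.\<close>

lemma theta_triangle:
  assumes w: "E w a" "E w b" and ab: "E b a"
    and rich: "K \<le> card {y \<in> Y. E a y}" "h + K \<le> card {x \<in> X. E b x}"
    and r: "odd r" "r \<ge> 2" and K: "r + 4 \<le> K"
  shows "has_theta E 2 r"
proof -
  obtain j where j: "r = 2 * j + 3" using r odd_ge_2E by blast
  have ne: "b \<noteq> a" "w \<noteq> a" "w \<noteq> b" using w ab E_irrefl by metis+
  have P: "inner_path E {b, a} b [w] a" using w ne E_sym by (auto simp: inner_path_def)
  have "card ({b, a} \<union> set [w]) \<le> 3" by (auto simp: card_insert_if)
  then obtain Q where "length Q = 2 * j + 2" "inner_path E ({b, a} \<union> set [w]) b Q a"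
    using odd_path_across[OF rich(2) rich(1), of "{b, a} \<union> set [w]" j] K j by auto
  then show ?thesis using has_thetaI[OF ab ne(1) _ _ P] j by simp
qed

text \<open>The edge is \<open>a z\<close> with \<open>z\<close> in \<open>Y\<close>. The detour
  over \<open>w\<close> to \<open>b\<close> lands on the side of \<open>z\<close>, from where an
  even path of length at least \<open>2\<close> is required; hence \<open>q \<ge> 4\<close>.\<close>

lemma theta_long_bridge:
  assumes w: "E w a" "E w b" "a \<noteq> b"
    and rich: "K \<le> card {y \<in> Y. E a y}" "h + K \<le> card {x \<in> X. E b x}"
    and q: "even q" "q \<ge> 4" and r: "odd r" "r \<ge> 2" and K: "q + r + 4 \<le> K"
  shows "has_theta E q r"
proof -
  obtain i where i: "q = 2 * i + 4" using q even_ge_4E by blast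
  obtain j where j: "r = 2 * j + 3" using r odd_ge_2E by blast
  have ne: "w \<noteq> a" "w \<noteq> b" using w E_irrefl by metis+
  have "card {w, a, b} < card {y \<in> Y. E a y}" using rich K w ne by (simp add: card_insert_if)
  from card_Collect_diff_nonempty[OF _ this]
  obtain z where z: "z \<in> Y" "E a z" "z \<noteq> w" "z \<noteq> a" "z \<noteq> b" by auto
  have "card {w, a, b, z} \<le> 4" by (auto simp: card_insert_if)
  then obtain P where P: "length P = 2 * i + 1" "inner_path E {w, a, b, z} b P z"
    using even_path[OF rich(2) z(1), of "{w, a, b, z}" i] K i by auto
  have P': "inner_path E {a, z} a (w # b # P) z"
    using P w ne z E_sym by (auto simp: inner_path_def successively_Cons)
  have "card ({a, z} \<union> set (w # b # P)) \<le> 2 + length (w # b # P)"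
    by (rule order_trans[OF card_Un_le]) (use card_length[of "w # b # P"] z in auto)
  then obtain Q where "length Q = 2 * j + 2" "inner_path E ({a, z} \<union> set (w # b # P)) a Q z"
    using odd_path[OF rich(1) z(1), of "{a, z} \<union> set (w # b # P)" j] K i j P by auto
  then show ?thesis using has_thetaI[OF z(2) z(4)[symmetric] _ _ P'] P i j by simp
qed

text \<open>The edge is \<open>a z\<close>, and the path of length \<open>q\<close> begins with the
  three edges of the handle. Taking \<open>z\<close> adjacent to \<open>a'\<close> as well covers
  \<open>q = 4\<close>, where a single edge completes it.\<close>

lemma theta_handle:
  assumes w: "E w a" "E w w'" "E w' a'" "a \<noteq> a'" "w \<noteq> a'" "w' \<noteq> a"
    and common: "K \<le> card {y \<in> Y. E a y \<and> E a' y}"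
    and q: "even q" "q \<ge> 4" and r: "odd r" "r \<ge> 2" and K: "q + r + 4 \<le> K"
  shows "has_theta E q r"
proof -
  obtain i where i: "q = 2 * i + 4" using q even_ge_4E by blast
  obtain j where j: "r = 2 * j + 3" using r odd_ge_2E by blast
  have ne: "w \<noteq> a" "w' \<noteq> a'" "w \<noteq> w'" using w E_irrefl by metis+
  have "card {w, a, w', a'} \<le> 4" by (auto simp: card_insert_if)
  then have "card {w, a, w', a'} < card {y \<in> Y. E a y \<and> E a' y}" using common K q by simp
  from card_Collect_diff_nonempty[OF _ this]
  obtain z where z: "z \<in> Y" "E a z" "E a' z" "z \<noteq> w" "z \<noteq> a" "z \<noteq> w'" "z \<noteq> a'" by auto
  have c: "K \<le> card {y \<in> Y. E a y}" "K \<le> card {y \<in> Y. E a' y}"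
    using finY by (auto intro!: order_trans[OF common] card_mono)
  have cZ: "card {w, a, w', a', z} \<le> 5" by (auto simp: card_insert_if)
  obtain P where P: "length P = 2 * i" "inner_path E {w, a, w', a', z} a' P z"
  proof (cases i)
    case 0
    then show ?thesis using that[of "[]"] z by (auto simp: inner_path_def)
  next
    case (Suc k)
    then show ?thesis
      using odd_path[OF c(2) z(1), of "{w, a, w', a', z}" k] that cZ K i by auto
  qed
  have P': "inner_path E {a, z} a (w # w' # a' # P) z"
    using P w ne z E_sym by (auto simp: inner_path_def successively_Cons)
  have "card ({a, z} \<union> set (w # w' # a' # P)) \<le> 2 + length (w # w' # a' # P)"
    by (rule order_trans[OF card_Un_le]) (use card_length[of "w # w' # a' # P"] z in auto)
  then obtain Q where "length Q = 2 * j + 2" "inner_path E ({a, z} \<union> set (w # w' # a' # P)) a Q z"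
    using odd_path[OF c(1) z(1), of "{a, z} \<union> set (w # w' # a' # P)" j] K i j P by auto
  then show ?thesis using has_thetaI[OF z(2) z(5)[symmetric] _ _ P'] P i j by simp
qed

end

section \<open>Graphs without a long path, and fans\<close>

lemma path_of_min_degree:
  assumes "finite S" "S \<noteq> {}" and sym: "\<And>u v. E u v \<Longrightarrow> E v u"
    and deg: "\<And>v. v \<in> S \<Longrightarrow> k \<le> card {u \<in> S. E v u}" and irrefl: "\<And>v. \<not> E v v"
  shows "j \<le> k \<Longrightarrow> \<exists>p. length p = j + 1 \<and> distinct p \<and> set p \<subseteq> S \<and> successively E p"
proof (induction j)
  case 0
  from assms obtain v where "v \<in> S" by blast
  then show ?case by (intro exI[of _ "[v]"]) auto
next
  case (Suc j)
  then obtain p where p: "length p = j + 1" "distinct p" "set p \<subseteq> S" "successively E p" by auto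
  then obtain v p' where vp: "p = v # p'" by (cases p) auto
  have "card (set p') < card {u \<in> S. E v u}"
    using card_length[of p'] p vp deg[of v] Suc.prems by auto
  from card_Collect_diff_nonempty[OF _ this]
  obtain u where u: "u \<in> S" "E v u" "u \<notin> set p'" by auto
  then have "u \<noteq> v" using irrefl by metis
  then show ?case using u p vp sym by (intro exI[of _ "u # p"]) auto
qed

text \<open>A weak form of the Erdos-Gallai bound. Without the path, some vertex has fewer than
  \<open>k\<close> neighbours in \<open>S\<close>; deleting it lowers the degree sum by less than
  \<open>2 * k\<close>.\<close>

lemma path_or_few_edges:
  assumes "finite S" and sym: "\<And>u v. E u v \<Longrightarrow> E v u" and irrefl: "\<And>v. \<not> E v v"
    and nopath: "\<not> (\<exists>p. length p = k + 1 \<and> distinct p \<and> set p \<subseteq> S \<and> successively E p)"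
  shows "(\<Sum>v\<in>S. card {u \<in> S. E v u}) \<le> 2 * k * card S"
  using assms(1) nopath
proof (induction "card S" arbitrary: S)
  case 0
  then show ?case by simp
next
  case (Suc m)
  have "\<exists>v\<in>S. card {u \<in> S. E v u} < k"
  proof (rule ccontr)
    assume "\<not> ?thesis"
    then have deg: "k \<le> card {u \<in> S. E v u}" if "v \<in> S" for v using that by (simp add: not_less)
    have "S \<noteq> {}" using Suc.hyps(2) by auto
    from path_of_min_degree[where j = k, OF Suc.prems(1) this sym deg irrefl order_refl]
    have "\<exists>p. length p = k + 1 \<and> distinct p \<and> set p \<subseteq> S \<and> successively E p" .
    then show False using Suc.prems by blast
  qed
  then obtain v where v: "v \<in> S" "card {u \<in> S. E v u} < k" by blast
  let ?S = "S - {v}"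
  have IH: "(\<Sum>w\<in>?S. card {u \<in> ?S. E w u}) \<le> 2 * k * card ?S"
  proof (rule Suc.hyps(1))
    show "m = card ?S" using Suc.hyps(2) v Suc.prems(1) by simp
    show "finite ?S" using Suc.prems(1) by simp
    show "\<not> (\<exists>p. length p = k + 1 \<and> distinct p \<and> set p \<subseteq> ?S \<and> successively E p)"
      using Suc.prems(2) by blast
  qed
  have "card {u \<in> S. E w u} = card {u \<in> ?S. E w u} + (if E w v then 1 else 0)" if "w \<in> ?S" for w
  proof (cases "E w v")
    case True
    then have "{u \<in> S. E w u} = insert v {u \<in> ?S. E w u}" using v by auto
    then show ?thesis using True Suc.prems by simp
  next
    case False
    then have "{u \<in> S. E w u} = {u \<in> ?S. E w u}" by auto
    then show ?thesis using False by simp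
  qed
  then have "(\<Sum>w\<in>?S. card {u \<in> S. E w u}) =
      (\<Sum>w\<in>?S. card {u \<in> ?S. E w u} + (if E w v then 1 else 0))"
    by (rule sum.cong[OF refl])
  then have "(\<Sum>w\<in>?S. card {u \<in> S. E w u}) =
      (\<Sum>w\<in>?S. card {u \<in> ?S. E w u}) + (\<Sum>w\<in>?S. if E w v then 1 else 0)"
    unfolding sum.distrib .
  moreover have "(\<Sum>w\<in>?S. if E w v then 1 else 0) = card {w \<in> ?S. E w v}"
    using Suc.prems by (simp add: sum.If_cases Int_def)
  moreover have "card {w \<in> ?S. E w v} \<le> card {u \<in> S. E v u}"
    by (rule card_mono) (use Suc.prems in simp, blast intro: sym)
  moreover have "(\<Sum>w\<in>S. card {u \<in> S. E w u}) = card {u \<in> S. E v u} + (\<Sum>w\<in>?S. card {u \<in> S. E w u})"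
    using sum.remove[OF Suc.prems(1) v(1)] by simp
  moreover have "card S = card ?S + 1" using card.remove[OF Suc.prems(1) v(1)] by simp
  ultimately have "(\<Sum>w\<in>S. card {u \<in> S. E w u}) \<le> 2 * k * card ?S + 2 * k" "card S = card ?S + 1"
    using IH v(2) by linarith+
  then show ?case by simp
qed

text \<open>The edge joins \<open>u\<close> to the \<open>q\<close>-th vertex \<open>y\<close> of
  the path. The \<open>q - 1\<close> vertices before \<open>y\<close> and the \<open>r - 1\<close>
  vertices after it, the latter read backwards, are the inner vertices.\<close>

lemma theta_fan:
  assumes "length p = q + r - 1" "q \<ge> 2" "r \<ge> 2" "distinct p" "successively E p"
    and nbr: "\<And>v. v \<in> set p \<Longrightarrow> E u v"
    and sym: "\<And>u v. E u v \<Longrightarrow> E v u" and irrefl: "\<And>v. \<not> E v v"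
  shows "has_theta E q r"
proof -
  define P where "P = take (q - 1) p"
  define y where "y = p ! (q - 1)"
  define Q where "Q = drop q p"
  have p: "p = P @ y # Q" unfolding P_def y_def Q_def
    using assms(1-3) id_take_nth_drop[of "q - 1" p] by simp
  have len: "length P + 1 = q" "length Q + 1 = r" using assms by (auto simp: P_def Q_def)
  have u: "u \<notin> set p" using nbr irrefl by blast
  have "E u y" "u \<noteq> y" using nbr p u by auto
  moreover have "successively E (P @ [y])" "E u (hd (P @ [y]))"
    using assms(5) p nbr by (simp_all add: successively_append_iff successively_Cons hd_append)
  then have "inner_path E {u, y} u P y"
    using assms(4) u p by (auto simp: inner_path_def successively_Cons)
  moreover have "successively E (y # Q)"
    using assms(5) p by (auto simp: successively_append_iff successively_Cons)
  then have "successively (\<lambda>a b. E b a) (y # Q)"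
    by (rule successively_mono) (rule sym)
  then have "successively E (rev Q @ [y])" using successively_rev[of E "y # Q"] by simp
  then have "inner_path E ({u, y} \<union> set P) u (rev Q) y"
    using assms(4) u p nbr len by (cases "rev Q") (auto simp: inner_path_def successively_Cons)
  ultimately show ?thesis using has_thetaI[of E u y P q "rev Q" r] len by simp
qed

section \<open>The spectral radius as a Rayleigh quotient\<close>

text \<open>Compactness of the unit sphere. Vectors are functions on the whole type, so coordinates
  outside \<open>V\<close> are frozen at \<open>0\<close>; the domain is then closed in a product of
  compact sets.\<close>

lemma quadratic_form_attains_max:
  fixes V :: "'a set"
  assumes "finite V" "V \<noteq> {}" "finite R" "R \<subseteq> V \<times> V"
  obtains x :: "'a \<Rightarrow> real" where "(\<Sum>v\<in>V. (x v)\<^sup>2) = 1"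
    "\<And>y. (\<Sum>v\<in>V. (y v)\<^sup>2) = 1 \<Longrightarrow>
       (\<Sum>(u, v)\<in>R. y u * y v) \<le> (\<Sum>(u, v)\<in>R. x u * x v)"
proof -
  define C :: "('a \<Rightarrow> real) set" where "C = PiE UNIV (\<lambda>i. if i \<in> V then {-1..1} else {0})"
  define S where "S = C \<inter> {y. (\<Sum>v\<in>V. (y v)\<^sup>2) = 1}"
  have "compactin (product_topology (\<lambda>i. euclidean) UNIV) C"
    unfolding C_def compactin_PiE by auto
  then have "compact C" by (simp add: euclidean_product_topology)
  moreover have "closed {y :: 'a \<Rightarrow> real. (\<Sum>v\<in>V. (y v)\<^sup>2) = 1}"
    by (intro closed_Collect_eq continuous_intros continuous_on_product_coordinates)
  ultimately have "compact S" unfolding S_def by (rule compact_Int_closed)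
  obtain v0 where v0: "v0 \<in> V" using assms(2) by blast
  have "(\<Sum>v\<in>V. (if v = v0 then 1 else 0 :: real)\<^sup>2) = (\<Sum>v\<in>V. if v = v0 then 1 else 0)"
    by (rule sum.cong) auto
  also have "\<dots> = 1" using v0 assms(1) by simp
  finally have "(\<lambda>i. if i = v0 then 1 else 0) \<in> S"
    using v0 by (auto simp: S_def C_def)
  then have "S \<noteq> {}" by blast
  have "continuous_on S (\<lambda>y. \<Sum>(u, v)\<in>R. y u * y v)"
    unfolding split_def
    by (intro continuous_intros continuous_on_subset[OF continuous_on_product_coordinates]) auto
  from continuous_attains_sup[OF \<open>compact S\<close> \<open>S \<noteq> {}\<close> this]
  obtain x where x: "x \<in> S"
    "\<And>y. y \<in> S \<Longrightarrow> (\<Sum>(u, v)\<in>R. y u * y v) \<le> (\<Sum>(u, v)\<in>R. x u * x v)" by blast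
  show ?thesis
  proof
    show "(\<Sum>v\<in>V. (x v)\<^sup>2) = 1" using x(1) by (simp add: S_def)
    fix y :: "'a \<Rightarrow> real" assume y: "(\<Sum>v\<in>V. (y v)\<^sup>2) = 1"
    let ?y = "\<lambda>i. if i \<in> V then y i else 0"
    have "\<bar>y v\<bar> \<le> 1" if "v \<in> V" for v
      using member_le_sum[of v V "\<lambda>v. (y v)\<^sup>2"] assms(1) that y by (simp add: abs_square_le_1)
    then have "?y \<in> S" using y by (auto simp: S_def C_def abs_le_iff)
    moreover have "(\<Sum>(u, v)\<in>R. ?y u * ?y v) = (\<Sum>(u, v)\<in>R. y u * y v)"
      using assms(4) by (intro sum.cong) auto
    ultimately show "(\<Sum>(u, v)\<in>R. y u * y v) \<le> (\<Sum>(u, v)\<in>R. x u * x v)" using x(2) by force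
  qed
qed

text \<open>The first-order condition at a maximum. A nonzero slope \<open>b\<close> is refuted by
  \<open>t = b / k\<close> with \<open>2 * k > c\<close>.\<close>

lemma vanishing_slope:
  fixes b c :: real
  assumes "\<And>t. 2 * t * b \<le> c * t\<^sup>2"
  shows "b = 0"
proof (rule ccontr)
  assume "b \<noteq> 0"
  define k t where "k = \<bar>c\<bar> + 1" and "t = b / k"
  have k: "k > 0" "2 * k - c > 0" by (auto simp: k_def)
  then have t: "t \<noteq> 0" "b = t * k" using \<open>b \<noteq> 0\<close> by (auto simp: t_def)
  have "0 < t\<^sup>2 * (2 * k - c)" using t k by simp
  moreover have "2 * t * b \<le> c * t\<^sup>2" by (rule assms)
  ultimately show False using t(2) by (simp add: power2_eq_square algebra_simps)
qed

lemma (in pair_graph) sum_parcs: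
  "(\<Sum>(u, v)\<in>parcs G. f u v) = (\<Sum>u\<in>pverts G. \<Sum>v | (u, v) \<in> parcs G. f u v)"
proof -
  have "(\<Sum>u\<in>pverts G. \<Sum>v | (u, v) \<in> parcs G. f u v) =
      (\<Sum>(u, v)\<in>(SIGMA u:pverts G. {v. (u, v) \<in> parcs G}). f u v)"
    by (rule sum.Sigma)
      (auto intro!: finite_subset[OF _ pair_finite_verts] dest: wellformed')
  also have "(SIGMA u:pverts G. {v. (u, v) \<in> parcs G}) = parcs G"
    by (auto dest: wellformed')
  finally show ?thesis by simp
qed

text \<open>The absence of loops rules out a term in \<open>t\<^sup>2\<close>; the factor
  \<open>2\<close> comes from the two arcs of each edge at \<open>v\<close>.\<close>

lemma (in pair_graph) quadratic_form_perturb: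
  fixes x :: "'a \<Rightarrow> real"
  assumes v: "v \<in> pverts G"
  shows "(\<Sum>(a, b)\<in>parcs G. (x(v := x v + t)) a * (x(v := x v + t)) b) =
    (\<Sum>(a, b)\<in>parcs G. x a * x b) + 2 * t * (\<Sum>u | (v, u) \<in> parcs G. x u)"
proof -
  have split: "(x(v := x v + t)) a * (x(v := x v + t)) b =
      x a * x b + ((if a = v then t * x b else 0) + (if b = v then t * x a else 0))"
    if "(a, b) \<in> parcs G" for a b
    using pair_no_loops[OF that] by (auto simp: algebra_simps)
  have 1: "(\<Sum>(a, b)\<in>parcs G. if a = v then t * x b else 0) = t * (\<Sum>u | (v, u) \<in> parcs G. x u)"
  proof -
    have "(\<Sum>b | (a, b) \<in> parcs G. if a = v then t * x b else 0) =
        (if a = v then t * (\<Sum>u | (v, u) \<in> parcs G. x u) else 0)" for a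
      by (simp add: sum_distrib_left)
    then show ?thesis using v pair_finite_verts by (subst sum_parcs) simp
  qed
  have "(\<Sum>(a, b)\<in>parcs G. if b = v then t * x a else 0) =
      (\<Sum>(a, b)\<in>parcs G. if a = v then t * x b else 0)"
    by (rule sum.reindex_bij_witness[of _ prod.swap prod.swap])
      (auto dest: pair_sym_arcs[unfolded symmetric_def, THEN symD, simplified] intro: arcs_symmetric)
  with 1 have 2: "(\<Sum>(a, b)\<in>parcs G. if b = v then t * x a else 0) =
      t * (\<Sum>u | (v, u) \<in> parcs G. x u)" by simp
  have "(\<Sum>(a, b)\<in>parcs G. (x(v := x v + t)) a * (x(v := x v + t)) b) =
      (\<Sum>(a, b)\<in>parcs G. x a * x b + ((if a = v then t * x b else 0) + (if b = v then t * x a else 0)))"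
    by (rule sum.cong) (auto simp only: split prod.case)
  also have "\<dots> = (\<Sum>(a, b)\<in>parcs G. x a * x b) +
      ((\<Sum>(a, b)\<in>parcs G. if a = v then t * x b else 0) + (\<Sum>(a, b)\<in>parcs G. if b = v then t * x a else 0))"
    by (simp add: split_def sum.distrib)
  finally show ?thesis using 1 2 by simp
qed

lemma (in pair_graph) quadratic_form_eigenvector:
  fixes y :: "'a \<Rightarrow> real"
  assumes "\<And>v. v \<in> pverts G \<Longrightarrow> (\<Sum>u | (v, u) \<in> parcs G. y u) = k * y v"
  shows "(\<Sum>(u, v)\<in>parcs G. y u * y v) = k * (\<Sum>v\<in>pverts G. (y v)\<^sup>2)"
proof -
  have "(\<Sum>(u, v)\<in>parcs G. y u * y v) = (\<Sum>v\<in>pverts G. y v * (k * y v))"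
    unfolding sum_parcs sum_distrib_left[symmetric] using assms by (intro sum.cong) auto
  then show ?thesis by (simp add: power2_eq_square sum_distrib_left mult_ac)
qed

text \<open>Absolute values turn a maximiser of the quadratic form into a nonnegative one, because
  all coefficients are nonnegative. Scaling extends the maximality to the Rayleigh inequality, and
  perturbing one coordinate of the maximiser gives the eigenvector equation there.\<close>

lemma (in pair_graph) perron_vector_exists:
  assumes "pverts G \<noteq> {}"
  obtains l :: real and x where "\<And>v. x v \<ge> 0" "(\<Sum>v\<in>pverts G. (x v)\<^sup>2) = 1"
    "\<And>v. v \<in> pverts G \<Longrightarrow> (\<Sum>u | (v, u) \<in> parcs G. x u) = l * x v"
    "\<And>y. (\<Sum>(u, v)\<in>parcs G. y u * y v) \<le> l * (\<Sum>v\<in>pverts G. (y v)\<^sup>2)"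
proof -
  let ?V = "pverts G" and ?R = "parcs G"
  have "?R \<subseteq> ?V \<times> ?V" by (auto dest: wellformed')
  then obtain z :: "'a \<Rightarrow> real" where z: "(\<Sum>v\<in>?V. (z v)\<^sup>2) = 1"
    "\<And>y. (\<Sum>v\<in>?V. (y v)\<^sup>2) = 1 \<Longrightarrow>
       (\<Sum>(u, v)\<in>?R. y u * y v) \<le> (\<Sum>(u, v)\<in>?R. z u * z v)"
    using quadratic_form_attains_max[OF pair_finite_verts assms pair_finite_arcs] by blast
  define x where "x v = \<bar>z v\<bar>" for v
  define l where "l = (\<Sum>(u, v)\<in>?R. x u * x v)"
  have x1: "(\<Sum>v\<in>?V. (x v)\<^sup>2) = 1" using z(1) by (simp add: x_def)
  have zl: "(\<Sum>(u, v)\<in>?R. z u * z v) \<le> l"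
    unfolding l_def by (intro sum_mono) (auto simp: x_def simp flip: abs_mult)
  have ray: "(\<Sum>(u, v)\<in>?R. y u * y v) \<le> l * (\<Sum>v\<in>?V. (y v)\<^sup>2)" for y
  proof (cases "(\<Sum>v\<in>?V. (y v)\<^sup>2) = 0")
    case True
    then have "\<forall>v\<in>?V. y v = 0" using pair_finite_verts by (simp add: sum_nonneg_eq_0_iff)
    then have "(\<Sum>(u, v)\<in>?R. y u * y v) = 0" by (intro sum.neutral) (auto dest: wellformed')
    then show ?thesis using True by simp
  next
    case False
    define s where "s = (\<Sum>v\<in>?V. (y v)\<^sup>2)"
    have s: "s > 0" using False by (simp add: s_def sum_nonneg less_le)
    let ?y = "\<lambda>v. y v / sqrt s"
    have "(\<Sum>v\<in>?V. (?y v)\<^sup>2) = (\<Sum>v\<in>?V. (y v)\<^sup>2) / s"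
      using s by (simp add: power_divide sum_divide_distrib)
    then have "(\<Sum>v\<in>?V. (?y v)\<^sup>2) = 1" using s by (simp flip: s_def)
    then have "(\<Sum>(u, v)\<in>?R. ?y u * ?y v) \<le> l" using z(2)[of ?y] zl by linarith
    moreover have "(\<Sum>(u, v)\<in>?R. ?y u * ?y v) = (\<Sum>(u, v)\<in>?R. y u * y v) / s"
      using s by (simp add: sum_divide_distrib split_def)
    ultimately show ?thesis using s by (simp add: pos_divide_le_eq flip: s_def)
  qed
  have eig: "(\<Sum>u | (v, u) \<in> ?R. x u) = l * x v" if v: "v \<in> ?V" for v
  proof -
    have "2 * t * ((\<Sum>u | (v, u) \<in> ?R. x u) - l * x v) \<le> l * t\<^sup>2" for t
    proof -
      have "(\<Sum>w\<in>?V. ((x(v := x v + t)) w)\<^sup>2) = (x v + t)\<^sup>2 + (\<Sum>w\<in>?V - {v}. (x w)\<^sup>2)"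
        using sum.remove[OF pair_finite_verts v, of "\<lambda>w. ((x(v := x v + t)) w)\<^sup>2"] by simp
      moreover have "(\<Sum>w\<in>?V. (x w)\<^sup>2) = (x v)\<^sup>2 + (\<Sum>w\<in>?V - {v}. (x w)\<^sup>2)"
        by (rule sum.remove[OF pair_finite_verts v])
      ultimately have "(\<Sum>w\<in>?V. ((x(v := x v + t)) w)\<^sup>2) = 1 + 2 * t * x v + t\<^sup>2"
        using x1 by (simp add: power2_eq_square algebra_simps)
      with ray[of "x(v := x v + t)"] quadratic_form_perturb[OF v, of x t]
      show ?thesis unfolding l_def[symmetric] by (simp add: algebra_simps)
    qed
    from vanishing_slope[OF this] show ?thesis by simp
  qed
  show ?thesis by (rule that[OF _ x1 eig ray]) (simp add: x_def)
qed

section \<open>From matrix eigenvalues to functions on the vertices\<close>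

lemma eigenvalue_adjacency_matrix_iff:
  fixes G :: "'a::linorder pair_pre_digraph"
  assumes "pair_graph G"
  shows "eigenvalue (adjacency_matrix G) (l :: real) \<longleftrightarrow>
    (\<exists>y :: 'a \<Rightarrow> real. (\<exists>v\<in>pverts G. y v \<noteq> 0) \<and>
      (\<forall>v\<in>pverts G. (\<Sum>u | (v, u) \<in> parcs G. y u) = l * y v))"
    (is "?L \<longleftrightarrow> ?R")
proof -
  interpret pair_graph G by fact
  define n where "n = card (pverts G)"
  define vs where "vs = sorted_list_of_set (pverts G)"
  have vs: "distinct vs" "set vs = pverts G" "length vs = n"
    by (simp_all add: vs_def n_def pair_finite_verts)
  have bij: "bij_betw ((!) vs) {..<n} (pverts G)"
    using bij_betw_nth[OF vs(1), of "{..<n}" "pverts G"] vs by simp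
  let ?A = "adjacency_matrix G"
  have dim: "dim_row ?A = n" "dim_col ?A = n"
    by (simp_all add: adjacency_matrix_def Let_def n_def)
  have A: "?A = mat n n (\<lambda>(i, j). if (vs ! i, vs ! j) \<in> parcs G then 1 else 0)"
    by (simp add: adjacency_matrix_def Let_def n_def vs_def)
  have row: "(?A *\<^sub>v w) $ i = (\<Sum>u | (vs ! i, u) \<in> parcs G. y u)"
    if i: "i < n" and w: "dim_vec w = n" and y: "\<And>j. j < n \<Longrightarrow> y (vs ! j) = w $ j" for w y i
  proof -
    have "(?A *\<^sub>v w) $ i = (\<Sum>j<n. (if (vs ! i, vs ! j) \<in> parcs G then 1 else 0) * w $ j)"
      using i w unfolding A by (simp add: scalar_prod_def atLeast0LessThan)
    also have "\<dots> = (\<Sum>j<n. if (vs ! i, vs ! j) \<in> parcs G then y (vs ! j) else 0)"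
      using y by (intro sum.cong) auto
    also have "\<dots> = (\<Sum>u\<in>pverts G. if (vs ! i, u) \<in> parcs G then y u else 0)"
      by (rule sum.reindex_bij_betw[OF bij])
    also have "\<dots> = (\<Sum>u | u \<in> pverts G \<and> (vs ! i, u) \<in> parcs G. y u)"
      using pair_finite_verts by (simp add: sum.If_cases Int_def)
    also have "\<dots> = (\<Sum>u | (vs ! i, u) \<in> parcs G. y u)"
      by (rule sum.cong) (auto dest: wellformed')
    finally show ?thesis .
  qed
  show ?thesis
  proof
    assume ?L
    then obtain w where "w \<in> carrier_vec n" and w': "w \<noteq> 0\<^sub>v n" "?A *\<^sub>v w = l \<cdot>\<^sub>v w"
      unfolding eigenvalue_def eigenvector_def dim by blast
    then have w: "dim_vec w = n" "w \<noteq> 0\<^sub>v n" "?A *\<^sub>v w = l \<cdot>\<^sub>v w" by auto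
    define y where "y v = w $ (the_inv_into {..<n} ((!) vs) v)" for v
    have y: "y (vs ! j) = w $ j" if "j < n" for j
      unfolding y_def using bij that by (subst the_inv_into_f_f) (auto simp: bij_betw_def)
    obtain j where j: "j < n" "w $ j \<noteq> 0"
    proof (rule ccontr)
      assume "\<not> thesis"
      then have "w = 0\<^sub>v n" using that w(1) by (intro eq_vecI) auto
      then show False using w(2) by simp
    qed
    have "(\<Sum>u | (v, u) \<in> parcs G. y u) = l * y v" if v: "v \<in> pverts G" for v
    proof -
      obtain i where i: "i < n" "v = vs ! i" using v in_set_conv_nth[of v vs] vs(2,3) by auto
      show ?thesis using row[OF i(1) w(1) y] w i y by simp
    qed
    moreover have "vs ! j \<in> pverts G" "y (vs ! j) \<noteq> 0" using j y nth_mem[of j vs] vs by simp_all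
    ultimately show ?R by blast
  next
    assume ?R
    then obtain y :: "'a \<Rightarrow> real" and v where y: "v \<in> pverts G" "y v \<noteq> 0"
      "\<And>v. v \<in> pverts G \<Longrightarrow> (\<Sum>u | (v, u) \<in> parcs G. y u) = l * y v" by blast
    define w where "w = vec n (\<lambda>i. y (vs ! i))"
    have w: "dim_vec w = n" "\<And>j. j < n \<Longrightarrow> y (vs ! j) = w $ j" by (simp_all add: w_def)
    obtain i where "i < n" "v = vs ! i" using y(1) in_set_conv_nth[of v vs] vs(2,3) by auto
    then have "w \<noteq> 0\<^sub>v n" using y(2) w(2) by auto
    moreover have "?A *\<^sub>v w = l \<cdot>\<^sub>v w"
    proof (rule eq_vecI)
      show "dim_vec (?A *\<^sub>v w) = dim_vec (l \<cdot>\<^sub>v w)" using w dim by simp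
      fix i assume "i < dim_vec (l \<cdot>\<^sub>v w)"
      then have i: "i < n" using w by simp
      then have "vs ! i \<in> pverts G" using vs nth_mem by blast
      then show "(?A *\<^sub>v w) $ i = (l \<cdot>\<^sub>v w) $ i" using row[OF i w] y(3) w i by simp
    qed
    moreover have "w \<in> carrier_vec n" using w(1) by (rule carrier_vecI)
    ultimately show ?L unfolding eigenvalue_def eigenvector_def dim by blast
  qed
qed

text \<open>The maximal Rayleigh quotient is an eigenvalue, and it dominates every other one: insert
  an eigenvector into the Rayleigh inequality.\<close>

lemma graph_spectral_radius_perron:
  fixes G :: "'a::linorder pair_pre_digraph"
  assumes "pair_graph G" "pverts G \<noteq> {}"
  obtains x where "\<And>v. x v \<ge> 0" "(\<Sum>v\<in>pverts G. (x v)\<^sup>2) = 1"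
    "\<And>v. v \<in> pverts G \<Longrightarrow> (\<Sum>u | (v, u) \<in> parcs G. x u) = graph_spectral_radius G * x v"
    "\<And>y. (\<Sum>(u, v)\<in>parcs G. y u * y v) \<le> graph_spectral_radius G * (\<Sum>v\<in>pverts G. (y v)\<^sup>2)"
proof -
  interpret pair_graph G by fact
  obtain l :: real and x where x: "\<And>v. x v \<ge> 0" "(\<Sum>v\<in>pverts G. (x v)\<^sup>2) = 1"
    "\<And>v. v \<in> pverts G \<Longrightarrow> (\<Sum>u | (v, u) \<in> parcs G. x u) = l * x v"
    "\<And>y. (\<Sum>(u, v)\<in>parcs G. y u * y v) \<le> l * (\<Sum>v\<in>pverts G. (y v)\<^sup>2)"
    using perron_vector_exists[OF assms(2)] by metis
  let ?S = "spectrum (adjacency_matrix G)"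
  have "adjacency_matrix G \<in> carrier_mat (card (pverts G)) (card (pverts G))"
    by (simp add: adjacency_matrix_def Let_def)
  then have fin: "finite ?S" by (rule card_finite_spectrum)
  have "\<exists>v\<in>pverts G. x v \<noteq> 0"
  proof (rule ccontr)
    assume "\<not> ?thesis"
    then have "(\<Sum>v\<in>pverts G. (x v)\<^sup>2) = 0" by simp
    then show False using x(2) by simp
  qed
  then have "l \<in> ?S" using eigenvalue_adjacency_matrix_iff[OF assms(1)] x(3)
    by (auto simp: spectrum_def)
  moreover have "k \<le> l" if "k \<in> ?S" for k
  proof -
    from that obtain y :: "'a \<Rightarrow> real" and v where y: "v \<in> pverts G" "y v \<noteq> 0"
      "\<And>v. v \<in> pverts G \<Longrightarrow> (\<Sum>u | (v, u) \<in> parcs G. y u) = k * y v"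
      using eigenvalue_adjacency_matrix_iff[OF assms(1)] by (auto simp: spectrum_def)
    have "(\<Sum>v\<in>pverts G. (y v)\<^sup>2) > 0"
      using y pair_finite_verts by (intro sum_pos2[of _ v]) auto
    moreover have "(\<Sum>(u, v)\<in>parcs G. y u * y v) = k * (\<Sum>v\<in>pverts G. (y v)\<^sup>2)"
      by (rule quadratic_form_eigenvector) (rule y(3))
    ultimately show ?thesis using x(4)[of y] by simp
  qed
  ultimately have "Max ?S = l" using fin by (intro Max_eqI) auto
  then have "graph_spectral_radius G = l" by (simp add: graph_spectral_radius_def)
  then show ?thesis using x that by blast
qed

text \<open>The test vector is carried along \<open>f\<close> and extended by \<open>0\<close>. It
  is nonnegative, so the remaining arcs of \<open>G\<close> can only increase the form.\<close>

lemma graph_spectral_radius_ge: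
  fixes G :: "'a::linorder pair_pre_digraph" and K :: "'b pair_pre_digraph" and y :: "'b \<Rightarrow> real"
  assumes "pair_graph G" "pair_graph K" "pverts K \<noteq> {}"
    and f: "inj_on f (pverts K)" "f ` pverts K \<subseteq> pverts G"
      "\<And>u v. (u, v) \<in> parcs K \<Longrightarrow> (f u, f v) \<in> parcs G"
    and y: "\<And>v. y v \<ge> 0"
  shows "(\<Sum>(u, v)\<in>parcs K. y u * y v) \<le> graph_spectral_radius G * (\<Sum>v\<in>pverts K. (y v)\<^sup>2)"
proof -
  interpret G: pair_graph G by fact
  interpret K: pair_graph K by fact
  have "pverts G \<noteq> {}" using assms(3) f(2) by blast
  then obtain x :: "'a \<Rightarrow> real" where ray:
    "\<And>y. (\<Sum>(u, v)\<in>parcs G. y u * y v) \<le> graph_spectral_radius G * (\<Sum>v\<in>pverts G. (y v)\<^sup>2)"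
    using graph_spectral_radius_perron[OF assms(1)] by metis
  define z where "z v = (if v \<in> f ` pverts K then y (the_inv_into (pverts K) f v) else 0)" for v
  have zf: "z (f v) = y v" if "v \<in> pverts K" for v
    using that f(1) by (simp add: z_def the_inv_into_f_f)
  have z0: "z v \<ge> 0" for v using y by (simp add: z_def)
  have inj: "inj_on (map_prod f f) (parcs K)"
    by (rule inj_on_subset[OF map_prod_inj_on[OF f(1) f(1)]]) (auto dest: K.wellformed')
  have "(\<Sum>(u, v)\<in>parcs K. y u * y v) = (\<Sum>e\<in>parcs K. (\<lambda>(u, v). z u * z v) (map_prod f f e))"
  proof (rule sum.cong[OF refl], clarify)
    fix u v assume "(u, v) \<in> parcs K"
    then have "u \<in> pverts K" "v \<in> pverts K" using K.wellformed' by auto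
    then show "y u * y v = (case map_prod f f (u, v) of (u, v) \<Rightarrow> z u * z v)" by (simp add: zf)
  qed
  also have "\<dots> = (\<Sum>(u, v)\<in>map_prod f f ` parcs K. z u * z v)"
    using sum.reindex[OF inj, of "\<lambda>(u, v). z u * z v"] by (simp add: comp_def)
  also have "\<dots> \<le> (\<Sum>(u, v)\<in>parcs G. z u * z v)"
    using f(3) z0 G.pair_finite_arcs by (intro sum_mono2) auto
  also have "\<dots> \<le> graph_spectral_radius G * (\<Sum>v\<in>pverts G. (z v)\<^sup>2)" by (rule ray)
  also have "(\<Sum>v\<in>pverts G. (z v)\<^sup>2) = (\<Sum>v\<in>f ` pverts K. (z v)\<^sup>2)"
    using f(2) G.pair_finite_verts by (intro sum.mono_neutral_right) (auto simp: z_def)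
  also have "\<dots> = (\<Sum>v\<in>pverts K. (y v)\<^sup>2)"
    using f(1) by (simp add: sum.reindex zf)
  finally show ?thesis .
qed

lemma graph_spectral_radius_mono:
  fixes G H :: "'a::linorder pair_pre_digraph"
  assumes "pair_graph G" "pair_graph H" "pverts H \<noteq> {}"
    and f: "inj_on f (pverts H)" "f ` pverts H \<subseteq> pverts G"
      "\<And>u v. (u, v) \<in> parcs H \<Longrightarrow> (f u, f v) \<in> parcs G"
  shows "graph_spectral_radius H \<le> graph_spectral_radius G"
proof -
  interpret H: pair_graph H by fact
  obtain x :: "'a \<Rightarrow> real" where x: "\<And>v. x v \<ge> 0" "(\<Sum>v\<in>pverts H. (x v)\<^sup>2) = 1"
    "\<And>v. v \<in> pverts H \<Longrightarrow> (\<Sum>u | (v, u) \<in> parcs H. x u) = graph_spectral_radius H * x v"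
    using graph_spectral_radius_perron[OF assms(2,3)] by metis
  have "(\<Sum>(u, v)\<in>parcs H. x u * x v) = graph_spectral_radius H * (\<Sum>v\<in>pverts H. (x v)\<^sup>2)"
    by (rule H.quadratic_form_eigenvector) (rule x(3))
  then show ?thesis
    using graph_spectral_radius_ge[where y = x, OF assms(1,2,3) f x(1)] x(2) by simp
qed

section \<open>Theta subgraphs as pairs of paths\<close>

lemma graph_iso_image:
  assumes "pair_graph H" and f: "inj_on f (pverts H)"
  defines "H' \<equiv> \<lparr>pverts = f ` pverts H, parcs = map_prod f f ` parcs H\<rparr>"
  shows "pair_graph H'" "graph_iso H H'"
proof -
  interpret H: pair_graph H by fact
  have sym: "(v, u) \<in> parcs H" if "(u, v) \<in> parcs H" for u v
    using that H.arcs_symmetric by blast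
  have wf: "u \<in> pverts H" "v \<in> pverts H" if "(u, v) \<in> parcs H" for u v
    using H.wellformed'[OF that] by auto
  have ne: "f u \<noteq> f v" if "(u, v) \<in> parcs H" for u v
    using H.pair_no_loops[OF that] inj_onD[OF f] wf[OF that] by auto
  have "symmetric (with_proj H')"
    unfolding symmetric_def sym_def by (auto simp: H'_def dest: sym)
  then show pg: "pair_graph H'"
    using H.pair_finite_verts H.pair_finite_arcs
    by unfold_locales (auto simp: H'_def dest: wf ne)
  show "graph_iso H H'"
    unfolding graph_iso_iff[OF assms(1) pg]
  proof (intro exI[of _ f] conjI ballI)
    show "bij_betw f (pverts H) (pverts H')" using f by (simp add: bij_betw_def H'_def)
    fix u v assume uv: "u \<in> pverts H" "v \<in> pverts H"
    show "(u, v) \<in> parcs H \<longleftrightarrow> (f u, f v) \<in> parcs H'"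
    proof
      assume "(f u, f v) \<in> parcs H'"
      then obtain a b where ab: "(a, b) \<in> parcs H" "f u = f a" "f v = f b" by (auto simp: H'_def)
      then show "(u, v) \<in> parcs H" using uv wf[OF ab(1)] inj_onD[OF f] by metis
    qed (force simp: H'_def)
  qed
qed

lemma not_free_of_iff:
  assumes "pair_graph H" "pair_graph G"
  shows "\<not> free_of H G \<longleftrightarrow> (\<exists>f. inj_on f (pverts H) \<and> f ` pverts H \<subseteq> pverts G \<and>
    (\<forall>u v. (u, v) \<in> parcs H \<longrightarrow> (f u, f v) \<in> parcs G))" (is "_ \<longleftrightarrow> (\<exists>f. ?P f)")
proof
  interpret H: pair_graph H by fact
  interpret G: pair_graph G by fact
  assume "\<not> free_of H G"
  then obtain H' where H': "pair_graph H'" "subgraph (with_proj H') (with_proj G)" "graph_iso H H'"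
    by (auto simp: free_of_def)
  from H'(2) have sub: "pverts H' \<subseteq> pverts G" "parcs H' \<subseteq> parcs G" by (auto simp: subgraph_def)
  obtain f where f: "bij_betw f (pverts H) (pverts H')"
    "\<And>u v. u \<in> pverts H \<Longrightarrow> v \<in> pverts H \<Longrightarrow> (u, v) \<in> parcs H \<longleftrightarrow> (f u, f v) \<in> parcs H'"
    using H'(3) unfolding graph_iso_iff[OF assms(1) H'(1)] by blast
  have "(f u, f v) \<in> parcs G" if "(u, v) \<in> parcs H" for u v
    using that f(2) H.wellformed'[OF that] sub(2) by blast
  then have "?P f" using f(1) sub(1) unfolding bij_betw_def by blast
  then show "\<exists>f. ?P f" by blast
next
  interpret H: pair_graph H by fact
  interpret G: pair_graph G by fact
  assume "\<exists>f. ?P f"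
  then obtain f where f: "inj_on f (pverts H)" "f ` pverts H \<subseteq> pverts G"
    "\<And>u v. (u, v) \<in> parcs H \<Longrightarrow> (f u, f v) \<in> parcs G" by blast
  define H' where "H' = \<lparr>pverts = f ` pverts H, parcs = map_prod f f ` parcs H\<rparr>"
  have pg: "pair_graph H'" and iso: "graph_iso H H'"
    unfolding H'_def using graph_iso_image[OF assms(1) f(1)] by blast+
  interpret H': pair_graph H' by (rule pg)
  have "subgraph (with_proj H') (with_proj G)"
    using f G.wf_digraph H'.wf_digraph by (auto simp: subgraph_def H'_def compatible_def)
  then show "\<not> free_of H G" using pg iso by (auto simp: free_of_def)
qed

lemma parcs_theta_graph_iff:
  "(x, y) \<in> parcs (theta_graph ls) \<longleftrightarrow> (\<exists>i j. i < length ls \<and> j < ls ! i \<and>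
      ((x, y) = (theta_at ls i j, theta_at ls i (Suc j)) \<or>
       (y, x) = (theta_at ls i j, theta_at ls i (Suc j))))"
  by (auto simp: theta_graph_def mk_symmetric_def)

lemma pverts_theta_graph:
  "pverts (theta_graph ls) = {theta_at ls i j | i j. i < length ls \<and> j \<le> ls ! i}"
  by (simp add: theta_graph_def mk_symmetric_def)

text \<open>Entry \<open>j\<close> of \<open>u # path i @ [v]\<close> corresponds to
  \<open>theta_at [1, q, r] i j\<close>; path \<open>0\<close> has no inner vertex and is the
  edge.\<close>

lemma free_of_theta_iff:
  assumes "pair_graph G" "q \<ge> 2" "r \<ge> 2"
  shows "free_of (theta_graph [1, q, r]) G \<longleftrightarrow> \<not> has_theta (\<lambda>u v. (u, v) \<in> parcs G) q r"
proof -
  interpret pair_graph G by fact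
  let ?ls = "[1, q, r]" and ?E = "\<lambda>u v. (u, v) \<in> parcs G"
  let ?T = "theta_graph ?ls"
  interpret T: pair_graph ?T by (rule pair_graph_theta_graph)
  note iff = not_free_of_iff[OF pair_graph_theta_graph assms(1), of ?ls]
  have "\<not> free_of ?T G \<longleftrightarrow> has_theta ?E q r"
  proof
    assume "\<not> free_of ?T G"
    then obtain f where f: "inj_on f (pverts ?T)" "\<And>u v. (u, v) \<in> parcs ?T \<Longrightarrow> (f u, f v) \<in> parcs G"
      unfolding iff by blast
    define path where "path i = map (\<lambda>j. f (Inner i j)) [1..<?ls ! i]" for i
    have full: "f Source # path i @ [f Sink] = map (\<lambda>j. f (theta_at ?ls i j)) [0..<Suc (?ls ! i)]"
      if "i \<in> {1, 2}" for i
    proof -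
      have "?ls ! i \<noteq> 0" using that assms by auto
      then have "[0..<Suc (?ls ! i)] = 0 # [1..<?ls ! i] @ [?ls ! i]"
        by (simp add: upt_conv_Cons)
      then show ?thesis using \<open>?ls ! i \<noteq> 0\<close> by (simp add: path_def theta_at_def)
    qed
    have succ: "successively ?E (f Source # path i @ [f Sink])" if "i \<in> {1, 2}" for i
      unfolding full[OF that] successively_conv_nth
    proof (intro allI impI)
      fix j assume "Suc j < length (map (\<lambda>j. f (theta_at ?ls i j)) [0..<Suc (?ls ! i)])"
      then have j: "j < ?ls ! i" by simp
      have "(theta_at ?ls i j, theta_at ?ls i (Suc j)) \<in> parcs ?T"
        unfolding parcs_theta_graph_iff using j that by (intro exI[of _ i] exI[of _ j]) auto
      from f(2)[OF this] show "?E (map (\<lambda>j. f (theta_at ?ls i j)) [0..<Suc (?ls ! i)] ! j)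
          (map (\<lambda>j. f (theta_at ?ls i j)) [0..<Suc (?ls ! i)] ! Suc j)"
        using j by (simp del: upt_Suc)
    qed
    let ?L = "Source # Sink # map (Inner 1) [1..<q] @ map (Inner 2) [1..<r]"
    have "theta_at ?ls 0 0 = Source" "theta_at ?ls 0 1 = Sink" by (auto simp: theta_at_def)
    then have e: "(Source, Sink) \<in> parcs ?T"
      unfolding parcs_theta_graph_iff by (intro exI[of _ 0]) auto
    have "Inner i j \<in> pverts ?T" if "i \<in> {1, 2}" "1 \<le> j" "j < ?ls ! i" for i j
      using that unfolding pverts_theta_graph
      by (intro CollectI exI[of _ i] exI[of _ j]) (auto simp: theta_at_def)
    then have "set ?L \<subseteq> pverts ?T"
      using T.wellformed'[OF e] by auto
    then have "inj_on f (set ?L)" by (rule inj_on_subset[OF f(1)])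
    moreover have "distinct ?L" by (auto simp: distinct_map inj_on_def)
    ultimately have "distinct (map f ?L)" unfolding distinct_map by blast
    moreover have "map f ?L = f Source # f Sink # path 1 @ path 2"
      by (simp add: path_def)
    ultimately have "distinct (f Source # f Sink # path 1 @ path 2)" by metis
    moreover have "length (path 1) + 1 = q" "length (path 2) + 1 = r"
      using assms by (auto simp: path_def)
    ultimately show "has_theta ?E q r"
      unfolding has_theta_def using f(2)[OF e] succ[of 1] succ[of 2] by blast
  next
    assume "has_theta ?E q r"
    then obtain u v P Q where *: "?E u v" "length P + 1 = q" "length Q + 1 = r"
      "distinct (u # v # P @ Q)" "successively ?E (u # P @ [v])" "successively ?E (u # Q @ [v])"
      unfolding has_theta_def by blast
    define path where "path i = (if i = 0 then [] else if i = 1 then P else Q)" for i :: nat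
    have lp: "length (path i) + 1 = ?ls ! i" if "i < 3" for i
      using that * by (auto simp: path_def less_Suc_eq numeral_3_eq_3)
    have sp: "successively ?E (u # path i @ [v])" if "i < 3" for i
      using * by (auto simp: path_def)
    \<comment> \<open>Inner vertices are numbered from \<open>1\<close>, list entries from
      \<open>0\<close>.\<close>
    define f where "f x = (case x of Source \<Rightarrow> u | Sink \<Rightarrow> v | Inner i j \<Rightarrow> path i ! (j - 1))" for x
    have f_at: "f (theta_at ?ls i j) = (u # path i @ [v]) ! j" if "i < 3" "j \<le> ?ls ! i" for i j
      using that lp[OF that(1)] by (auto simp: f_def theta_at_def nth_Cons' nth_append)
    have arc: "(f x, f y) \<in> parcs G" if "(x, y) \<in> parcs ?T" for x y
    proof -
      from that obtain i j where "i < length ?ls" and ij': "j < ?ls ! i"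
        "(x, y) = (theta_at ?ls i j, theta_at ?ls i (Suc j)) \<or>
         (y, x) = (theta_at ?ls i j, theta_at ?ls i (Suc j))"
        unfolding parcs_theta_graph_iff by blast
      then have ij: "i < 3" "j < ?ls ! i"
        "(x, y) = (theta_at ?ls i j, theta_at ?ls i (Suc j)) \<or>
         (y, x) = (theta_at ?ls i j, theta_at ?ls i (Suc j))" by auto
      have "?E (f (theta_at ?ls i j)) (f (theta_at ?ls i (Suc j)))"
        using sp[OF ij(1)] ij(2) lp[OF ij(1)] f_at[OF ij(1)]
        unfolding successively_conv_nth by simp
      then show ?thesis using ij(3) arcs_symmetric by auto
    qed
    have verts: "pverts ?T \<subseteq> {Source, Sink} \<union> Inner 1 ` {1..<q} \<union> Inner 2 ` {1..<r}"
      unfolding pverts_theta_graph by (auto simp: theta_at_def less_Suc_eq numeral_3_eq_3)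
    have "inj_on f ({Source, Sink} \<union> Inner 1 ` {1..<q} \<union> Inner 2 ` {1..<r})"
    proof (rule inj_onI)
      have mem: "P ! (j - 1) \<in> set P" if "1 \<le> j" "j < q" for j using that * by auto
      have mem': "Q ! (j - 1) \<in> set Q" if "1 \<le> j" "j < r" for j using that * by auto
      have ne: "u \<noteq> v" "u \<notin> set P" "v \<notin> set P" "u \<notin> set Q" "v \<notin> set Q" "set P \<inter> set Q = {}"
        "distinct P" "distinct Q" using *(4) by auto
      fix x y assume xy: "x \<in> {Source, Sink} \<union> Inner 1 ` {1..<q} \<union> Inner 2 ` {1..<r}"
        "y \<in> {Source, Sink} \<union> Inner 1 ` {1..<q} \<union> Inner 2 ` {1..<r}" "f x = f y"
      have fs: "f Source = u" "f Sink = v" "f (Inner 1 j) = P ! (j - 1)" "f (Inner 2 j) = Q ! (j - 1)" for j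
        by (simp_all add: f_def path_def)
      have eqP: "i = j" if "P ! (i - 1) = P ! (j - 1)" "1 \<le> i" "i < q" "1 \<le> j" "j < q" for i j
        proof -
        have "i - 1 < length P" "j - 1 < length P" using that *(2,3) by linarith+
        then have "i - 1 = j - 1" using that(1) nth_eq_iff_index_eq[OF ne(7)] by blast
        then show ?thesis using that by linarith
      qed
      have eqQ: "i = j" if "Q ! (i - 1) = Q ! (j - 1)" "1 \<le> i" "i < r" "1 \<le> j" "j < r" for i j
        proof -
        have "i - 1 < length Q" "j - 1 < length Q" using that *(2,3) by linarith+
        then have "i - 1 = j - 1" using that(1) nth_eq_iff_index_eq[OF ne(8)] by blast
        then show ?thesis using that by linarith
      qed
      from xy show "x = y"
        apply (elim UnE insertE imageE emptyE; simp only: fs atLeastLessThan_iff)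
        using ne mem mem' eqP eqQ by (metis disjoint_iff)+
    qed
    then have "inj_on f (pverts ?T)" using verts by (rule inj_on_subset)
    moreover have "f ` pverts ?T \<subseteq> pverts G"
    proof safe
      fix x assume "x \<in> pverts ?T"
      then have "\<exists>y. (x, y) \<in> parcs ?T"
        unfolding pverts_theta_graph parcs_theta_graph_iff
      proof (elim CollectE exE conjE)
        fix i j assume ij: "x = theta_at ?ls i j" "i < length ?ls" "j \<le> ?ls ! i"
        have pos: "0 < ?ls ! i" using ij(2) assms by (auto simp: less_Suc_eq numeral_3_eq_3)
        show "\<exists>y i j. i < length ?ls \<and> j < ?ls ! i \<and>
          ((x, y) = (theta_at ?ls i j, theta_at ?ls i (Suc j)) \<or>
           (y, x) = (theta_at ?ls i j, theta_at ?ls i (Suc j)))"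
        proof (cases "j < ?ls ! i")
          case True
          then show ?thesis using ij by blast
        next
          case False
          then have "j = Suc (?ls ! i - 1)" "?ls ! i - 1 < ?ls ! i" using ij(3) pos by auto
          then show ?thesis using ij(1,2) by metis
        qed
      qed
      then show "f x \<in> pverts G" using arc wellformed' by blast
    qed
    ultimately show "\<not> free_of ?T G" unfolding iff using arc by blast
  qed
  then show ?thesis by blast
qed

section \<open>The extremal graphs\<close>

lemma pair_graph_complete_bipartite: "pair_graph (complete_bipartite a b)"
  by unfold_locales (auto simp: complete_bipartite_def Let_def symmetric_def sym_def)

lemma complete_bipartite_simps:
  "(Left i, Right j) \<in> parcs (complete_bipartite a b) \<longleftrightarrow> i < a \<and> j < b"
  "(Right j, Left i) \<in> parcs (complete_bipartite a b) \<longleftrightarrow> i < a \<and> j < b"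
  "(Left i, Left i') \<notin> parcs (complete_bipartite a b)"
  "(Right j, Right j') \<notin> parcs (complete_bipartite a b)"
  "(New k, x) \<notin> parcs (complete_bipartite a b)"
  "(x, New k) \<notin> parcs (complete_bipartite a b)"
  by (auto simp: complete_bipartite_def Let_def)

lemma pverts_complete_bipartite: "pverts (complete_bipartite a b) = Left ` {..<a} \<union> Right ` {..<b}"
  by (simp add: complete_bipartite_def Let_def)

lemma pverts_K_bullet_K3:
  "a > 0 \<Longrightarrow> b > 0 \<Longrightarrow> pverts (K_bullet_K3 a b) = Left ` {..<a} \<union> Right ` {..<b} \<union> {New 0}"
  by (auto simp: K_bullet_K3_def glue_complete_def pverts_complete_bipartite)

lemma pverts_K_circ_K3:
  "b > 0 \<Longrightarrow> pverts (K_circ_K3 a b) = Left ` {..<a} \<union> Right ` {..<b} \<union> {New 0, New 1}"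
  by (auto simp: K_circ_K3_def glue_complete_def pverts_complete_bipartite)

lemma pverts_SK: "pverts (SK a b) = Left ` {..<a} \<union> Right ` {..<b} \<union> {New 0}"
  by (auto simp: SK_def subdivide.simps pverts_complete_bipartite)

lemma parcs_K_bullet_K3: "parcs (K_bullet_K3 a b) = parcs (complete_bipartite a b) \<union>
    {(x, y). x \<in> {Left 0, Right 0, New 0} \<and> y \<in> {Left 0, Right 0, New 0} \<and> x \<noteq> y}"
  by (simp add: K_bullet_K3_def glue_complete_def)

lemma parcs_K_circ_K3: "parcs (K_circ_K3 a b) = parcs (complete_bipartite a b) \<union>
    {(x, y). x \<in> {Right 0, New 0, New 1} \<and> y \<in> {Right 0, New 0, New 1} \<and> x \<noteq> y}"
  by (simp add: K_circ_K3_def glue_complete_def)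

lemma pair_graph_K_bullet_K3: "pair_graph (K_bullet_K3 a b)"
  unfolding K_bullet_K3_def by (intro pair_graph_glue_complete pair_graph_complete_bipartite) simp

lemma pair_graph_K_circ_K3: "pair_graph (K_circ_K3 a b)"
  unfolding K_circ_K3_def by (intro pair_graph_glue_complete pair_graph_complete_bipartite) simp

lemma pair_graph_SK: "a > 0 \<Longrightarrow> b > 0 \<Longrightarrow> pair_graph (SK a b)"
proof -
  assume ab: "a > 0" "b > 0"
  interpret C: pair_graph "complete_bipartite a b" by (rule pair_graph_complete_bipartite)
  have sym: "(y, x) \<in> parcs (complete_bipartite a b)" if "(x, y) \<in> parcs (complete_bipartite a b)" for x y
    using that C.arcs_symmetric by blast
  show ?thesis
    using C.pair_finite_arcs C.pair_finite_verts ab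
    by unfold_locales
      (auto simp: pverts_SK parcs_SK symmetric_def sym_def pverts_complete_bipartite
        dest: C.wellformed' C.pair_no_loops sym)
qed

lemma card_ext_verts:
  "card (Left ` {..<a} \<union> Right ` {..<b} \<union> New ` {..<c}) = a + b + c"
proof -
  have "card (Left ` {..<a} \<union> Right ` {..<b} \<union> New ` {..<c}) =
      card (Left ` {..<a}) + card (Right ` {..<b}) + card (New ` {..<c})"
    by (subst card_Un_disjoint, auto)+
  then show ?thesis by (simp add: card_image inj_on_def)
qed

lemma not_bipartite_triangle:
  assumes "pair_graph G" "(x, y) \<in> parcs G" "(y, z) \<in> parcs G" "(x, z) \<in> parcs G"
  shows "\<not> bipartite G"
  using assms unfolding bipartite_def by blast

lemma not_bipartite_K_bullet_K3: "\<not> bipartite (K_bullet_K3 a b)"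
  by (rule not_bipartite_triangle[OF pair_graph_K_bullet_K3, of "Left 0" "Right 0" _ _ "New 0"])
    (auto simp: parcs_K_bullet_K3)

lemma not_bipartite_K_circ_K3: "\<not> bipartite (K_circ_K3 a b)"
  by (rule not_bipartite_triangle[OF pair_graph_K_circ_K3, of "New 1" "Right 0" _ _ "New 0"])
    (auto simp: parcs_K_circ_K3)

text \<open>The subdivided edge lies on a five-cycle, which takes a second vertex from each
  side.\<close>

lemma not_bipartite_SK:
  assumes "a \<ge> 2" "b \<ge> 2"
  shows "\<not> bipartite (SK a b)"
proof
  assume "bipartite (SK a b)"
  then obtain U V where UV: "U \<inter> V = {}" "parcs (SK a b) \<subseteq> U \<times> V \<union> V \<times> U"
    unfolding bipartite_def by blast
  have "(New 0, Left 0) \<in> parcs (SK a b)" "(Left 0, Right 1) \<in> parcs (SK a b)"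
    "(Right 1, Left 1) \<in> parcs (SK a b)" "(Left 1, Right 0) \<in> parcs (SK a b)"
    "(Right 0, New 0) \<in> parcs (SK a b)"
    using assms by (auto simp: parcs_SK complete_bipartite_simps)
  then show False using UV by blast
qed

section \<open>Theta-freeness of the candidates\<close>

lemma alternating_walk_parity:
  assumes "successively (\<lambda>x y. c x \<noteq> (c y :: bool)) (u # P @ [v])"
  shows "c u = c v \<longleftrightarrow> odd (length P)"
  using assms by (induction P arbitrary: u) auto

text \<open>An odd number of inner vertices closes up with the edge \<open>u v\<close> to an odd
  cycle, and \<open>c\<close> is a proper two-colouring away from \<open>w\<close>.\<close>

lemma odd_cycle_meets:
  assumes "E u v" "odd (length P)" "successively E (u # P @ [v])"
    and c: "\<And>x y. E x y \<Longrightarrow> x \<noteq> w \<Longrightarrow> y \<noteq> w \<Longrightarrow> c x \<noteq> (c y :: bool)"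
  shows "w \<in> set (u # P @ [v])"
proof (rule ccontr)
  assume w: "w \<notin> set (u # P @ [v])"
  have "successively (\<lambda>x y. c x \<noteq> c y) (u # P @ [v])"
    by (rule successively_mono[OF assms(3)]) (use c w in metis)
  from alternating_walk_parity[OF this] have "c u = c v" using assms(2) by blast
  moreover have "c u \<noteq> c v" using c[OF assms(1)] w by auto
  ultimately show False by blast
qed

text \<open>Both paths close with the edge to odd cycles, which must pass through
  \<open>New 0\<close>. The cycles share only \<open>u\<close> and \<open>v\<close>, so
  \<open>New 0\<close> is one of these and has three neighbours in the theta graph, but its degree
  is two.\<close>

lemma theta_free_K_bullet_K3:
  assumes "even q" "even r" "q \<ge> 2" "r \<ge> 2"
  shows "\<not> has_theta (\<lambda>x y. (x, y) \<in> parcs (K_bullet_K3 a b)) q r"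
proof
  let ?E = "\<lambda>x y. (x, y) \<in> parcs (K_bullet_K3 a b)"
  assume "has_theta ?E q r"
  then obtain u v P Q where *: "?E u v" "length P + 1 = q" "length Q + 1 = r"
    "distinct (u # v # P @ Q)" "successively ?E (u # P @ [v])" "successively ?E (u # Q @ [v])"
    unfolding has_theta_def by blast
  define c where "c x = (case x of Left _ \<Rightarrow> True | _ \<Rightarrow> False)" for x
  have c: "c x \<noteq> c y" if "?E x y" "x \<noteq> New 0" "y \<noteq> New 0" for x y
    using that by (cases x; cases y) (auto simp: c_def parcs_K_bullet_K3 complete_bipartite_simps)
  have "odd (length P)" "odd (length Q)" using * assms by (metis even_plus_one_iff)+
  then have "New 0 \<in> set (u # P @ [v])" "New 0 \<in> set (u # Q @ [v])"
    using odd_cycle_meets[where E = ?E and c = c and w = "New 0", OF *(1) _ *(5) c]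
      odd_cycle_meets[where E = ?E and c = c and w = "New 0", OF *(1) _ *(6) c] by blast+
  then have w: "u = New 0 \<or> v = New 0" using *(4) by auto
  have nbr: "y \<in> {Left 0, Right 0}" if "?E (New 0) y \<or> ?E y (New 0)" for y
    using that by (cases y) (auto simp: parcs_K_bullet_K3 complete_bipartite_simps)
  have ne: "P \<noteq> []" "Q \<noteq> []" using * assms by auto
  have "?E u (hd P)" "?E (last P) v" "?E u (hd Q)" "?E (last Q) v"
    using *(5,6) ne by (auto simp: successively_Cons successively_append_iff)
  then have "v \<in> {Left 0, Right 0} \<and> hd P \<in> {Left 0, Right 0} \<and> hd Q \<in> {Left 0, Right 0} \<or>
      u \<in> {Left 0, Right 0} \<and> last P \<in> {Left 0, Right 0} \<and> last Q \<in> {Left 0, Right 0}"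
    using w nbr *(1) by metis
  moreover have "distinct [v, hd P, hd Q]" "distinct [u, last P, last Q]"
    using *(4) ne hd_in_set[OF ne(1)] hd_in_set[OF ne(2)] last_in_set[OF ne(1)] last_in_set[OF ne(2)]
    by (auto simp del: hd_in_set last_in_set)
  ultimately show False by auto
qed

text \<open>A path of length \<open>2\<close> and the edge form a triangle, and \<open>SK\<close>
  has none.\<close>

lemma theta_free_SK:
  assumes "a > 0" "b > 0" "r \<ge> 2"
  shows "\<not> has_theta (\<lambda>x y. (x, y) \<in> parcs (SK a b)) 2 r"
proof
  let ?E = "\<lambda>x y. (x, y) \<in> parcs (SK a b)"
  assume "has_theta ?E 2 r"
  then obtain u v P where *: "?E u v" "length P = 1" "successively ?E (u # P @ [v])"
    unfolding has_theta_def by auto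
  then obtain p where "P = [p]" by (cases P) auto
  then have "?E u p" "?E p v" using * by auto
  then show False using *(1) assms
    by (cases u; cases v; cases p) (auto simp: parcs_SK complete_bipartite_simps)
qed

text \<open>The path of length \<open>q\<close> and the edge form an odd cycle of length at least
  five. It passes through \<open>New 0\<close>, hence through both neighbours \<open>New 1\<close>
  and \<open>Right 0\<close>; at \<open>New 1\<close> it must continue to \<open>Right 0\<close>, so
  it would be the triangle.\<close>

lemma theta_free_K_circ_K3:
  assumes "even q" "q \<ge> 4"
  shows "\<not> has_theta (\<lambda>x y. (x, y) \<in> parcs (K_circ_K3 a b)) q r"
proof
  let ?E = "\<lambda>x y. (x, y) \<in> parcs (K_circ_K3 a b)"
  assume "has_theta ?E q r"
  then obtain u v P where *: "?E u v" "length P + 1 = q" "distinct (u # P @ [v])"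
    "successively ?E (u # P @ [v])"
    unfolding has_theta_def by auto
  define c where "c x = (case x of Right _ \<Rightarrow> True | _ \<Rightarrow> False)" for x
  have c: "c x \<noteq> c y" if "?E x y" "x \<noteq> New k" "y \<noteq> New k" "k < 2" for x y k
    using that
    by (cases x; cases y) (auto simp: c_def parcs_K_circ_K3 complete_bipartite_simps less_2_cases_iff)
  have "odd (length P)" using * assms by (metis even_plus_one_iff)
  then have "New 0 \<in> set (u # P @ [v])"
    using odd_cycle_meets[where E = ?E and c = c and w = "New 0", OF *(1) _ *(4) c] by simp
  \<comment> \<open>The cycle is cut open at \<open>New 0\<close>, whose neighbours on it become the
    ends of the list \<open>ys @ xs\<close>.\<close>
  then obtain xs ys where split: "u # P @ [v] = xs @ New 0 # ys" by (meson split_list)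
  have sym: "?E y x" if "?E x y" for x y
    using that by (auto simp: parcs_K_circ_K3 complete_bipartite_def Let_def)
  have "length (u # P @ [v]) = length (xs @ New 0 # ys)" using split by metis
  then have "length (ys @ xs) = q" using *(2) by simp
  moreover have "distinct (New 0 # ys @ xs)" using *(3) unfolding split by auto
  ultimately have cyc: "distinct (New 0 # ys @ xs)" "length (ys @ xs) = q" by blast+
  have walk: "successively ?E (New 0 # ys @ xs @ [New 0])"
  proof -
    have a: "successively ?E (xs @ [New 0])" "successively ?E (New 0 # ys)"
      using *(4) unfolding split by (auto simp: successively_append_iff successively_Cons)
    have "?E (last (New 0 # ys)) (hd (xs @ [New 0]))"
      using sym[OF *(1)] split by (cases xs; cases ys rule: rev_cases) auto
    then have "successively ?E ((New 0 # ys) @ (xs @ [New 0]))"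
      using a by (subst successively_append_iff) blast
    then show ?thesis by simp
  qed
  define R where "R = ys @ xs"
  have R: "distinct (New 0 # R)" "length R = q" "successively ?E (New 0 # R @ [New 0])"
    using cyc walk by (simp_all add: R_def)
  have nbr0: "y \<in> {New 1, Right 0}" if "?E (New 0) y \<or> ?E y (New 0)" for y
    using that by (cases y) (auto simp: parcs_K_circ_K3 complete_bipartite_simps)
  have nbr1: "y \<in> {New 0, Right 0}" if "?E (New 1) y \<or> ?E y (New 1)" for y
    using that by (cases y) (auto simp: parcs_K_circ_K3 complete_bipartite_simps)
  obtain s S t where RS: "R = s # S @ [t]"
  proof -
    obtain s R' where "R = s # R'" using R(2) assms by (cases R) auto
    moreover obtain S t where "R' = S @ [t]" using R(2) assms calculation by (cases R' rule: rev_cases) auto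
    ultimately show ?thesis using that by blast
  qed
  have S: "S \<noteq> []" "s \<noteq> t" "s \<notin> set S" "t \<notin> set S" "New 0 \<notin> set S"
    using R RS assms by auto
  have e: "?E (New 0) s" "?E t (New 0)" "?E s (hd S)" "?E (last S) t"
    using R(3) S(1) unfolding RS by (auto simp: successively_Cons successively_append_iff)
  have mem: "hd S \<in> set S" "last S \<in> set S" using S(1) by auto
  have st: "s \<in> {New 1, Right 0}" "t \<in> {New 1, Right 0}" using e nbr0 by auto
  then consider "s = New 1" "t = Right 0" | "s = Right 0" "t = New 1" using S(2) by auto
  then show False
  proof cases
    case 1
    then have "hd S \<in> {New 0, Right 0}" using e nbr1 by blast
    then show False using mem(1) S(3-5) 1 by (metis empty_iff insert_iff)
  next
    case 2
    then have "last S \<in> {New 0, Right 0}" using e nbr1 by blast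
    then show False using mem(2) S(3-5) 2 by (metis empty_iff insert_iff)
  qed
qed

section \<open>Transport along isomorphisms\<close>

lemma exists_copy:
  assumes "pair_graph K"
  shows "copies K \<noteq> {}"
proof -
  interpret K: pair_graph K by fact
  obtain f :: "_ \<Rightarrow> nat" where f: "inj_on f (pverts K)"
    using finite_imp_inj_to_nat_seg[OF K.pair_finite_verts] by blast
  show ?thesis using graph_iso_image[OF assms f] by (auto simp: copies_def)
qed

lemma graph_isoE:
  assumes "pair_graph K" "pair_graph G" "graph_iso K G"
  obtains f g where "bij_betw f (pverts K) (pverts G)" "bij_betw g (pverts G) (pverts K)"
    "\<And>u v. (u, v) \<in> parcs K \<Longrightarrow> (f u, f v) \<in> parcs G"
    "\<And>u v. (u, v) \<in> parcs G \<Longrightarrow> (g u, g v) \<in> parcs K"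
    "\<And>v. v \<in> pverts K \<Longrightarrow> g (f v) = v" "\<And>v. v \<in> pverts G \<Longrightarrow> f (g v) = v"
proof -
  interpret K: pair_graph K by fact
  interpret G: pair_graph G by fact
  obtain f where f: "bij_betw f (pverts K) (pverts G)"
    "\<And>u v. u \<in> pverts K \<Longrightarrow> v \<in> pverts K \<Longrightarrow> (u, v) \<in> parcs K \<longleftrightarrow> (f u, f v) \<in> parcs G"
    using assms(3) unfolding graph_iso_iff[OF assms(1,2)] by blast
  define g where "g = the_inv_into (pverts K) f"
  have g: "bij_betw g (pverts G) (pverts K)" unfolding g_def by (rule bij_betw_the_inv_into[OF f(1)])
  have gf: "g (f v) = v" if "v \<in> pverts K" for v
    using that f(1) unfolding g_def bij_betw_def by (intro the_inv_into_f_f) auto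
  have fg: "f (g v) = v" if "v \<in> pverts G" for v
    using that f(1) unfolding g_def bij_betw_def by (intro f_the_inv_into_f) auto
  have gin: "g v \<in> pverts K" if "v \<in> pverts G" for v using that g bij_betwE by blast
  have fa: "(f u, f v) \<in> parcs G" if "(u, v) \<in> parcs K" for u v
    using f(2) that K.wellformed'[OF that] by blast
  have ga: "(g u, g v) \<in> parcs K" if "(u, v) \<in> parcs G" for u v
    using f(2)[of "g u" "g v"] that G.wellformed'[OF that] gin fg by metis
  show ?thesis by (rule that[OF f(1) g fa ga gf fg])
qed

lemma bipartite_graph_iso:
  assumes "pair_graph K" "pair_graph G" "graph_iso K G" "bipartite G"
  shows "bipartite K"
proof -
  interpret K: pair_graph K by fact
  obtain f g where f: "bij_betw f (pverts K) (pverts G)"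
    "\<And>u v. (u, v) \<in> parcs K \<Longrightarrow> (f u, f v) \<in> parcs G"
    using graph_isoE[OF assms(1-3)] by metis
  obtain U V where UV: "pverts G = U \<union> V" "U \<inter> V = {}" "parcs G \<subseteq> U \<times> V \<union> V \<times> U"
    using assms(4) unfolding bipartite_def by blast
  have "pverts K = {v \<in> pverts K. f v \<in> U} \<union> {v \<in> pverts K. f v \<in> V}"
    using f(1) UV(1) bij_betwE by blast
  moreover have "{v \<in> pverts K. f v \<in> U} \<inter> {v \<in> pverts K. f v \<in> V} = {}" using UV(2) by blast
  moreover have "parcs K \<subseteq> {v \<in> pverts K. f v \<in> U} \<times> {v \<in> pverts K. f v \<in> V} \<union>
      {v \<in> pverts K. f v \<in> V} \<times> {v \<in> pverts K. f v \<in> U}"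
  proof (rule subrelI)
    fix u v assume uv: "(u, v) \<in> parcs K"
    then show "(u, v) \<in> {v \<in> pverts K. f v \<in> U} \<times> {v \<in> pverts K. f v \<in> V} \<union>
      {v \<in> pverts K. f v \<in> V} \<times> {v \<in> pverts K. f v \<in> U}"
      using f(2)[OF uv] UV(3) K.wellformed'[OF uv] by auto
  qed
  ultimately show ?thesis unfolding bipartite_def by blast
qed

lemma free_of_graph_iso:
  assumes "pair_graph K" "pair_graph G" "graph_iso K G" "pair_graph H" "free_of H K"
  shows "free_of H G"
proof (rule ccontr)
  assume "\<not> free_of H G"
  then obtain h where h: "inj_on h (pverts H)" "h ` pverts H \<subseteq> pverts G"
    "\<And>u v. (u, v) \<in> parcs H \<Longrightarrow> (h u, h v) \<in> parcs G"
    unfolding not_free_of_iff[OF assms(4,2)] by blast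
  obtain f g where g: "bij_betw g (pverts G) (pverts K)"
    "\<And>u v. (u, v) \<in> parcs G \<Longrightarrow> (g u, g v) \<in> parcs K"
    using graph_isoE[OF assms(1-3)] by metis
  have "inj_on (g \<circ> h) (pverts H)"
    using h(1,2) g(1) by (intro comp_inj_on) (auto simp: bij_betw_def intro: inj_on_subset)
  moreover have "(g \<circ> h) ` pverts H \<subseteq> pverts K" using h(2) g(1) by (auto simp: bij_betw_def)
  ultimately have "\<not> free_of H K"
    unfolding not_free_of_iff[OF assms(4,1)] using h(3) g(2) by (intro exI[of _ "g \<circ> h"]) auto
  then show False using assms(5) by blast
qed

lemma graph_spectral_radius_copies:
  assumes K: "pair_graph K" "pverts K \<noteq> {}" and G: "G \<in> copies K" and G': "G' \<in> copies K"
  shows "graph_spectral_radius G \<le> graph_spectral_radius G'"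
proof -
  have pg: "pair_graph G" "graph_iso K G" "pair_graph G'" "graph_iso K G'"
    using G G' by (auto simp: copies_def)
  obtain f g where g: "bij_betw g (pverts G) (pverts K)"
    "\<And>u v. (u, v) \<in> parcs G \<Longrightarrow> (g u, g v) \<in> parcs K"
    using graph_isoE[OF K(1) pg(1,2)] by metis
  obtain f' g' where f': "bij_betw f' (pverts K) (pverts G')"
    "\<And>u v. (u, v) \<in> parcs K \<Longrightarrow> (f' u, f' v) \<in> parcs G'"
    using graph_isoE[OF K(1) pg(3,4)] by metis
  have b: "bij_betw (f' \<circ> g) (pverts G) (pverts G')" using g(1) f'(1) by (rule bij_betw_trans)
  show ?thesis
  proof (rule graph_spectral_radius_mono[OF pg(3,1), where f = "f' \<circ> g"])
    show "pverts G \<noteq> {}" using g(1) K(2) by (auto simp: bij_betw_def)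
    show "inj_on (f' \<circ> g) (pverts G)" "(f' \<circ> g) ` pverts G \<subseteq> pverts G'"
      using b by (auto simp: bij_betw_def)
    show "((f' \<circ> g) u, (f' \<circ> g) v) \<in> parcs G'" if "(u, v) \<in> parcs G" for u v
      using that g(2) f'(2) by simp
  qed
qed

text \<open>The existence of a maximum is part of the conclusion: by \<open>key\<close>, a graph
  exceeding some copy is itself a copy, and all copies have the same spectral radius.\<close>

lemma SPEX3_eq_copiesI:
  assumes K: "pair_graph K" "card (pverts K) = n" "pverts K \<noteq> {}" "free_of H K" "\<not> bipartite K"
    and H: "pair_graph H"
    and key: "\<And>G G0. G0 \<in> copies K \<Longrightarrow> G \<in> nonbipartite_free_graphs n H \<Longrightarrow>
      graph_spectral_radius G0 \<le> graph_spectral_radius G \<Longrightarrow> G \<in> copies K"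
  shows "SPEX3 n H = copies K"
proof -
  obtain G0 where G0: "G0 \<in> copies K" using exists_copy[OF K(1)] by blast
  have sub: "copies K \<subseteq> nonbipartite_free_graphs n H"
  proof
    fix G assume "G \<in> copies K"
    then have pg: "pair_graph G" "graph_iso K G" by (auto simp: copies_def)
    obtain f g where f: "bij_betw f (pverts K) (pverts G)"
      using graph_isoE[OF K(1) pg] by metis
    have "card (pverts G) = n" using bij_betw_same_card[OF f] K(2) by simp
    moreover have "free_of H G" using free_of_graph_iso[OF K(1) pg H K(4)] .
    moreover have "\<not> bipartite G" using bipartite_graph_iso[OF K(1) pg] K(5) by blast
    ultimately show "G \<in> nonbipartite_free_graphs n H"
      using pg by (simp add: nonbipartite_free_graphs_def)
  qed
  show ?thesis
  proof
    show "SPEX3 n H \<subseteq> copies K"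
      using key[OF G0] sub G0 by (auto simp: SPEX3_def)
    show "copies K \<subseteq> SPEX3 n H"
    proof
      fix G assume G: "G \<in> copies K"
      have "graph_spectral_radius G' \<le> graph_spectral_radius G"
        if G': "G' \<in> nonbipartite_free_graphs n H" for G'
      proof (rule ccontr)
        assume "\<not> ?thesis"
        then have "G' \<in> copies K" "graph_spectral_radius G < graph_spectral_radius G'"
          using key[OF G G'] by auto
        then show False using graph_spectral_radius_copies[OF K(1,3) \<open>G' \<in> copies K\<close> G] by simp
      qed
      then show "G \<in> SPEX3 n H" using G sub by (auto simp: SPEX3_def)
    qed
  qed
qed

section \<open>Lower bounds and an equation for the spectral radii of the candidates\<close>

lemma card_parcs_complete_bipartite: "card (parcs (complete_bipartite a b)) = 2 * (a * b)"
proof -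
  let ?U = "Left ` {..<a}" and ?V = "Right ` {..<b}"
  have "card ?U = a" "card ?V = b" by (simp_all add: card_image inj_on_def)
  moreover have "card (?U \<times> ?V \<union> ?V \<times> ?U) = card (?U \<times> ?V) + card (?V \<times> ?U)"
    by (rule card_Un_disjoint) auto
  ultimately show ?thesis by (simp add: complete_bipartite_def Let_def card_cartesian_product)
qed

text \<open>The Perron vector of the complete bipartite graph, extended by \<open>0\<close>, as test vector.\<close>

definition bip_vec :: "nat \<Rightarrow> nat \<Rightarrow> ext_vertex \<Rightarrow> real" where
  "bip_vec a b v = (case v of Left _ \<Rightarrow> sqrt b | Right _ \<Rightarrow> sqrt a | New _ \<Rightarrow> 0)"

lemma bip_vec_norm: "(\<Sum>v\<in>Left ` {..<a} \<union> Right ` {..<b}. (bip_vec a b v)\<^sup>2) = 2 * (a * b)"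
proof -
  have "(\<Sum>v\<in>Left ` {..<a} \<union> Right ` {..<b}. (bip_vec a b v)\<^sup>2) =
      (\<Sum>v\<in>Left ` {..<a}. (bip_vec a b v)\<^sup>2) + (\<Sum>v\<in>Right ` {..<b}. (bip_vec a b v)\<^sup>2)"
    by (rule sum.union_disjoint) auto
  then show ?thesis by (simp add: sum.reindex inj_on_def bip_vec_def)
qed

lemma bip_vec_arc:
  assumes "(u, v) \<in> parcs (complete_bipartite a b)"
  shows "bip_vec a b u * bip_vec a b v = sqrt (a * b)"
  using assms by (cases u; cases v) (auto simp: complete_bipartite_simps bip_vec_def real_sqrt_mult)

text \<open>There are \<open>2 * (a * b)\<close> arcs, each contributing
  \<open>sqrt (a * b)\<close>, against a squared norm of \<open>2 * (a * b)\<close>.\<close>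

lemma spectral_radius_ge_complete_bipartite:
  fixes G :: "'a::linorder pair_pre_digraph"
  assumes "pair_graph K" "pair_graph G" "graph_iso K G" "a > 0" "b > 0"
    "pverts (complete_bipartite a b) \<subseteq> pverts K" "parcs (complete_bipartite a b) \<subseteq> parcs K"
  shows "sqrt (a * b) \<le> graph_spectral_radius G"
proof -
  obtain f g where f: "bij_betw f (pverts K) (pverts G)"
    "\<And>u v. (u, v) \<in> parcs K \<Longrightarrow> (f u, f v) \<in> parcs G"
    using graph_isoE[OF assms(1-3)] by metis
  let ?C = "complete_bipartite a b"
  have "(\<Sum>(u, v)\<in>parcs ?C. bip_vec a b u * bip_vec a b v) \<le>
      graph_spectral_radius G * (\<Sum>v\<in>pverts ?C. (bip_vec a b v)\<^sup>2)"
  proof (rule graph_spectral_radius_ge[OF assms(2) pair_graph_complete_bipartite, where f = f])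
    show "pverts ?C \<noteq> {}" using assms(4) by (auto simp: pverts_complete_bipartite)
    show "inj_on f (pverts ?C)" "f ` pverts ?C \<subseteq> pverts G"
      using f(1) assms(6) by (auto simp: bij_betw_def intro: inj_on_subset)
    show "(f u, f v) \<in> parcs G" if "(u, v) \<in> parcs ?C" for u v using that assms(7) f(2) by blast
    show "bip_vec a b v \<ge> 0" for v by (simp add: bip_vec_def split: ext_vertex.split)
  qed
  moreover have "(\<Sum>(u, v)\<in>parcs ?C. bip_vec a b u * bip_vec a b v) = (\<Sum>e\<in>parcs ?C. sqrt (a * b))"
    by (rule sum.cong) (auto simp: bip_vec_arc)
  ultimately have "2 * (real a * b) * sqrt (a * b) \<le> 2 * (real a * b) * graph_spectral_radius G"
    by (simp add: card_parcs_complete_bipartite pverts_complete_bipartite bip_vec_norm mult_ac)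
  then show ?thesis using assms(4,5) by (simp add: mult_le_cancel_left)
qed

text \<open>The same test vector sees two arcs fewer, and the new vertex has weight
  \<open>0\<close>; the quotient drops by \<open>1 / sqrt (a * b)\<close>.\<close>

lemma spectral_radius_ge_SK:
  fixes G :: "'a::linorder pair_pre_digraph"
  assumes "pair_graph G" "graph_iso (SK a b) G" "a > 0" "b > 0"
  shows "sqrt (a * b) - 1 / sqrt (a * b) \<le> graph_spectral_radius G"
proof -
  note pgS = pair_graph_SK[OF assms(3,4)]
  interpret S: pair_graph "SK a b" by (rule pgS)
  interpret C: pair_graph "complete_bipartite a b" by (rule pair_graph_complete_bipartite)
  obtain f g where f: "bij_betw f (pverts (SK a b)) (pverts G)"
    "\<And>u v. (u, v) \<in> parcs (SK a b) \<Longrightarrow> (f u, f v) \<in> parcs G"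
    using graph_isoE[OF pgS assms(1,2)] by metis
  let ?C = "complete_bipartite a b" and ?S = "SK a b" and ?y = "bip_vec a b"
  let ?D = "{(Left 0, Right 0), (Right 0, Left 0)}"
  have "(\<Sum>(u, v)\<in>parcs ?S. ?y u * ?y v) \<le>
      graph_spectral_radius G * (\<Sum>v\<in>pverts ?S. (?y v)\<^sup>2)"
  proof (rule graph_spectral_radius_ge[OF assms(1) pgS, where f = f])
    show "pverts ?S \<noteq> {}" by (auto simp: pverts_SK)
    show "inj_on f (pverts ?S)" "f ` pverts ?S \<subseteq> pverts G" using f(1) by (auto simp: bij_betw_def)
    show "?y v \<ge> 0" for v by (simp add: bip_vec_def split: ext_vertex.split)
  qed (rule f(2))
  moreover have "(\<Sum>(u, v)\<in>parcs ?S. ?y u * ?y v) = (\<Sum>(u, v)\<in>parcs ?C - ?D. ?y u * ?y v)"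
    by (rule sum.mono_neutral_right[OF S.pair_finite_arcs])
      (use assms(3,4) in \<open>auto simp: parcs_SK bip_vec_def\<close>)
  moreover have "\<dots> = (\<Sum>e\<in>parcs ?C - ?D. sqrt (a * b))"
    by (rule sum.cong) (auto simp: bip_vec_arc)
  moreover have "(\<Sum>v\<in>pverts ?S. (?y v)\<^sup>2) = (\<Sum>v\<in>Left ` {..<a} \<union> Right ` {..<b}. (?y v)\<^sup>2)"
    by (rule sum.mono_neutral_right) (auto simp: pverts_SK bip_vec_def)
  moreover have "card (parcs ?C - ?D) = 2 * (a * b) - 2"
    using assms(3,4) by (subst card_Diff_subset) (auto simp: complete_bipartite_simps card_parcs_complete_bipartite)
  ultimately have "real (2 * (a * b) - 2) * sqrt (a * b) \<le> graph_spectral_radius G * (2 * (real a * b))"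
    by (simp add: bip_vec_norm)
  moreover have "real (2 * (a * b) - 2) = 2 * (real a * b) - 2"
    using assms(3,4) by (subst of_nat_diff) (auto simp: Suc_le_eq)
  ultimately have "(2 * (real a * b) - 2) * sqrt (a * b) \<le> graph_spectral_radius G * (2 * (real a * b))"
    by metis
  then have le: "(real a * b) * sqrt (a * b) - sqrt (a * b) \<le> (real a * b) * graph_spectral_radius G"
    by (simp add: algebra_simps)
  define s where "s = sqrt (real a * b)"
  have s: "s > 0" "s * s = real a * b" using assms(3,4) by (simp_all add: s_def)
  have "s * s * s - s \<le> s * s * graph_spectral_radius G" using le s by (simp add: s_def)
  then have "s * (s * s - 1) \<le> s * (s * graph_spectral_radius G)" by (simp add: algebra_simps)
  then have "s * s - 1 \<le> s * graph_spectral_radius G" using s(1) by (rule mult_left_le_imp_le)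
  then have "s - 1 / s \<le> graph_spectral_radius G" using s(1) by (simp add: field_simps)
  then show ?thesis by (simp add: s_def)
qed

text \<open>\<open>L\<close> and \<open>R\<close> are the total weights of the sides of sizes
  \<open>A\<close> and \<open>B\<close>, \<open>c\<close> is the weight of the vertex shared with
  the triangle, and \<open>n0\<close>, \<open>n1\<close> are those of the new vertices. Symmetry
  forces \<open>n0 = n1\<close>, and the rest is elimination.\<close>

lemma K_circ_K3_eigen_relation:
  fixes L R c n0 n1 l A B :: real
  assumes L: "l * L = A * R" and R: "l * R = B * L + n0 + n1" and c: "l * c = L + n0 + n1"
    and n: "l * n0 = c + n1" "l * n1 = c + n0" and l: "l > 2" and R0: "R \<noteq> 0"
  shows "l\<^sup>2 = A * B + 2 * A / ((l - 2) * (l + 1))"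
proof -
  have "(l + 1) * (n0 - n1) = 0" using n by (simp add: algebra_simps)
  then have n01: "n1 = n0" using l by simp
  have c': "c = (l - 1) * n0" using n n01 by (simp add: algebra_simps)
  have Lm: "(l - 2) * (l + 1) * n0 = L" using c n01 unfolding c' by (simp add: algebra_simps)
  have "l\<^sup>2 * R = l * (l * R)" by (simp add: power2_eq_square)
  also have "\<dots> = B * (l * L) + 2 * (l * n0)" using R n01 by (simp add: algebra_simps)
  finally have 1: "l\<^sup>2 * R = A * B * R + 2 * (l * n0)" using L by (simp add: algebra_simps)
  have D: "(l - 2) * (l + 1) > 0" using l by simp
  have "(l - 2) * (l + 1) * (l * n0) = A * R" using Lm L by (simp add: algebra_simps)
  then have "l * n0 = A * R / ((l - 2) * (l + 1))"
    using D by (metis less_irrefl nonzero_mult_div_cancel_left)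
  with 1 have "l\<^sup>2 * R = (A * B + 2 * A / ((l - 2) * (l + 1))) * R"
    by (simp add: algebra_simps)
  then show ?thesis using R0 by simp
qed

lemma K_circ_K3_equation:
  fixes G :: "'a::linorder pair_pre_digraph"
  assumes G: "pair_graph G" "graph_iso (K_circ_K3 a b) G" and ab: "a > 0" "b > 0"
    and l: "graph_spectral_radius G > 2"
  shows "(graph_spectral_radius G)\<^sup>2 =
    real a * b + 2 * a / ((graph_spectral_radius G - 2) * (graph_spectral_radius G + 1))"
proof -
  let ?K = "K_circ_K3 a b" and ?l = "graph_spectral_radius G"
  note pgK = pair_graph_K_circ_K3[of a b]
  interpret K: pair_graph ?K by (rule pgK)
  interpret G: pair_graph G by (rule G(1))
  obtain f g where f: "bij_betw f (pverts ?K) (pverts G)" "bij_betw g (pverts G) (pverts ?K)"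
    "\<And>u v. (u, v) \<in> parcs ?K \<Longrightarrow> (f u, f v) \<in> parcs G"
    "\<And>u v. (u, v) \<in> parcs G \<Longrightarrow> (g u, g v) \<in> parcs ?K"
    "\<And>v. v \<in> pverts ?K \<Longrightarrow> g (f v) = v" "\<And>v. v \<in> pverts G \<Longrightarrow> f (g v) = v"
    using graph_isoE[OF pgK G] by metis
  have pv: "pverts ?K = Left ` {..<a} \<union> Right ` {..<b} \<union> {New 0, New 1}"
    by (rule pverts_K_circ_K3[OF ab(2)])
  have "pverts G \<noteq> {}" using f(1) pv by (auto simp: bij_betw_def)
  then obtain x where x: "\<And>v. x v \<ge> 0" "(\<Sum>v\<in>pverts G. (x v)\<^sup>2) = 1"
    "\<And>v. v \<in> pverts G \<Longrightarrow> (\<Sum>u | (v, u) \<in> parcs G. x u) = ?l * x v"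
    using graph_spectral_radius_perron[OF G(1)] by metis
  define z where "z v = x (f v)" for v
  have eig: "(\<Sum>u | (v, u) \<in> parcs ?K. z u) = ?l * z v" if v: "v \<in> pverts ?K" for v
  proof -
    have "(\<Sum>u | (v, u) \<in> parcs ?K. z u) = (\<Sum>u | (f v, u) \<in> parcs G. x u)"
    proof (rule sum.reindex_bij_witness[of _ g f])
      fix u assume "u \<in> {u. (v, u) \<in> parcs ?K}"
      then have u: "(v, u) \<in> parcs ?K" by simp
      show "g (f u) = u" using f(5) K.wellformed'[OF u] by blast
      show "f u \<in> {u. (f v, u) \<in> parcs G}" using f(3)[OF u] by simp
      show "x (f u) = z u" by (simp add: z_def)
    next
      fix u assume "u \<in> {u. (f v, u) \<in> parcs G}"
      then have u: "(f v, u) \<in> parcs G" by simp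
      show "f (g u) = u" using f(6) G.wellformed'[OF u] by blast
      show "g u \<in> {u. (v, u) \<in> parcs ?K}" using f(4)[OF u] f(5)[OF v] by simp
    qed
    also have "\<dots> = ?l * z v" using x(3)[of "f v"] bij_betwE[OF f(1)] v by (simp add: z_def)
    finally show ?thesis .
  qed
  define L where "L = (\<Sum>i<a. z (Left i))"
  define R where "R = (\<Sum>j<b. z (Right j))"
  have sumL: "(\<Sum>u\<in>Left ` {..<a}. z u) = L" by (simp add: L_def sum.reindex inj_on_def)
  have sumR: "(\<Sum>u\<in>Right ` {..<b}. z u) = R" by (simp add: R_def sum.reindex inj_on_def)
  have zL: "?l * z (Left i) = R" if "i < a" for i
  proof -
    have "{u. (Left i, u) \<in> parcs ?K} = Right ` {..<b}"
      using that by (auto simp: parcs_K_circ_K3 complete_bipartite_def Let_def)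
    then show ?thesis using eig[of "Left i"] that sumR pv by simp
  qed
  have c: "?l * z (Right 0) = L + z (New 0) + z (New 1)"
  proof -
    have "{u. (Right 0, u) \<in> parcs ?K} = insert (New 0) (insert (New 1) (Left ` {..<a}))"
      using ab by (auto simp: parcs_K_circ_K3 complete_bipartite_def Let_def)
    moreover have "(\<Sum>u\<in>insert (New 0) (insert (New 1) (Left ` {..<a})). z u) = z (New 0) + (z (New 1) + L)"
    proof -
      have "New 0 \<notin> insert (New 1) (Left ` {..<a})" "New 1 \<notin> Left ` {..<a}" by auto
      then show ?thesis using sumL by simp
    qed
    ultimately show ?thesis using eig[of "Right 0"] pv ab by simp
  qed
  have zR: "?l * z (Right j) = L" if "0 < j" "j < b" for j
  proof -
    have "{u. (Right j, u) \<in> parcs ?K} = Left ` {..<a}"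
      using that by (auto simp: parcs_K_circ_K3 complete_bipartite_def Let_def)
    then show ?thesis using eig[of "Right j"] that sumL pv by simp
  qed
  have n: "?l * z (New 0) = z (Right 0) + z (New 1)" "?l * z (New 1) = z (Right 0) + z (New 0)"
  proof -
    have "{u. (New 0, u) \<in> parcs ?K} = {Right 0, New 1}" "{u. (New 1, u) \<in> parcs ?K} = {Right 0, New 0}"
      by (auto simp: parcs_K_circ_K3 complete_bipartite_def Let_def)
    then show "?l * z (New 0) = z (Right 0) + z (New 1)" "?l * z (New 1) = z (Right 0) + z (New 0)"
      using eig[of "New 0"] eig[of "New 1"] pv by simp_all
  qed
  have LR: "?l * L = a * R" using zL by (simp add: L_def sum_distrib_left)
  have RL: "?l * R = b * L + z (New 0) + z (New 1)"
  proof -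
    have "?l * R = (\<Sum>j<b. ?l * z (Right j))" by (simp add: R_def sum_distrib_left)
    also have "\<dots> = ?l * z (Right 0) + (\<Sum>j\<in>{..<b} - {0}. ?l * z (Right j))"
      using ab by (intro sum.remove) auto
    also have "(\<Sum>j\<in>{..<b} - {0}. ?l * z (Right j)) = (\<Sum>j\<in>{..<b} - {0}. L)"
      by (rule sum.cong) (auto simp: zR)
    also have "\<dots> = (real b - 1) * L" using ab by (simp add: of_nat_diff)
    finally show ?thesis using c by (simp add: algebra_simps)
  qed
  \<comment> \<open>If the right side had total weight \<open>0\<close>, the eigenvector equations
    would make every weight vanish.\<close>
  have "R \<noteq> 0"
  proof
    assume R0: "R = 0"
    then have L0: "L = 0" using LR l by simp
    have znn: "z v \<ge> 0" for v using x(1) by (simp add: z_def)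
    have "b * L + z (New 0) + z (New 1) = 0" using RL R0 by simp
    then have N0: "z (New 0) = 0" "z (New 1) = 0" using L0 znn[of "New 0"] znn[of "New 1"] by auto
    have z0: "z (Right 0) = 0" using c L0 N0 l by simp
    have zi: "z (Left i) = 0" if "i < a" for i using zL[OF that] R0 l by simp
    have zj: "z (Right j) = 0" if "j < b" for j
      using zR[OF _ that] L0 l z0 by (cases "j = 0") auto
    have "z v = 0" if v: "v \<in> pverts ?K" for v using v zi zj N0 unfolding pv by auto
    then have "x v = 0" if "v \<in> pverts G" for v
      using that f(6)[OF that] bij_betwE[OF f(2)] z_def by metis
    then show False using x(2) by simp
  qed
  from K_circ_K3_eigen_relation[OF LR RL c n l this] show ?thesis by (simp add: mult_ac)
qed

text \<open>The correction grows with the size of the side opposite to the triangle and decreases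
  with the radius. So \<open>A > B\<close> and \<open>l \<le> m\<close> would give
  \<open>m\<^sup>2 < l\<^sup>2\<close>: the triangle hangs on the smaller side.\<close>

lemma K_circ_K3_side:
  fixes l m A B :: real
  assumes l: "l\<^sup>2 = A * B + 2 * A / ((l - 2) * (l + 1))"
    and m: "m\<^sup>2 = A * B + 2 * B / ((m - 2) * (m + 1))"
    and lm: "l > 2" "l \<le> m" and AB: "0 \<le> B"
  shows "A \<le> B"
proof (rule ccontr)
  assume "\<not> A \<le> B"
  have D: "0 < (l - 2) * (l + 1)" "(l - 2) * (l + 1) \<le> (m - 2) * (m + 1)"
    using lm by (auto intro!: mult_mono)
  have "2 * B / ((m - 2) * (m + 1)) \<le> 2 * B / ((l - 2) * (l + 1))"
    using D AB by (intro divide_left_mono) auto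
  also have "\<dots> < 2 * A / ((l - 2) * (l + 1))"
    using D \<open>\<not> A \<le> B\<close> by (intro divide_strict_right_mono) auto
  finally have "m\<^sup>2 < l\<^sup>2" using l m by linarith
  moreover have "l\<^sup>2 \<le> m\<^sup>2" using lm by (intro power_mono) auto
  ultimately show False by linarith
qed

section \<open>Recognising the candidates from a description of their arcs\<close>

lemma bij_betw_lessThan_card:
  assumes "finite A" "x \<in> A"
  obtains g where "bij_betw g {..<card A} A" "g (0::nat) = x"
proof -
  obtain h where h: "bij_betw h {..<card A} A"
    using ex_bij_betw_nat_finite[OF assms(1)] by (auto simp: atLeast0LessThan)
  then have "x \<in> h ` {..<card A}" using assms(2) by (simp add: bij_betw_def)
  then obtain k where k: "k < card A" "h k = x" by blast
  \<comment> \<open>The candidates place the distinguished vertices at index \<open>0\<close>, so a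
    transposition moves \<open>x\<close> there.\<close>
  have "bij_betw (transpose 0 k) {..<card A} {..<card A}"
    using k by (intro bij_betw_transpose_iff) auto
  then have "bij_betw (h \<circ> transpose 0 k) {..<card A} A" using h by (rule bij_betw_trans)
  moreover have "(h \<circ> transpose 0 k) 0 = x" using k by simp
  ultimately show ?thesis using that by blast
qed

definition ext_map :: "(nat \<Rightarrow> 'a) \<Rightarrow> (nat \<Rightarrow> 'a) \<Rightarrow> (nat \<Rightarrow> 'a) \<Rightarrow> ext_vertex \<Rightarrow> 'a" where
  "ext_map f g h v = (case v of Left i \<Rightarrow> f i | Right j \<Rightarrow> g j | New k \<Rightarrow> h k)"

lemma ext_map_simps [simp]:
  "ext_map f g h (Left i) = f i" "ext_map f g h (Right j) = g j" "ext_map f g h (New k) = h k"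
  by (simp_all add: ext_map_def)

lemma bij_betw_ext_map:
  assumes "bij_betw f {..<a} A" "bij_betw g {..<b} B" "bij_betw h {..<c} C"
    and "A \<inter> B = {}" "A \<inter> C = {}" "B \<inter> C = {}"
  shows "bij_betw (ext_map f g h) (Left ` {..<a} \<union> Right ` {..<b} \<union> New ` {..<c}) (A \<union> B \<union> C)"
proof -
  have comp: "bij_betw (ext_map f g h) (k ` {..<d}) D"
    if "inj k" "bij_betw (\<lambda>i. ext_map f g h (k i)) {..<d} D" for k d D
    using that bij_betw_comp_iff[of k "{..<d}" "k ` {..<d}" "ext_map f g h" D]
    by (auto simp: bij_betw_def comp_def inj_on_def)
  have "bij_betw (ext_map f g h) (Left ` {..<a}) A" "bij_betw (ext_map f g h) (Right ` {..<b}) B"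
    "bij_betw (ext_map f g h) (New ` {..<c}) C"
    using assms by (auto intro!: comp simp: inj_def)
  then show ?thesis using assms(4-6) by (intro bij_betw_combine) auto
qed

lemma bij_betw_based:
  assumes "bij_betw f {..<n} A" "f 0 = x" "i < n"
  shows "f i \<in> A" "f i = x \<longleftrightarrow> i = (0 :: nat)"
proof -
  show "f i \<in> A" using bij_betwE[OF assms(1)] assms(3) by simp
  show "f i = x \<longleftrightarrow> i = 0"
    using inj_onD[OF bij_betw_imp_inj_on[OF assms(1)], of i 0] assms(2,3) by fastforce
qed

lemma ext_map_one_new:
  assumes ab: "a0 \<in> A" "b0 \<in> B" and disj: "A \<inter> B = {}" "w \<notin> A" "w \<notin> B" and fin: "finite A" "finite B"
  obtains f g where
    "bij_betw (ext_map f g (\<lambda>_. w)) (Left ` {..<card A} \<union> Right ` {..<card B} \<union> {New 0}) (A \<union> B \<union> {w})"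
    "\<And>i. i < card A \<Longrightarrow> f i \<in> A \<and> f i \<notin> B \<and> f i \<noteq> w \<and> (f i = a0 \<longleftrightarrow> i = 0) \<and> f i \<noteq> b0 \<and> w \<noteq> f i"
    "\<And>i. i < card B \<Longrightarrow> g i \<in> B \<and> g i \<notin> A \<and> g i \<noteq> w \<and> (g i = b0 \<longleftrightarrow> i = 0) \<and> g i \<noteq> a0 \<and> w \<noteq> g i"
    "card A > 0" "card B > 0"
proof -
  obtain f where f: "bij_betw f {..<card A} A" "f 0 = a0" using bij_betw_lessThan_card[OF fin(1) ab(1)] .
  obtain g where g: "bij_betw g {..<card B} B" "g 0 = b0" using bij_betw_lessThan_card[OF fin(2) ab(2)] .
  have pos: "card A > 0" "card B > 0" using ab fin by (auto simp: card_gt_0_iff)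
  have "bij_betw (ext_map f g (\<lambda>_. w)) (Left ` {..<card A} \<union> Right ` {..<card B} \<union> New ` {..<1}) (A \<union> B \<union> {w})"
    using f g disj by (intro bij_betw_ext_map) (auto simp: bij_betw_def inj_on_def)
  then have bij: "bij_betw (ext_map f g (\<lambda>_. w)) (Left ` {..<card A} \<union> Right ` {..<card B} \<union> {New 0}) (A \<union> B \<union> {w})"
    by (simp add: lessThan_Suc)
  show ?thesis
  proof (rule that[OF bij _ _ pos])
    show "f i \<in> A \<and> f i \<notin> B \<and> f i \<noteq> w \<and> (f i = a0 \<longleftrightarrow> i = 0) \<and> f i \<noteq> b0 \<and> w \<noteq> f i" if "i < card A" for i
      using bij_betw_based[OF f that] disj ab by blast
    show "g i \<in> B \<and> g i \<notin> A \<and> g i \<noteq> w \<and> (g i = b0 \<longleftrightarrow> i = 0) \<and> g i \<noteq> a0 \<and> w \<noteq> g i" if "i < card B" for i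
      using bij_betw_based[OF g that] disj ab by blast
  qed
qed

lemma graph_iso_K_bullet_K3:
  assumes G: "pair_graph G" "pverts G = A \<union> B \<union> {w}" and ab: "a0 \<in> A" "b0 \<in> B"
    and disj: "A \<inter> B = {}" "w \<notin> A" "w \<notin> B" and fin: "finite A" "finite B"
    and arcs: "\<And>u v. (u, v) \<in> parcs G \<longleftrightarrow> u \<in> A \<and> v \<in> B \<or> u \<in> B \<and> v \<in> A \<or>
      u \<in> {a0, b0, w} \<and> v \<in> {a0, b0, w} \<and> u \<noteq> v"
  shows "graph_iso (K_bullet_K3 (card A) (card B)) G"
proof -
  obtain f g where bij': "bij_betw (ext_map f g (\<lambda>_. w)) (Left ` {..<card A} \<union> Right ` {..<card B} \<union> {New 0}) (A \<union> B \<union> {w})"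
    and fA: "\<And>i. i < card A \<Longrightarrow> f i \<in> A \<and> f i \<notin> B \<and> f i \<noteq> w \<and> (f i = a0 \<longleftrightarrow> i = 0) \<and> f i \<noteq> b0 \<and> w \<noteq> f i"
    and gB: "\<And>i. i < card B \<Longrightarrow> g i \<in> B \<and> g i \<notin> A \<and> g i \<noteq> w \<and> (g i = b0 \<longleftrightarrow> i = 0) \<and> g i \<noteq> a0 \<and> w \<noteq> g i"
    and pos: "card A > 0" "card B > 0"
    by (rule ext_map_one_new[OF ab disj fin]) (rule that)
  let ?f = "ext_map f g (\<lambda>_. w)"
  have bij: "bij_betw ?f (pverts (K_bullet_K3 (card A) (card B))) (pverts G)"
    using bij' by (simp only: pverts_K_bullet_K3[OF pos] G(2))
  have ne: "a0 \<notin> B" "b0 \<notin> A" "w \<noteq> a0" "w \<noteq> b0" "a0 \<noteq> w" "b0 \<noteq> w" "a0 \<noteq> b0" "b0 \<noteq> a0"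
    using ab disj by auto
  show ?thesis
    unfolding graph_iso_iff[OF pair_graph_K_bullet_K3 G(1)]
  proof (intro exI[of _ ?f] conjI ballI bij)
    fix u v assume "u \<in> pverts (K_bullet_K3 (card A) (card B))" "v \<in> pverts (K_bullet_K3 (card A) (card B))"
    then show "(u, v) \<in> parcs (K_bullet_K3 (card A) (card B)) \<longleftrightarrow> (?f u, ?f v) \<in> parcs G"
      unfolding pverts_K_bullet_K3[OF pos] arcs parcs_K_bullet_K3
      by (elim UnE imageE insertE emptyE; auto simp: fA gB disj ab ne complete_bipartite_simps)
  qed
qed

lemma graph_iso_K_circ_K3:
  assumes G: "pair_graph G" "pverts G = A \<union> B \<union> {w, w'}" and ab: "b0 \<in> B"
    and disj: "A \<inter> B = {}" "w \<notin> A" "w \<notin> B" "w' \<notin> A" "w' \<notin> B" "w \<noteq> w'" and fin: "finite A" "finite B"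
    and arcs: "\<And>u v. (u, v) \<in> parcs G \<longleftrightarrow> u \<in> A \<and> v \<in> B \<or> u \<in> B \<and> v \<in> A \<or>
      u \<in> {b0, w, w'} \<and> v \<in> {b0, w, w'} \<and> u \<noteq> v"
  shows "graph_iso (K_circ_K3 (card A) (card B)) G"
proof -
  obtain f where f: "bij_betw f {..<card A} A"
    using ex_bij_betw_nat_finite[OF fin(1)] by (auto simp: atLeast0LessThan)
  obtain g where g: "bij_betw g {..<card B} B" "g 0 = b0" using bij_betw_lessThan_card[OF fin(2) ab(1)] .
  let ?h = "\<lambda>k :: nat. if k = 0 then w else w'"
  let ?f = "ext_map f g ?h"
  have pos: "card B > 0" using ab fin by (auto simp: card_gt_0_iff)
  have "{..<2} = {0, 1 :: nat}" by auto
  then have "bij_betw ?h {..<2} {w, w'}" using disj by (auto simp: bij_betw_def inj_on_def)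
  then have "bij_betw ?f (Left ` {..<card A} \<union> Right ` {..<card B} \<union> New ` {..<2}) (A \<union> B \<union> {w, w'})"
    using f g disj by (intro bij_betw_ext_map) auto
  then have bij: "bij_betw ?f (pverts (K_circ_K3 (card A) (card B))) (pverts G)"
    using pos G(2) \<open>{..<2} = {0, 1}\<close> by (simp add: pverts_K_circ_K3)
  have fA: "f i \<in> A" "f i \<notin> B" "f i \<noteq> w" "f i \<noteq> w'" "f i \<noteq> b0" "w \<noteq> f i" "w' \<noteq> f i"
    if "i < card A" for i
    using bij_betw_based(1)[OF f refl that] disj ab by blast+
  have gB: "g i \<in> B" "g i \<notin> A" "g i \<noteq> w" "g i = b0 \<longleftrightarrow> i = 0" "g i \<noteq> w'" "w \<noteq> g i" "w' \<noteq> g i"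
    if "i < card B" for i
    using bij_betw_based[OF g that] disj ab by blast+
  have ne: "b0 \<notin> A" "w \<noteq> b0" "b0 \<noteq> w" "w' \<noteq> b0" "b0 \<noteq> w'" "w' \<noteq> w"
    using ab disj by auto
  show ?thesis
    unfolding graph_iso_iff[OF pair_graph_K_circ_K3 G(1)]
  proof (intro exI[of _ ?f] conjI ballI bij)
    fix u v assume "u \<in> pverts (K_circ_K3 (card A) (card B))" "v \<in> pverts (K_circ_K3 (card A) (card B))"
    then show "(u, v) \<in> parcs (K_circ_K3 (card A) (card B)) \<longleftrightarrow> (?f u, ?f v) \<in> parcs G"
      unfolding pverts_K_circ_K3[OF pos] arcs parcs_K_circ_K3
      by (elim UnE imageE insertE emptyE; auto simp: fA gB disj ab ne complete_bipartite_simps)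
  qed
qed

lemma graph_iso_SK:
  assumes G: "pair_graph G" "pverts G = A \<union> B \<union> {w}" and ab: "a0 \<in> A" "b0 \<in> B"
    and disj: "A \<inter> B = {}" "w \<notin> A" "w \<notin> B" and fin: "finite A" "finite B"
    and arcs: "\<And>u v. (u, v) \<in> parcs G \<longleftrightarrow>
      (u \<in> A \<and> v \<in> B \<or> u \<in> B \<and> v \<in> A) \<and> {u, v} \<noteq> {a0, b0} \<or>
      u = w \<and> v \<in> {a0, b0} \<or> v = w \<and> u \<in> {a0, b0}"
  shows "graph_iso (SK (card A) (card B)) G"
proof -
  obtain f g where bij': "bij_betw (ext_map f g (\<lambda>_. w)) (Left ` {..<card A} \<union> Right ` {..<card B} \<union> {New 0}) (A \<union> B \<union> {w})"
    and fA: "\<And>i. i < card A \<Longrightarrow> f i \<in> A \<and> f i \<notin> B \<and> f i \<noteq> w \<and> (f i = a0 \<longleftrightarrow> i = 0) \<and> f i \<noteq> b0 \<and> w \<noteq> f i"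
    and gB: "\<And>i. i < card B \<Longrightarrow> g i \<in> B \<and> g i \<notin> A \<and> g i \<noteq> w \<and> (g i = b0 \<longleftrightarrow> i = 0) \<and> g i \<noteq> a0 \<and> w \<noteq> g i"
    and pos: "card A > 0" "card B > 0"
    by (rule ext_map_one_new[OF ab disj fin]) (rule that)
  let ?f = "ext_map f g (\<lambda>_. w)"
  have bij: "bij_betw ?f (pverts (SK (card A) (card B))) (pverts G)"
    using bij' by (simp only: pverts_SK G(2))
  have ne: "a0 \<notin> B" "b0 \<notin> A" "w \<noteq> a0" "w \<noteq> b0" "a0 \<noteq> w" "b0 \<noteq> w" "a0 \<noteq> b0" "b0 \<noteq> a0"
    using ab disj by auto
  show ?thesis
    unfolding graph_iso_iff[OF pair_graph_SK[OF pos] G(1)]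
  proof (intro exI[of _ ?f] conjI ballI bij)
    fix u v assume "u \<in> pverts (SK (card A) (card B))" "v \<in> pverts (SK (card A) (card B))"
    then show "(u, v) \<in> parcs (SK (card A) (card B)) \<longleftrightarrow> (?f u, ?f v) \<in> parcs G"
      unfolding pverts_SK arcs parcs_SK[OF pos]
      by (elim UnE imageE insertE emptyE; auto simp: fA gB disj ab ne complete_bipartite_simps doubleton_eq_iff)
  qed
qed

section \<open>Walks of length two from a vertex of maximal Perron weight\<close>

text \<open>The vector is scaled to maximum \<open>1\<close> rather than to unit norm, which makes
  weighted sums directly comparable with cardinalities.\<close>

locale perron_graph =
  fixes V :: "'a set" and E :: "'a \<Rightarrow> 'a \<Rightarrow> bool" and l :: real and x :: "'a \<Rightarrow> real"
  assumes finV: "finite V"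
    and adj_V: "E u v \<Longrightarrow> v \<in> V"
    and adj_sym: "E u v \<Longrightarrow> E v u"
    and adj_irrefl: "\<not> E v v"
    and x_nonneg: "0 \<le> x v"
    and x_le_1: "v \<in> V \<Longrightarrow> x v \<le> 1"
    and x_max: "\<exists>v\<in>V. x v = 1"
    and eigen: "v \<in> V \<Longrightarrow> (\<Sum>u | E v u. x u) = l * x v"
begin

lemma finite_nbrs [simp]: "finite {u. E v u}" "finite {u. E u v}"
  by (rule finite_subset[OF _ finV]; use adj_V adj_sym in blast)+

lemma l_nonneg: "0 \<le> l"
proof -
  obtain u where "u \<in> V" "x u = 1" using x_max by blast
  then have "l = (\<Sum>w | E u w. x w)" using eigen[of u] by simp
  then show ?thesis using x_nonneg by (simp add: sum_nonneg)
qed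

lemma x_le_degree:
  assumes "v \<in> V"
  shows "l * x v \<le> card {u. E v u}"
proof -
  have "(\<Sum>u | E v u. x u) \<le> (\<Sum>u | E v u. 1)"
    using adj_V x_le_1 by (intro sum_mono) blast
  then show ?thesis using eigen[OF assms] by simp
qed

lemma sum_nbrs_weight:
  assumes S: "S \<subseteq> V" "finite S"
  shows "(\<Sum>v\<in>S. \<Sum>w | E v w. x w) = (\<Sum>w\<in>V. x w * card {v \<in> S. E w v})"
proof -
  have "{w. E v w} = {w \<in> V. E v w}" for v using adj_V by blast
  then have "(\<Sum>v\<in>S. \<Sum>w | E v w. x w) = (\<Sum>v\<in>S. \<Sum>w\<in>V. if E v w then x w else 0)"
    using finV by (simp add: sum.inter_filter)
  also have "\<dots> = (\<Sum>w\<in>V. \<Sum>v\<in>S. if E v w then x w else 0)" by (rule sum.swap)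
  also have "\<dots> = (\<Sum>w\<in>V. x w * card {v \<in> S. E w v})"
  proof (rule sum.cong[OF refl])
    fix w
    have "{v \<in> S. E v w} = {v \<in> S. E w v}" using adj_sym by blast
    then show "(\<Sum>v\<in>S. if E v w then x w else 0) = x w * card {v \<in> S. E w v}"
      using S by (simp add: sum.If_cases Int_def)
  qed
  finally show ?thesis .
qed

lemma neighbourhood_edges:
  assumes q: "q \<ge> 2" "r \<ge> 2" and free: "\<not> has_theta E q r" and S: "S = {v. E u v}"
  shows "(\<Sum>v\<in>S. card {w \<in> S. E v w}) \<le> 2 * (q + r) * card S"
proof -
  have "\<not> (\<exists>p. length p = (q + r - 2) + 1 \<and> distinct p \<and> set p \<subseteq> S \<and> successively E p)"
  proof
    assume "\<exists>p. length p = (q + r - 2) + 1 \<and> distinct p \<and> set p \<subseteq> S \<and> successively E p"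
    then obtain p where p: "length p = (q + r - 2) + 1" "distinct p" "set p \<subseteq> S" "successively E p" by blast
    have "has_theta E q r"
    proof (rule theta_fan[OF _ q p(2,4) _ adj_sym adj_irrefl])
      show "length p = q + r - 1" using p(1) q by simp
      show "E u v" if "v \<in> set p" for v using that p(3) S by blast
    qed
    then show False using free by blast
  qed
  then have "(\<Sum>v\<in>S. card {w \<in> S. E v w}) \<le> 2 * (q + r - 2) * card S"
    using S by (intro path_or_few_edges[OF _ adj_sym adj_irrefl]) simp_all
  also have "\<dots> \<le> 2 * (q + r) * card S" by (intro mult_right_mono) auto
  finally show ?thesis .
qed

end

lemma markov_card:
  fixes g :: "'a \<Rightarrow> real" and t :: real
  assumes "finite S" "\<And>a. a \<in> S \<Longrightarrow> 0 \<le> g a" "(\<Sum>a\<in>S. g a) \<le> M" "t > 0"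
  shows "card {a \<in> S. t < g a} * t \<le> M"
proof -
  have "card {a \<in> S. t < g a} * t = (\<Sum>a\<in>{a \<in> S. t < g a}. t)" by simp
  also have "\<dots> \<le> (\<Sum>a\<in>{a \<in> S. t < g a}. g a)" by (rule sum_mono) auto
  also have "\<dots> \<le> (\<Sum>a\<in>S. g a)" using assms by (intro sum_mono2) auto
  finally show ?thesis using assms by linarith
qed

lemma card_filter_split:
  assumes "finite S"
  shows "real (card S) = card {v \<in> S. P v} + card {v \<in> S. \<not> P v}"
proof -
  have "card S = card ({v \<in> S. P v} \<union> {v \<in> S. \<not> P v})" by (rule arg_cong[where f = card]) auto
  also have "\<dots> = card {v \<in> S. P v} + card {v \<in> S. \<not> P v}"
    using assms by (intro card_Un_disjoint) auto
  finally show ?thesis by simp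
qed

context perron_graph
begin

text \<open>
  At the vertex where the Perron vector is maximal, \<open>l\<^sup>2\<close> counts walks of length two with weights
  at most \<open>1\<close>. The neighbourhood \<open>S\<close> spans few edges, so nearly all these walks cross between \<open>S\<close>
  and its complement: this bounds at once the number of missing cross edges, the imbalance of the
  two parts, and the defect of the Perron vector from the constant vector.
\<close>

lemma walk_count:
  assumes q: "q \<ge> 2" "r \<ge> 2" and free: "\<not> has_theta E q r"
  obtains S where "S \<subseteq> V" "l = (\<Sum>v\<in>S. x v)"
    "l\<^sup>2 + (\<Sum>a\<in>V - S. real (card {b \<in> S. \<not> E a b}))
       + (\<Sum>a\<in>V - S. (1 - x a) * card {b \<in> S. E a b})
     \<le> real (card S) * card (V - S) + 2 * real (q + r) * card V"
proof -
  obtain u where u: "u \<in> V" "x u = 1" using x_max by blast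
  define S where "S = {v. E u v}"
  have SV: "S \<subseteq> V" using adj_V by (auto simp: S_def)
  have finS: "finite S" by (simp add: S_def)
  have l1: "l = (\<Sum>v\<in>S. x v)" using eigen[OF u(1)] u(2) by (simp add: S_def)
  have "l\<^sup>2 = l * (\<Sum>v\<in>S. x v)" unfolding l1[symmetric] by (simp add: power2_eq_square)
  also have "\<dots> = (\<Sum>v\<in>S. l * x v)" by (rule sum_distrib_left)
  also have "\<dots> = (\<Sum>v\<in>S. \<Sum>w | E v w. x w)" using eigen SV by (intro sum.cong) auto
  also have "\<dots> = (\<Sum>w\<in>V. x w * card {v \<in> S. E w v})" by (rule sum_nbrs_weight[OF SV finS])
  also have "\<dots> = (\<Sum>w\<in>V - S. x w * card {v \<in> S. E w v}) + (\<Sum>w\<in>S. x w * card {v \<in> S. E w v})"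
    by (rule sum.subset_diff[OF SV finV])
  finally have l2: "l\<^sup>2 = (\<Sum>w\<in>V - S. x w * card {v \<in> S. E w v}) + (\<Sum>w\<in>S. x w * card {v \<in> S. E w v})" .
  have "(\<Sum>w\<in>S. x w * card {v \<in> S. E w v}) \<le> (\<Sum>w\<in>S. real (card {v \<in> S. E w v}))"
    using x_le_1 SV by (intro sum_mono mult_left_le_one_le) (auto simp: x_nonneg)
  also have "\<dots> = real (\<Sum>w\<in>S. card {v \<in> S. E w v})" by simp
  also have "\<dots> \<le> real (2 * (q + r) * card S)"
    using neighbourhood_edges[OF q free S_def] by (simp only: of_nat_le_iff)
  also have "\<dots> \<le> real (2 * (q + r) * card V)"
    using card_mono[OF finV SV] by (simp only: of_nat_le_iff mult_le_mono2)
  finally have inner: "(\<Sum>w\<in>S. x w * card {v \<in> S. E w v}) \<le> 2 * real (q + r) * card V" by simp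
  \<comment> \<open>For each \<open>a\<close> outside \<open>S\<close>, the \<open>card S\<close>
    conceivable steps into \<open>S\<close> split into missing ones, the weight \<open>x a\<close>
    of the present ones, and their defect \<open>1 - x a\<close>.\<close>
  have "(\<Sum>w\<in>V - S. x w * card {v \<in> S. E w v}) + (\<Sum>a\<in>V - S. real (card {b \<in> S. \<not> E a b}))
       + (\<Sum>a\<in>V - S. (1 - x a) * card {b \<in> S. E a b}) = (\<Sum>a\<in>V - S. real (card S))"
    unfolding sum.distrib[symmetric]
    by (rule sum.cong[OF refl]) (use card_filter_split[OF finS] in \<open>simp add: algebra_simps\<close>)
  then have "(\<Sum>w\<in>V - S. x w * card {v \<in> S. E w v}) + (\<Sum>a\<in>V - S. real (card {b \<in> S. \<not> E a b}))
       + (\<Sum>a\<in>V - S. (1 - x a) * card {b \<in> S. E a b}) = real (card S) * card (V - S)"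
    by simp
  with l2 inner show ?thesis by (intro that[OF SV l1]) linarith
qed

text \<open>Since \<open>s * (n - s) = n\<^sup>2 / 4 - (s - n / 2)\<^sup>2\<close>, the missing
  pairs \<open>D1\<close>, the defect \<open>D2\<close> and the squared imbalance add up to at most
  \<open>(2 * k + 2) * n\<close>. By the choice of \<open>n\<close> this is at most
  \<open>2 * 10^-8 * n\<^sup>2\<close>. \<open>X\<close> comes from outside the neighbourhood
  \<open>S\<close>, and \<open>Y\<close> from \<open>S\<close>.\<close>

lemma stable_partition:
  fixes q r :: nat
  defines "n \<equiv> real (card V)"
  assumes q: "q \<ge> 2" "r \<ge> 2" and free: "\<not> has_theta E q r"
    and big: "100000000 * (real (q + r) + 10) \<le> n" and l: "n\<^sup>2 / 4 - 2 * n \<le> l\<^sup>2"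
  obtains X Y where "X \<subseteq> V" "Y \<subseteq> V" "X \<inter> Y = {}"
    "\<And>a. a \<in> X \<Longrightarrow> card {b \<in> Y. \<not> E a b} \<le> n / 1000"
    "\<And>b. b \<in> Y \<Longrightarrow> card {a \<in> X. \<not> E b a} \<le> n / 1000"
    "498 / 1000 * n \<le> card X" "card X \<le> 502 / 1000 * n" "498 / 1000 * n \<le> card Y" "card Y \<le> 502 / 1000 * n"
    "card (V - X - Y) \<le> 1 / 10000 * n" "(\<Sum>v\<in>V. 1 - x v) \<le> 4 / 1000 * n"
    "499 / 1000 * n \<le> l" "l \<le> 502 / 1000 * n"
proof -
  obtain S where S: "S \<subseteq> V" "l = (\<Sum>v\<in>S. x v)" and count:
    "l\<^sup>2 + (\<Sum>a\<in>V - S. real (card {b \<in> S. \<not> E a b}))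
       + (\<Sum>a\<in>V - S. (1 - x a) * card {b \<in> S. E a b})
     \<le> real (card S) * card (V - S) + 2 * real (q + r) * card V"
    using walk_count[OF q free] .
  define T where "T = V - S"
  define D1 where "D1 = (\<Sum>a\<in>T. real (card {b \<in> S. \<not> E a b}))"
  define D2 where "D2 = (\<Sum>a\<in>T. (1 - x a) * card {b \<in> S. E a b})"
  define k where "k = real (q + r)"
  define s where "s = real (card S)"
  have finS: "finite S" and finT: "finite T" using S(1) finV by (auto simp: T_def intro: finite_subset)
  have cT: "real (card T) = n - s"
    using card_Diff_subset[OF finS S(1)] card_mono[OF finV S(1)] by (simp add: T_def n_def s_def of_nat_diff)
  have n: "n \<ge> 1000000000" "100000000 * (k + 10) \<le> n" "k \<ge> 0" using big by (auto simp: k_def)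
  have D1: "D1 \<ge> 0" unfolding D1_def by (simp add: sum_nonneg)
  have D2: "D2 \<ge> 0" unfolding D2_def
    using x_le_1 by (intro sum_nonneg mult_nonneg_nonneg) (auto simp: T_def)
  have "n\<^sup>2 / 4 - 2 * n + D1 + D2 \<le> s * (n - s) + 2 * k * n"
  proof -
    have "l\<^sup>2 + D1 + D2 \<le> s * (n - s) + 2 * k * n"
      using count unfolding cT[symmetric] by (simp add: D1_def D2_def T_def s_def k_def n_def)
    then show ?thesis using l by linarith
  qed
  then have main: "D1 + D2 + (s - n / 2)\<^sup>2 \<le> (2 * k + 2) * n"
    by (simp add: power2_eq_square algebra_simps)
  have kn: "(2 * k + 2) * n \<le> 2 / 100000000 * n * n"
    using n by (intro mult_right_mono) auto
  have "(s - n / 2)\<^sup>2 \<le> (1 / 1000 * n)\<^sup>2"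
  proof -
    have "(1 / 1000 * n)\<^sup>2 = 1 / 1000000 * (n * n)" by (simp add: power2_eq_square)
    moreover have "n * n \<ge> 0" by simp
    ultimately show ?thesis using main D1 D2 kn by linarith
  qed
  then have "\<bar>s - n / 2\<bar> \<le> 1 / 1000 * n" using n by (simp add: abs_le_square_iff[symmetric])
  then have s: "499 / 1000 * n \<le> s" "s \<le> 501 / 1000 * n" by linarith+
  have l_up: "l \<le> s"
  proof -
    have "l \<le> (\<Sum>v\<in>S. 1)" unfolding S(2) using x_le_1 S(1) by (intro sum_mono) auto
    then show ?thesis by (simp add: s_def)
  qed
  have l_low: "499 / 1000 * n \<le> l"
  proof (rule ccontr)
    assume "\<not> ?thesis"
    then have "l\<^sup>2 \<le> (499 / 1000 * n)\<^sup>2" using l_nonneg by (intro power_mono) auto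
    then have "n * n * 999 / 1000000 \<le> 2 * n" using l by (simp add: power2_eq_square)
    then have "n * 999 / 1000000 \<le> 2" using n by (simp add: mult.assoc)
    then show False using n by simp
  qed
  \<comment> \<open>Vertices missing more than \<open>n / 1000\<close> of the opposite set are
    discarded; since \<open>D1\<close> counts the missing pairs, there are few of them on either
    side.\<close>
  define BX where "BX = {a \<in> T. n / 1000 < card {b \<in> S. \<not> E a b}}"
  define BY where "BY = {b \<in> S. n / 1000 < card {a \<in> T. \<not> E b a}}"
  define X where "X = {a \<in> T. \<not> n / 1000 < card {b \<in> S. \<not> E a b}}"
  define Y where "Y = {b \<in> S. \<not> n / 1000 < card {a \<in> T. \<not> E b a}}"
  have swap: "(\<Sum>b\<in>S. real (card {a \<in> T. \<not> E b a})) = D1"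
  proof -
    have "(\<Sum>b\<in>S. real (card {a \<in> T. \<not> E b a})) = (\<Sum>b\<in>S. \<Sum>a\<in>T. if \<not> E b a then 1 else 0)"
      using finT by (simp add: sum.If_cases Int_def)
    also have "\<dots> = (\<Sum>a\<in>T. \<Sum>b\<in>S. if \<not> E b a then 1 else 0)" by (rule sum.swap)
    also have "\<dots> = (\<Sum>a\<in>T. \<Sum>b\<in>S. if \<not> E a b then 1 else 0)"
      using adj_sym by (intro sum.cong refl if_cong) blast
    also have "\<dots> = D1" unfolding D1_def using finS by (simp add: sum.If_cases Int_def)
    finally show ?thesis .
  qed
  have D1n: "D1 \<le> 2 / 100000000 * n * n" using main D2 kn zero_le_power2[of "s - n / 2"] by linarith
  have D2n: "D2 \<le> 2 / 100000000 * n * n" using main D1 kn zero_le_power2[of "s - n / 2"] by linarith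
  have small: "c \<le> 2 / 100000 * n" if "c * (n / 1000) \<le> D1" for c
  proof -
    have "c * n \<le> (2 / 100000 * n) * n" using that D1n by simp
    then show ?thesis using n by (simp add: mult_le_cancel_right)
  qed
  have "card BX * (n / 1000) \<le> D1"
    using n finT
    unfolding BX_def by (intro markov_card[where g = "\<lambda>a. real (card {b \<in> S. \<not> E a b})"]) (auto simp: D1_def)
  then have cX: "real (card BX) \<le> 2 / 100000 * n" by (rule small)
  have "card BY * (n / 1000) \<le> D1"
    using n finS swap
    unfolding BY_def by (intro markov_card[where g = "\<lambda>b. real (card {a \<in> T. \<not> E b a})"]) auto
  then have cY: "real (card BY) \<le> 2 / 100000 * n" by (rule small)
  have X: "real (card X) = n - s - card BX"
    using card_filter_split[OF finT, of "\<lambda>a. n / 1000 < card {b \<in> S. \<not> E a b}"] cT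
    unfolding X_def BX_def by linarith
  have Y: "real (card Y) = s - card BY"
    using card_filter_split[OF finS, of "\<lambda>b. n / 1000 < card {a \<in> T. \<not> E b a}"]
    unfolding Y_def BY_def s_def by linarith
  \<comment> \<open>Vertices of \<open>X\<close> have at least \<open>0.4 * n\<close> neighbours in
    \<open>S\<close>, so their defect appears in \<open>D2\<close> with at least this
    factor.\<close>
  have defX: "(\<Sum>a\<in>X. 1 - x a) \<le> 1 / 10000000 * n"
  proof -
    have "(\<Sum>a\<in>X. 1 - x a) * (4 / 10 * n) = (\<Sum>a\<in>X. (1 - x a) * (4 / 10 * n))" by (rule sum_distrib_right)
    also have "\<dots> \<le> (\<Sum>a\<in>X. (1 - x a) * card {b \<in> S. E a b})"
    proof (intro sum_mono mult_left_mono)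
      fix a assume a: "a \<in> X"
      have "real (card {b \<in> S. E a b}) = s - card {b \<in> S. \<not> E a b}"
        using card_filter_split[OF finS, of "E a"] by (simp add: s_def)
      moreover have "real (card {b \<in> S. \<not> E a b}) \<le> n / 1000" using a by (simp add: X_def)
      ultimately show "4 / 10 * n \<le> card {b \<in> S. E a b}" using s n by linarith
      show "0 \<le> 1 - x a" using a x_le_1[of a] by (simp add: X_def T_def)
    qed
    also have "\<dots> \<le> D2" unfolding D2_def
      using finT x_le_1 by (intro sum_mono2) (auto simp: X_def T_def)
    finally have "(\<Sum>a\<in>X. 1 - x a) * (4 / 10 * n) \<le> (5 / 100000000 * n) * (4 / 10 * n)"
      using D2n by linarith
    then have "(\<Sum>a\<in>X. 1 - x a) \<le> 5 / 100000000 * n" by (rule mult_right_le_imp_le) (use n in simp)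
    then show ?thesis using n by linarith
  qed
  have defT: "(\<Sum>a\<in>T - X. 1 - x a) \<le> 2 / 100000 * n"
  proof -
    have "(\<Sum>a\<in>T - X. 1 - x a) \<le> (\<Sum>a\<in>T - X. 1)" using x_nonneg by (intro sum_mono) simp
    also have "\<dots> = real (card BX)"
      by (simp add: X_def BX_def) (rule arg_cong[where f = card], auto)
    finally show ?thesis using cX by linarith
  qed
  have "(\<Sum>v\<in>V. 1 - x v) = (\<Sum>v\<in>V - S. 1 - x v) + (\<Sum>v\<in>S. 1 - x v)"
    by (rule sum.subset_diff[OF S(1) finV])
  also have "(\<Sum>v\<in>V - S. 1 - x v) = (\<Sum>v\<in>T - X. 1 - x v) + (\<Sum>v\<in>X. 1 - x v)"
    unfolding T_def[symmetric] by (rule sum.subset_diff[OF _ finT]) (auto simp: X_def)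
  \<comment> \<open>On \<open>S\<close> the defect is known exactly, because \<open>l\<close> is the
    sum of the weights of the neighbours of \<open>u\<close>.\<close>
  also have "(\<Sum>v\<in>S. 1 - x v) = s - l" using S(2) by (simp add: sum_subtractf s_def)
  finally have defect: "(\<Sum>v\<in>V. 1 - x v) \<le> 4 / 1000 * n" using defX defT s l_low n by linarith
  have "V - X - Y \<subseteq> BX \<union> BY"
    by (auto simp: X_def Y_def BX_def BY_def T_def)
  then have "card (V - X - Y) \<le> card (BX \<union> BY)"
    using finS finT by (intro card_mono) (auto simp: BX_def BY_def)
  also have "\<dots> \<le> card BX + card BY"
    by (rule card_Un_le)
  finally have rest: "real (card (V - X - Y)) \<le> 1 / 10000 * n" using cX cY n by linarith
  have missX: "real (card {b \<in> Y. \<not> E a b}) \<le> n / 1000" if "a \<in> X" for a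
  proof -
    have "card {b \<in> Y. \<not> E a b} \<le> card {b \<in> S. \<not> E a b}"
      using finS by (intro card_mono) (auto simp: Y_def)
    then show ?thesis using that by (simp add: X_def)
  qed
  have missY: "real (card {a \<in> X. \<not> E b a}) \<le> n / 1000" if "b \<in> Y" for b
  proof -
    have "card {a \<in> X. \<not> E b a} \<le> card {a \<in> T. \<not> E b a}"
      using finT by (intro card_mono) (auto simp: X_def)
    then show ?thesis using that by (simp add: Y_def)
  qed
  show ?thesis
  proof (rule that[OF _ _ _ missX missY _ _ _ _ rest defect l_low])
    show "X \<subseteq> V" "Y \<subseteq> V" "X \<inter> Y = {}" using S(1) by (auto simp: X_def Y_def T_def)
    show "498 / 1000 * n \<le> card X" "card X \<le> 502 / 1000 * n" "498 / 1000 * n \<le> card Y" "card Y \<le> 502 / 1000 * n" "l \<le> 502 / 1000 * n"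
      using X Y cX cY s l_up n by linarith+
  qed
qed

end

section \<open>Graphs close to a balanced complete bipartite graph\<close>

locale stable_graph = perron_graph V E l x
  for V :: "'a set" and E l x +
  fixes X Y :: "'a set" and q r :: nat
  assumes q: "even q" "q \<ge> 2" and r: "r \<ge> 2"
    and theta_free: "\<not> has_theta E q r"
    and big: "100000000 * (real (q + r) + 10) \<le> card V"
    and XV: "X \<subseteq> V" and YV: "Y \<subseteq> V" and XY: "X \<inter> Y = {}"
    and missX: "a \<in> X \<Longrightarrow> card {b \<in> Y. \<not> E a b} \<le> card V / 1000"
    and missY: "b \<in> Y \<Longrightarrow> card {a \<in> X. \<not> E b a} \<le> card V / 1000"
    and cardX: "498 / 1000 * card V \<le> card X" "card X \<le> 502 / 1000 * card V"
    and cardY: "498 / 1000 * card V \<le> card Y" "card Y \<le> 502 / 1000 * card V"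
    and rest: "card (V - X - Y) \<le> 1 / 10000 * card V"
    and defect: "(\<Sum>v\<in>V. 1 - x v) \<le> 4 / 1000 * card V"
    and l_low: "499 / 1000 * card V \<le> l" and l_up: "l \<le> 502 / 1000 * card V"
begin

abbreviation "n \<equiv> real (card V)"
abbreviation "h \<equiv> card V div 1000"
abbreviation "K \<equiv> q + r + 10"

text \<open>The hypotheses are symmetric in \<open>X\<close> and \<open>Y\<close>, so each fact
  about one side has a mirror image.\<close>

lemma swap: "stable_graph V E l x Y X q r"
proof -
  have "V - Y - X = V - X - Y" by blast
  then show ?thesis
    using q r theta_free big XV YV XY missX missY cardX cardY rest defect l_low l_up
    by unfold_locales auto
qed

lemma n_big: "n \<ge> 1000000000" "K \<le> 1 / 100000000 * n" "real h \<le> n / 1000"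
proof -
  show "n \<ge> 1000000000" "K \<le> 1 / 100000000 * n" using big by simp_all
  have "1000 * (card V div 1000) \<le> card V" by simp
  then have "real (1000 * (card V div 1000)) \<le> n" by (simp only: of_nat_le_iff)
  then show "real h \<le> n / 1000" by simp
qed

lemma finX [simp]: "finite X" and finY [simp]: "finite Y"
  using XV YV finV by (auto intro: finite_subset)

lemma miss_nat:
  assumes "real c \<le> n / 1000"
  shows "c \<le> h"
proof -
  have "real (1000 * c) \<le> n" using assms by simp
  then have "1000 * c \<le> card V" by (simp only: of_nat_le_iff)
  then show ?thesis by linarith
qed

sublocale near: near_complete E X Y h K
proof
  have "real (2 * h + K) \<le> 498 / 1000 * n" using n_big by simp
  then have "real (2 * h + K) \<le> real (card X)" "real (2 * h + K) \<le> real (card Y)"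
    using cardX cardY by linarith+
  then show "2 * h + K \<le> card X" "2 * h + K \<le> card Y" by (simp_all only: of_nat_le_iff)
  show "E v u" if "E u v" for u v using that by (rule adj_sym)
qed (use adj_irrefl XY miss_nat[OF missX] miss_nat[OF missY] in simp_all)

text \<open>A class is recognised by neighbours in the opposite core: \<open>A\<close> extends
  \<open>X\<close>, and \<open>B\<close> extends \<open>Y\<close>.\<close>

definition A :: "'a set" where "A = {v \<in> V. 26 / 100 * n \<le> card {y \<in> Y. E v y}}"
definition B :: "'a set" where "B = {v \<in> V. 26 / 100 * n \<le> card {y \<in> X. E v y}}"
definition W :: "'a set" where "W = V - A - B"

lemma swap_A: "stable_graph.A V E X = B" and swap_B: "stable_graph.B V E Y = A"
  by (simp_all add: stable_graph.A_def[OF swap] stable_graph.B_def[OF swap] A_def B_def)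

lemma AV: "A \<subseteq> V" and BV: "B \<subseteq> V" and WV: "W \<subseteq> V"
  by (auto simp: A_def B_def W_def)

lemma fin_ABW [simp]: "finite A" "finite B" "finite W"
  using AV BV WV finV by (auto intro: finite_subset)

lemma X_sub_A: "X \<subseteq> A"
proof
  fix a assume a: "a \<in> X"
  have "498 / 1000 * n \<le> real (card {y \<in> Y. E a y}) + n / 1000"
    using card_filter_split[OF finY, of "E a"] missX[OF a] cardY by linarith
  then have "26 / 100 * n \<le> card {y \<in> Y. E a y}" using n_big by linarith
  then show "a \<in> A" using a XV by (auto simp: A_def)
qed

lemma rich_A:
  assumes "a \<in> A"
  shows "K \<le> card {y \<in> Y. E a y}" "h + K \<le> card {y \<in> Y. E a y}"
proof -
  have "real (h + K) \<le> real (card {y \<in> Y. E a y})" using assms n_big by (simp add: A_def)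
  then show "h + K \<le> card {y \<in> Y. E a y}" by (simp only: of_nat_le_iff)
  then show "K \<le> card {y \<in> Y. E a y}" by linarith
qed

lemma common_lower:
  assumes "c + card Y \<le> card {y \<in> Y. E u y} + card {y \<in> Y. E v y}"
  shows "c \<le> card {y \<in> Y. E u y \<and> E v y}"
proof -
  have "card {y \<in> Y. E u y} + card {y \<in> Y. E v y} =
      card ({y \<in> Y. E u y} \<union> {y \<in> Y. E v y}) + card ({y \<in> Y. E u y} \<inter> {y \<in> Y. E v y})"
    by (rule card_Un_Int) auto
  moreover have "card ({y \<in> Y. E u y} \<union> {y \<in> Y. E v y}) \<le> card Y" by (rule card_mono) auto
  moreover have "{y \<in> Y. E u y} \<inter> {y \<in> Y. E v y} = {y \<in> Y. E u y \<and> E v y}" by blast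
  ultimately show ?thesis using assms by simp
qed

text \<open>Two neighbourhoods of size \<open>0.26 * n\<close> inside \<open>Y\<close>, of size at
  most \<open>0.502 * n\<close>, overlap in at least \<open>0.018 * n\<close> vertices.\<close>

lemma common_A:
  assumes "a \<in> A" "a' \<in> A"
  shows "K \<le> card {y \<in> Y. E a y \<and> E a' y}"
proof (rule common_lower)
  have "real (K + card Y) \<le> real (card {y \<in> Y. E a y} + card {y \<in> Y. E a' y})"
    using assms cardY n_big by (simp add: A_def)
  then show "K + card Y \<le> card {y \<in> Y. E a y} + card {y \<in> Y. E a' y}" by (simp only: of_nat_le_iff)
qed

lemma A_independent:
  assumes "a \<in> A" "a' \<in> A"
  shows "\<not> E a a'"
  using near.theta_same_side[OF _ common_A[OF assms] q r] theta_free by auto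

text \<open>As \<open>a\<close> misses at most \<open>h\<close> vertices of \<open>Y\<close>,
  otherwise \<open>w\<close> and \<open>a\<close> would have \<open>K\<close> common neighbours
  there and \<open>w a\<close> would act as an edge inside a side.\<close>

lemma W_one_sided:
  assumes w: "E w a" "a \<in> X"
  shows "card {y \<in> Y. E w y} < h + K"
proof (rule ccontr)
  assume "\<not> ?thesis"
  then have "K + card Y \<le> card {y \<in> Y. E w y} + card {y \<in> Y. E a y}" using near.degX[OF w(2)] by linarith
  from common_lower[OF this] have "has_theta E q r" using near.theta_same_side[OF w(1) _ q r] by simp
  then show False using theta_free by blast
qed

end

section \<open>The two classes and the exceptional vertices\<close>

context stable_graph
begin

lemma Y_sub_B: "Y \<subseteq> B"
  using stable_graph.X_sub_A[OF swap] by (simp only: swap_A)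

lemma rich_B:
  assumes "b \<in> B"
  shows "K \<le> card {y \<in> X. E b y}" "h + K \<le> card {y \<in> X. E b y}"
  using stable_graph.rich_A[OF swap, unfolded swap_A] assms by blast+

lemma B_independent: "b \<in> B \<Longrightarrow> b' \<in> B \<Longrightarrow> \<not> E b b'"
  using stable_graph.A_independent[OF swap, unfolded swap_A] by blast

text \<open>A vertex of both classes would have a neighbour in \<open>X\<close>, hence an edge
  inside \<open>A\<close>.\<close>

lemma A_B_disjoint: "A \<inter> B = {}"
proof (rule ccontr)
  assume "A \<inter> B \<noteq> {}"
  then obtain v where v: "v \<in> A" "v \<in> B" by blast
  have "card {y \<in> X. E v y} > 0" using rich_B(1)[OF v(2)] by linarith
  then obtain a where "a \<in> X" "E v a" by (auto simp: card_gt_0_iff)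
  then show False using A_independent v X_sub_A by blast
qed

lemma V_eq: "A \<union> B \<union> W = V" and W_disjoint: "A \<inter> W = {}" "B \<inter> W = {}"
  using AV BV by (auto simp: W_def)

lemma card_V: "card V = card A + card B + card W"
  using V_eq A_B_disjoint W_disjoint card_Un_disjoint[of "A \<union> B" W] card_Un_disjoint[of A B] by auto

lemma sum_V: "sum f V = sum f (A \<union> B) + sum f W" for f :: "'a \<Rightarrow> real"
proof -
  have "sum f (A \<union> B \<union> W) = sum f (A \<union> B) + sum f W"
    using W_disjoint by (intro sum.union_disjoint) auto
  then show ?thesis by (simp only: V_eq)
qed

lemma card_A_B: "498 / 1000 * n \<le> card A" "498 / 1000 * n \<le> card B"
  using cardX cardY card_mono[OF _ X_sub_A] card_mono[OF _ Y_sub_B] by simp_all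

lemma card_W: "card W \<le> 1 / 10000 * n"
proof -
  have "W \<subseteq> V - X - Y" using X_sub_A Y_sub_B by (auto simp: W_def)
  then have "card W \<le> card (V - X - Y)" using finV by (intro card_mono) auto
  then show ?thesis using rest by linarith
qed

text \<open>Only one of the two neighbour counts can be substantial: a neighbour in \<open>X\<close>
  makes the count into \<open>Y\<close> negligible by \<open>W_one_sided\<close>. The other count is
  below \<open>0.26 * n\<close>; the excess \<open>0.002 * n\<close> absorbs the rest.\<close>

lemma degree_W:
  assumes "w \<in> W"
  shows "card {u. E w u} \<le> 262 / 1000 * n"
proof -
  have w: "card {y \<in> Y. E w y} < 26 / 100 * n" "card {y \<in> X. E w y} < 26 / 100 * n"
    using assms by (auto simp: W_def A_def B_def)
  have hK: "real (h + K) \<le> 11 / 10000 * n" using n_big by simp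
  have "real (card {y \<in> Y. E w y}) + card {y \<in> X. E w y} \<le> 2611 / 10000 * n"
  proof (cases "\<exists>a\<in>X. E w a")
    case True
    then have "card {y \<in> Y. E w y} < h + K" using W_one_sided by blast
    then have "real (card {y \<in> Y. E w y}) \<le> real (h + K)" by (simp only: of_nat_le_iff)
    then show ?thesis using w hK by linarith
  next
    case False
    then have "{y \<in> X. E w y} = {}" by blast
    then have "card {y \<in> X. E w y} = 0" by (simp only: card.empty)
    then show ?thesis using w n_big by linarith
  qed
  moreover have "card {u. E w u} \<le> card {y \<in> Y. E w y} + card {y \<in> X. E w y} + card (V - X - Y)"
  proof -
    have "{u. E w u} \<subseteq> {y \<in> Y. E w y} \<union> {y \<in> X. E w y} \<union> (V - X - Y)" using adj_V by blast
    then have "card {u. E w u} \<le> card ({y \<in> Y. E w y} \<union> {y \<in> X. E w y} \<union> (V - X - Y))"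
      using finV by (intro card_mono) auto
    also have "\<dots> \<le> card ({y \<in> Y. E w y} \<union> {y \<in> X. E w y}) + card (V - X - Y)" by (rule card_Un_le)
    also have "\<dots> \<le> card {y \<in> Y. E w y} + card {y \<in> X. E w y} + card (V - X - Y)"
      using card_Un_le[of "{y \<in> Y. E w y}" "{y \<in> X. E w y}"] by simp
    finally show ?thesis .
  qed
  ultimately show ?thesis using rest n_big by linarith
qed

lemma l_pos: "l > 0"
  using l_low n_big by linarith

section \<open>Cross edges against the weight of the exceptional vertices\<close>

definition M :: nat where "M = card {(a, b) \<in> A \<times> B. \<not> E a b}"
definition e :: nat where "e = card {(a, b) \<in> A \<times> B. E a b}"

lemma e_M: "e + M = card A * card B"
proof -
  have "card (A \<times> B) = card ({(a, b) \<in> A \<times> B. E a b} \<union> {(a, b) \<in> A \<times> B. \<not> E a b})"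
    by (rule arg_cong[where f = card]) auto
  also have "\<dots> = e + M" unfolding e_def M_def
    by (rule card_Un_disjoint) (auto intro: finite_subset[of _ "A \<times> B"])
  finally show ?thesis by (simp add: card_cartesian_product)
qed

definition N :: real where "N = (\<Sum>v\<in>V. (x v)\<^sup>2)"
definition NW :: real where "NW = (\<Sum>v\<in>W. (x v)\<^sup>2)"
definition cross :: real where "cross = (\<Sum>(a, b)\<in>{(a, b) \<in> A \<times> B. E a b}. x a * x b)"

text \<open>The tangent inequality \<open>(x v)\<^sup>2 \<ge> 1 - 2 * (1 - x v)\<close> loses at
  most twice the total defect, that is \<open>0.008 * n\<close>.\<close>

lemma N_bounds: "992 / 1000 * n \<le> N" "N \<le> n"
proof -
  have "(\<Sum>v\<in>V. 1 - 2 * (1 - x v)) \<le> N" unfolding N_def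
  proof (rule sum_mono)
    fix v
    have "0 \<le> (1 - x v)\<^sup>2" by simp
    then show "1 - 2 * (1 - x v) \<le> (x v)\<^sup>2" by (simp add: power2_eq_square algebra_simps)
  qed
  moreover have "(\<Sum>v\<in>V. 1 - 2 * (1 - x v)) = n - 2 * (\<Sum>v\<in>V. 1 - x v)"
    by (simp add: sum_subtractf sum_distrib_left)
  ultimately show "992 / 1000 * n \<le> N" using defect by linarith
  have "N \<le> (\<Sum>v\<in>V. 1)" unfolding N_def
    using x_le_1 x_nonneg by (intro sum_mono) (auto simp: power_le_one)
  then show "N \<le> n" by simp
qed

lemma N_split: "N = (\<Sum>v\<in>A. (x v)\<^sup>2) + (\<Sum>v\<in>B. (x v)\<^sup>2) + NW"
proof -
  have "N = (\<Sum>v\<in>A \<union> B. (x v)\<^sup>2) + NW" unfolding N_def NW_def by (rule sum_V)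
  also have "(\<Sum>v\<in>A \<union> B. (x v)\<^sup>2) = (\<Sum>v\<in>A. (x v)\<^sup>2) + (\<Sum>v\<in>B. (x v)\<^sup>2)"
    using A_B_disjoint by (intro sum.union_disjoint) auto
  finally show ?thesis .
qed

text \<open>The row of \<open>u\<close> sums to \<open>l * (x u)\<^sup>2\<close>. The arcs leaving
  \<open>W\<close> therefore carry \<open>l * NW\<close>, and those entering it from
  \<open>A \<union> B\<close> at most as much. Since both classes are independent, all others are
  cross arcs, each edge counted twice.\<close>

lemma rayleigh_cross: "l * N \<le> 2 * cross + 2 * (l * NW)"
proof -
  define a where "a u v = (if E u v then x u * x v else 0)" for u v
  have a0: "a u v \<ge> 0" for u v using x_nonneg by (simp add: a_def)
  have asym: "a u v = a v u" for u v using adj_sym by (auto simp: a_def)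
  have row: "(\<Sum>v\<in>V. a u v) = l * (x u)\<^sup>2" if "u \<in> V" for u
  proof -
    have "(\<Sum>v\<in>V. a u v) = (\<Sum>v | E u v. x u * x v)"
      unfolding a_def using finV adj_V
      by (subst sum.inter_filter[symmetric]) (auto intro!: sum.cong)
    also have "\<dots> = x u * (l * x u)" using eigen[OF that] by (simp add: sum_distrib_left[symmetric])
    finally show ?thesis by (simp add: power2_eq_square)
  qed
  have "l * N = (\<Sum>u\<in>V. \<Sum>v\<in>V. a u v)" using row by (simp add: N_def sum_distrib_left)
  also have "\<dots> = (\<Sum>u\<in>A \<union> B. \<Sum>v\<in>V. a u v) + (\<Sum>u\<in>W. \<Sum>v\<in>V. a u v)"
    by (rule sum_V)
  also have "(\<Sum>u\<in>W. \<Sum>v\<in>V. a u v) = l * NW"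
    unfolding NW_def sum_distrib_left using row WV by (intro sum.cong) auto
  also have "(\<Sum>u\<in>A \<union> B. \<Sum>v\<in>V. a u v) = (\<Sum>u\<in>A \<union> B. \<Sum>v\<in>A \<union> B. a u v) + (\<Sum>u\<in>A \<union> B. \<Sum>v\<in>W. a u v)"
  proof -
    have "(\<Sum>v\<in>V. a u v) = (\<Sum>v\<in>A \<union> B. a u v) + (\<Sum>v\<in>W. a u v)" for u
      by (rule sum_V)
    then show ?thesis by (simp add: sum.distrib)
  qed
  also have "(\<Sum>u\<in>A \<union> B. \<Sum>v\<in>W. a u v) \<le> l * NW"
  proof -
    have "(\<Sum>u\<in>A \<union> B. \<Sum>v\<in>W. a u v) \<le> (\<Sum>u\<in>V. \<Sum>v\<in>W. a u v)"
      using a0 AV BV finV by (intro sum_mono2) (auto intro: sum_nonneg)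
    also have "\<dots> = (\<Sum>v\<in>W. \<Sum>u\<in>V. a v u)" by (subst sum.swap) (simp add: asym)
    also have "\<dots> = l * NW"
      unfolding NW_def sum_distrib_left using row WV by (intro sum.cong) auto
    finally show ?thesis .
  qed
  also have "(\<Sum>u\<in>A \<union> B. \<Sum>v\<in>A \<union> B. a u v) = 2 * cross"
  proof -
    have z: "a u v = 0" if "u \<in> A \<and> v \<in> A \<or> u \<in> B \<and> v \<in> B" for u v
      using that A_independent B_independent by (auto simp: a_def)
    have "(\<Sum>u\<in>A \<union> B. \<Sum>v\<in>A \<union> B. a u v) =
        (\<Sum>u\<in>A. \<Sum>v\<in>A \<union> B. a u v) + (\<Sum>u\<in>B. \<Sum>v\<in>A \<union> B. a u v)"
      using A_B_disjoint by (intro sum.union_disjoint) auto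
    also have "(\<Sum>u\<in>A. \<Sum>v\<in>A \<union> B. a u v) = (\<Sum>u\<in>A. \<Sum>v\<in>B. a u v)"
      using z by (intro sum.cong refl sum.mono_neutral_right) auto
    also have "(\<Sum>u\<in>B. \<Sum>v\<in>A \<union> B. a u v) = (\<Sum>u\<in>B. \<Sum>v\<in>A. a u v)"
      using z by (intro sum.cong refl sum.mono_neutral_right) auto
    also have "\<dots> = (\<Sum>u\<in>A. \<Sum>v\<in>B. a u v)" by (subst sum.swap) (simp add: asym)
    also have "(\<Sum>u\<in>A. \<Sum>v\<in>B. a u v) = (\<Sum>(u, v)\<in>A \<times> B. a u v)" by (rule sum.cartesian_product)
    also have "\<dots> = cross" unfolding cross_def a_def split_def
      by (subst sum.inter_filter[symmetric]) (auto simp: mem_Times_iff intro!: sum.cong)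
    finally show ?thesis by simp
  qed
  finally show ?thesis by linarith
qed

text \<open>Cauchy-Schwarz over the \<open>e\<close> cross edges, then the inequality of arithmetic
  and geometric means: the bound \<open>sqrt e\<close> for the radius of a bipartite graph in
  Rayleigh form.\<close>

lemma cross_le: "2 * cross \<le> sqrt e * (N - NW)"
proof -
  let ?S = "{(a, b) \<in> A \<times> B. E a b}"
  define p where "p = (\<Sum>v\<in>A. (x v)\<^sup>2)"
  define s where "s = (\<Sum>v\<in>B. (x v)\<^sup>2)"
  have ps: "p \<ge> 0" "s \<ge> 0" by (simp_all add: p_def s_def sum_nonneg)
  have fS: "finite ?S" by (rule finite_subset[of _ "A \<times> B"]) auto
  have "(\<Sum>(a, b)\<in>?S. x a * x b)\<^sup>2 = (\<Sum>i\<in>?S. 1 * (case i of (a, b) \<Rightarrow> x a * x b))\<^sup>2" by simp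
  also have "\<dots> \<le> (\<Sum>i\<in>?S. 1\<^sup>2) * (\<Sum>i\<in>?S. (case i of (a, b) \<Rightarrow> x a * x b)\<^sup>2)"
    by (rule Cauchy_Schwarz_ineq_sum)
  also have "(\<Sum>i\<in>?S. (1::real)\<^sup>2) = e" by (simp add: e_def)
  also have "(\<Sum>i\<in>?S. (case i of (a, b) \<Rightarrow> x a * x b)\<^sup>2) \<le> (\<Sum>i\<in>A \<times> B. (case i of (a, b) \<Rightarrow> x a * x b)\<^sup>2)"
    by (rule sum_mono2) auto
  also have "\<dots> = (\<Sum>(a, b)\<in>A \<times> B. (x a)\<^sup>2 * (x b)\<^sup>2)"
    by (rule sum.cong) (auto simp: power_mult_distrib)
  also have "\<dots> = p * s" unfolding p_def s_def
    by (simp add: sum_product sum.cartesian_product)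
  finally have "cross\<^sup>2 \<le> e * (p * s)" by (simp add: cross_def mult_left_mono)
  then have "cross \<le> sqrt (e * (p * s))" by (rule real_le_rsqrt)
  also have "\<dots> = sqrt e * sqrt (p * s)" by (rule real_sqrt_mult)
  also have "\<dots> \<le> sqrt e * ((p + s) / 2)"
    using arith_geo_mean_sqrt[OF ps] by (intro mult_left_mono) auto
  finally show ?thesis using N_split by (simp add: p_def s_def)
qed

lemma NW_nonneg: "0 \<le> NW"
  by (simp add: NW_def sum_nonneg)

lemma x_W: "w \<in> W \<Longrightarrow> x w \<le> card {u. E w u} / l"
  using x_le_degree[of w] WV l_pos by (auto simp: field_simps)

text \<open>The price of deleting \<open>W\<close>. The two previous bounds give
  \<open>l * (1 - t) \<le> sqrt e\<close> with \<open>t = NW / (N - NW)\<close>, and squaring costs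
  at most \<open>2 * l\<^sup>2 * t\<close>.\<close>

lemma e_lower:
  assumes NW: "NW \<le> 1 / 1000 * n"
  shows "l\<^sup>2 - 51 / 100 * n * NW \<le> e"
proof -
  define D where "D = N - NW"
  have D: "991 / 1000 * n \<le> D" "D > 0" using N_bounds NW n_big by (auto simp: D_def)
  have "l * (D - NW) \<le> sqrt e * D" using rayleigh_cross cross_le by (simp add: D_def algebra_simps)
  then have 1: "l * (1 - NW / D) \<le> sqrt e" using D(2) by (simp add: field_simps)
  define t where "t = NW / D"
  have t: "0 \<le> t" "t \<le> 1" using NW NW_nonneg D n_big by (auto simp: t_def field_simps)
  have "l\<^sup>2 * (1 - 2 * t) \<le> l\<^sup>2 * (1 - t)\<^sup>2"
    by (intro mult_left_mono) (auto simp: power2_eq_square algebra_simps)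
  also have "\<dots> = (l * (1 - t))\<^sup>2" by (simp add: power_mult_distrib)
  also have "\<dots> \<le> (sqrt e)\<^sup>2" using 1 t l_nonneg by (intro power_mono) (auto simp: t_def)
  finally have 2: "l\<^sup>2 - 2 * l\<^sup>2 * t \<le> e" by (simp add: algebra_simps)
  have "l\<^sup>2 \<le> (502 / 1000 * n)\<^sup>2" using l_up l_nonneg by (intro power_mono) auto
  moreover have "(502 / 1000 * n)\<^sup>2 = 252004 / 1000000 * (n * n)" by (simp add: power2_eq_square)
  moreover have "0 \<le> n * n" by simp
  \<comment> \<open>Numerically \<open>2 * 0.502^2 < 0.505 < 0.51 * 0.991\<close>, whence the factor
    \<open>0.51 * n\<close> per unit of \<open>NW\<close>.\<close>
  ultimately have "2 * l\<^sup>2 \<le> 505 / 1000 * n * n" by linarith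
  also have "\<dots> \<le> 51 / 100 * n * D"
  proof -
    have "n * (505 / 1000 * n) \<le> n * (51 / 100 * D)" using D n_big by (intro mult_left_mono) auto
    then show ?thesis by (simp add: mult_ac)
  qed
  finally have "2 * l\<^sup>2 * t \<le> 51 / 100 * n * D * t" using t by (intro mult_right_mono)
  also have "\<dots> = 51 / 100 * n * NW" using D(2) by (simp add: t_def)
  finally show ?thesis using 2 by linarith
qed

text \<open>By the degree bound, weights on \<open>W\<close> are at most
  \<open>0.262 / 0.499 < 0.526\<close>, whose square is below \<open>0.277\<close>.\<close>

lemma NW_W: "NW \<le> 277 / 1000 * card W"
proof -
  have "(x w)\<^sup>2 \<le> 277 / 1000" if w: "w \<in> W" for w
  proof -
    have "x w * (499 / 1000 * n) \<le> x w * l" using l_low x_nonneg by (intro mult_left_mono)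
    also have "\<dots> \<le> 262 / 1000 * n"
      using x_le_degree[of w] degree_W[OF w] w WV by (simp add: mult.commute subset_iff)
    finally have "x w * (499 / 1000) * n \<le> 262 / 1000 * n" by simp
    then have "x w * (499 / 1000) \<le> 262 / 1000" by (rule mult_right_le_imp_le) (use n_big in simp)
    then have "x w \<le> 526 / 1000" by simp
    then have "(x w)\<^sup>2 \<le> (526 / 1000)\<^sup>2" using x_nonneg by (intro power_mono) auto
    then show ?thesis by (simp add: power2_eq_square)
  qed
  then have "NW \<le> (\<Sum>w\<in>W. 277 / 1000)" unfolding NW_def by (rule sum_mono)
  then show ?thesis by simp
qed

text \<open>With \<open>s\<close> instead of \<open>t\<close> exceptional vertices, the maximal
  number of cross edges drops by about \<open>n * (s - t) / 2\<close>, while the weight of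
  \<open>W\<close> makes up for at most \<open>0.142 * n * s\<close>. Up to a vanishing error this
  leaves \<open>s \<le> 1.4 * t\<close>, which is below \<open>t + 1\<close> for
  \<open>t \<le> 2\<close>.\<close>

lemma card_W_le:
  assumes t: "t \<in> {1, 2}" and l: "(n - t)\<^sup>2 / 4 - 3 \<le> l\<^sup>2"
  shows "card W \<le> t"
proof (rule ccontr)
  assume "\<not> card W \<le> t"
  define s where "s = real (card W)"
  have s: "s \<ge> t + 1" "s \<le> 1 / 10000 * n" using \<open>\<not> card W \<le> t\<close> card_W by (auto simp: s_def)
  have NW: "NW \<le> 277 / 1000 * s" using NW_W by (simp add: s_def)
  then have el: "l\<^sup>2 - 51 / 100 * n * NW \<le> e" using s n_big by (intro e_lower) linarith
  have "51 / 100 * n * NW \<le> 51 / 100 * n * (277 / 1000 * s)"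
    using NW n_big by (intro mult_left_mono) auto
  then have el': "l\<^sup>2 - 142 / 1000 * (n * s) \<le> e"
  proof -
    have "51 / 100 * n * (277 / 1000 * s) = 14127 / 100000 * (n * s)" by simp
    moreover have "0 \<le> n * s" by (simp add: s_def)
    ultimately show ?thesis using el \<open>51 / 100 * n * NW \<le> 51 / 100 * n * (277 / 1000 * s)\<close> by linarith
  qed
  have "real e \<le> real (card A) * card B" using e_M by (metis le_add1 of_nat_le_iff of_nat_mult)
  also have "\<dots> \<le> (real (card A) + card B)\<^sup>2 / 4"
    using zero_le_power2[of "real (card A) - card B"] by (simp add: power2_eq_square algebra_simps)
  also have "real (card A) + card B = n - s" using card_V by (simp add: s_def)
  finally have "(n - t)\<^sup>2 / 4 - 3 - 142 / 1000 * (n * s) \<le> (n - s)\<^sup>2 / 4" using l el' by linarith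
  then have "2 * n * s - 568 / 1000 * (n * s) \<le> 2 * n * t + s * s + 12"
  proof -
    have "(n - t)\<^sup>2 = n * n - 2 * n * t + real t * t" "(n - s)\<^sup>2 = n * n - 2 * n * s + s * s"
      by (simp_all add: power2_eq_square algebra_simps)
    moreover have "0 \<le> real t * t" by simp
    ultimately show ?thesis
      using \<open>(n - t)\<^sup>2 / 4 - 3 - 142 / 1000 * (n * s) \<le> (n - s)\<^sup>2 / 4\<close> by linarith
  qed
  moreover have "s * s \<le> 1 / 10000 * n * s" using s t by (intro mult_right_mono) auto
  ultimately have "143 / 100 * (n * s) \<le> 2 * n * t + 12"
    using n_big mult_nonneg_nonneg[of n s] s t by linarith
  moreover have "n * (t + 1) \<le> n * s" using s n_big by (intro mult_left_mono) auto
  ultimately have "143 / 100 * (n * (t + 1)) \<le> 2 * n * t + 12" by linarith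
  then show False using t n_big by auto
qed

end

section \<open>Structure of the extremal candidates\<close>

text \<open>The maximum of \<open>a * b\<close> over all \<open>a + b = m\<close>.\<close>

definition balanced_product :: "nat \<Rightarrow> nat" where
  "balanced_product m = (m div 2) * (m - m div 2)"

text \<open>The two roots in \<open>a\<close> are consecutive or equal integers, so the product is
  nonnegative for integral \<open>a\<close> and vanishes only at the balanced sizes.\<close>

lemma balanced_product_diff:
  fixes a b m :: nat
  assumes "a + b = m"
  shows "int (balanced_product m) - int (a * b) =
    (int (m div 2) - int a) * (int (m - m div 2) - int a)"
proof -
  have b: "int b = int (m div 2) + int (m - m div 2) - int a" using assms by linarith
  show ?thesis unfolding balanced_product_def of_nat_mult b by (simp add: algebra_simps)
qed

lemma balanced_product_cases:
  fixes m :: nat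
  shows "int (m - m div 2) = int (m div 2) \<or> int (m - m div 2) = int (m div 2) + 1"
  by linarith

lemma balanced_product_ge:
  assumes "a + b = m"
  shows "a * b \<le> balanced_product m"
proof -
  have "0 \<le> (int (m div 2) - int a) * (int (m - m div 2) - int a)"
    using balanced_product_cases[of m] by (auto simp: zero_le_mult_iff)
  then have "int (a * b) \<le> int (balanced_product m)" using balanced_product_diff[OF assms] by linarith
  then show ?thesis by (simp only: of_nat_le_iff)
qed

lemma balanced_product_eqD:
  assumes "a + b = m" "a * b = balanced_product m"
  shows "a = m div 2 \<and> b = m - m div 2 \<or> b = m div 2 \<and> a = m - m div 2"
proof -
  have "(int (m div 2) - int a) * (int (m - m div 2) - int a) = 0"
    using balanced_product_diff[OF assms(1)] assms(2) by simp
  then have "a = m div 2 \<or> a = m - m div 2" by auto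
  then show ?thesis using assms(1) by auto
qed

lemma sub_inverse_square_le:
  fixes p l :: real
  assumes "p \<ge> 1" "p - 1 / p \<le> l"
  shows "p * p - 2 \<le> l\<^sup>2"
proof -
  have "1 / p \<le> p" using assms(1) by (simp add: divide_le_eq mult_ge1_I)
  then have "(p - 1 / p)\<^sup>2 \<le> l\<^sup>2" using assms(2) by (intro power_mono) auto
  moreover have "(p - 1 / p)\<^sup>2 = p * p - 2 + 1 / p * (1 / p)"
    using assms(1) by (simp add: power2_eq_square algebra_simps)
  moreover have "0 \<le> 1 / p * (1 / p)" by simp
  ultimately show ?thesis by linarith
qed

lemma balanced_product_lower: "((real m)\<^sup>2 - 1) / 4 \<le> real (balanced_product m)"
proof -
  define p where "p = real (m div 2)"
  define p' where "p' = real (m - m div 2)"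
  have m: "real m = p + p'" unfolding p_def p'_def by linarith
  have "p' = p \<or> p' = p + 1" using balanced_product_cases[of m] unfolding p_def p'_def by linarith
  then have "((p + p')\<^sup>2 - 1) / 4 \<le> p * p'" by (auto simp: power2_eq_square algebra_simps)
  then show ?thesis unfolding balanced_product_def m by (simp add: p_def p'_def)
qed

context stable_graph
begin

text \<open>A two-colouring is encoded by one set over the whole type, so that sets like
  \<open>A\<close> or \<open>insert w A\<close> can be tested directly.\<close>

definition nonbip :: bool where
  "nonbip \<longleftrightarrow> (\<forall>U. \<exists>u v. E u v \<and> (u \<in> U \<longleftrightarrow> v \<in> U))"

lemma swap_W: "stable_graph.W V E Y X = W"
  by (simp add: stable_graph.W_def[OF swap] swap_A swap_B W_def) blast

lemma swap_M: "stable_graph.M V E Y X = M"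
proof -
  have "bij_betw prod.swap {(b, a) \<in> B \<times> A. \<not> E b a} {(a, b) \<in> A \<times> B. \<not> E a b}"
    by (rule bij_betwI[where g = prod.swap]) (auto dest: adj_sym)
  then have "card {(b, a) \<in> B \<times> A. \<not> E b a} = card {(a, b) \<in> A \<times> B. \<not> E a b}"
    by (rule bij_betw_same_card)
  then show ?thesis by (simp only: stable_graph.M_def[OF swap] swap_A swap_B M_def)
qed

lemma adj_ends: "E u v \<Longrightarrow> u \<in> V \<and> v \<in> V"
  using adj_V adj_sym by blast

lemma W_nonempty:
  assumes nonbip
  shows "W \<noteq> {}"
proof
  assume W: "W = {}"
  obtain u v where uv: "E u v" "u \<in> A \<longleftrightarrow> v \<in> A" using assms unfolding nonbip_def by blast
  have "u \<in> A \<or> u \<in> B" "v \<in> A \<or> v \<in> B" using adj_ends[OF uv(1)] V_eq W by blast+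
  then show False using uv A_independent[of u v] B_independent[of u v] by blast
qed

lemma adj_cases_single:
  assumes W: "W = {w}" and uv: "E u v"
  shows "u \<in> A \<and> v \<in> B \<or> u \<in> B \<and> v \<in> A \<or> u = w \<and> v \<in> A \<or> u = w \<and> v \<in> B \<or>
    v = w \<and> u \<in> A \<or> v = w \<and> u \<in> B"
proof -
  have "u \<in> A \<or> u \<in> B \<or> u = w" "v \<in> A \<or> v \<in> B \<or> v = w"
    using adj_ends[OF uv] V_eq W by blast+
  moreover have "\<not> (u = w \<and> v = w)" using uv adj_irrefl by blast
  ultimately show ?thesis using uv A_independent[of u v] B_independent[of u v] by blast
qed

text \<open>If \<open>w\<close> had no neighbour on one side, it could join that side and the graph
  would be two-coloured.\<close>

lemma W_singleton_nbrs:
  assumes nb: nonbip and W: "W = {w}"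
  obtains a b where "a \<in> A" "E w a" "b \<in> B" "E w b"
proof -
  have wAB: "w \<notin> A" "w \<notin> B" using W W_disjoint by auto
  have "\<exists>a\<in>A. E w a"
  proof (rule ccontr)
    assume no: "\<not> ?thesis"
    obtain u v where uv: "E u v" "u \<in> insert w A \<longleftrightarrow> v \<in> insert w A"
      using nb unfolding nonbip_def by blast
    then show False using adj_cases_single[OF W uv(1)] no wAB A_B_disjoint adj_sym[OF uv(1)] by blast
  qed
  moreover have "\<exists>b\<in>B. E w b"
  proof (rule ccontr)
    assume no: "\<not> ?thesis"
    obtain u v where uv: "E u v" "u \<in> A \<longleftrightarrow> v \<in> A"
      using nb unfolding nonbip_def by blast
    then show False using adj_cases_single[OF W uv(1)] no wAB A_B_disjoint adj_sym[OF uv(1)] by blast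
  qed
  ultimately show ?thesis using that by blast
qed

lemma M_ge:
  assumes "Z \<subseteq> {(a, b) \<in> A \<times> B. \<not> E a b}"
  shows "card Z \<le> M"
  unfolding M_def using assms by (intro card_mono) (auto intro: finite_subset[of _ "A \<times> B"])

lemma M_ge_almost_independent:
  assumes S: "S \<subseteq> A" "T \<subseteq> B" and one: "\<And>a. a \<in> S \<Longrightarrow> card {b \<in> T. E a b} \<le> 1"
  shows "card S * (card T - 1) \<le> M"
proof -
  have fin: "finite S" "finite T" using S by (auto intro: finite_subset)
  have "card S * (card T - 1) = (\<Sum>a\<in>S. card T - 1)" by simp
  also have "\<dots> \<le> (\<Sum>a\<in>S. card {b \<in> T. \<not> E a b})"
  proof (rule sum_mono)
    fix a assume a: "a \<in> S"
    show "card T - 1 \<le> card {b \<in> T. \<not> E a b}"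
      using card_filter_split[OF fin(2), of "E a"] one[OF a] by linarith
  qed
  also have "\<dots> = card (SIGMA a:S. {b \<in> T. \<not> E a b})" using fin by (simp add: card_SigmaI)
  also have "\<dots> \<le> M" using S by (intro M_ge) auto
  finally show ?thesis .
qed

lemma degree_single_W:
  assumes W: "W = {w}"
  shows "card {u. E w u} = card {a \<in> A. E w a} + card {b \<in> B. E w b}"
proof -
  have wAB: "w \<notin> A" "w \<notin> B" using W W_disjoint by blast+
  have AB: "u \<in> A \<or> u \<in> B" if u: "E w u" for u
  proof -
    have "u \<noteq> w" using u adj_irrefl by metis
    then show ?thesis using adj_cases_single[OF W u] wAB by blast
  qed
  have "{u. E w u} = {a \<in> A. E w a} \<union> {b \<in> B. E w b}"
    unfolding set_eq_iff mem_Collect_eq Un_iff using AB by fast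
  moreover have "{a \<in> A. E w a} \<inter> {b \<in> B. E w b} = {}" using A_B_disjoint by blast
  moreover have "finite {a \<in> A. E w a}" "finite {b \<in> B. E w b}" by simp_all
  ultimately show ?thesis by (simp only: card_Un_disjoint)
qed

text \<open>Missing pairs and imbalance must be paid for by the weight of \<open>w\<close>, at most
  \<open>d / l\<close>; here \<open>0.51 / 0.499^2 < 2.05\<close>. The number \<open>c\<close> is
  the amount by which \<open>l\<^sup>2\<close> may fall short of \<open>P\<close>.\<close>

lemma single_W_bound:
  assumes W: "W = {w}" and P: "real P - c \<le> l\<^sup>2"
  defines "d \<equiv> real (card {u. E w u})"
  shows "real M + (real P - real (card A * card B)) \<le> c + 205 / 100 * (d * d / n)" "d \<le> 262 / 1000 * n"
proof -
  show d: "d \<le> 262 / 1000 * n" using degree_W[of w] W by (simp add: d_def)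
  have d0: "d \<ge> 0" by (simp add: d_def)
  have n0: "n > 0" using n_big by linarith
  have "x w \<le> d / l" using x_W[of w] W by (simp add: d_def)
  also have "\<dots> \<le> d / (499 / 1000 * n)" using l_low n0 d0 by (intro divide_left_mono) auto
  finally have "(x w)\<^sup>2 \<le> (d / (499 / 1000 * n))\<^sup>2" using x_nonneg by (intro power_mono) auto
  have "NW = (x w)\<^sup>2" using W by (simp add: NW_def)
  have NW: "NW \<le> 1000000 / 249001 * (d * d / n / n)"
  proof -
    have "(d / (499 / 1000 * n))\<^sup>2 = 1000000 / 249001 * (d * d / n / n)"
      by (simp add: power2_eq_square)
    then show ?thesis
      using \<open>(x w)\<^sup>2 \<le> (d / (499 / 1000 * n))\<^sup>2\<close> \<open>NW = (x w)\<^sup>2\<close> by linarith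
  qed
  have "51 / 100 * n * NW \<le> 51 / 100 * n * (1000000 / 249001 * (d * d / n / n))"
    using NW n0 by (intro mult_left_mono) auto
  also have "\<dots> = 51000000 / 24900100 * (d * d / n)" using n0 by simp
  also have "\<dots> \<le> 205 / 100 * (d * d / n)" using d0 n0 by (intro mult_right_mono) auto
  finally have "51 / 100 * n * NW \<le> 205 / 100 * (d * d / n)" .
  moreover have "NW \<le> 1 / 1000 * n" using NW_W W n_big by simp
  then have "l\<^sup>2 - 51 / 100 * n * NW \<le> e" by (rule e_lower)
  moreover have "real e + real M = real (card A * card B)" using arg_cong[OF e_M, of real] by simp
  ultimately show "real M + (real P - real (card A * card B)) \<le> c + 205 / 100 * (d * d / n)"
    using P by linarith
qed

lemma small_defect:
  fixes d :: real
  assumes "d \<le> 100" "d \<ge> 0"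
  shows "205 / 100 * (d * d / n) < 1 / 10"
proof -
  have "d * d \<le> 100 * 100" using assms by (intro mult_mono) auto
  then show ?thesis using n_big by (simp add: divide_simps)
qed

text \<open>For bootstrapping: since \<open>2.05 * 0.262 < 0.54\<close>, the payment is a fraction
  of \<open>d\<close>. If every neighbour of \<open>w\<close> beyond a constant number forces a
  missing pair, \<open>d\<close> is bounded by a constant, and then \<open>small_defect\<close>
  makes the payment negligible.\<close>

lemma linear_defect:
  fixes d :: real
  assumes "d \<le> 262 / 1000 * n" "d \<ge> 0"
  shows "205 / 100 * (d * d / n) \<le> 54 / 100 * d"
proof -
  have "d * d \<le> d * (262 / 1000 * n)" using assms by (intro mult_left_mono)
  then have "d * d / n \<le> 262 / 1000 * d" using n_big by (simp add: divide_simps)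
  then show ?thesis using assms by linarith
qed

lemma adj_iff_single_W:
  assumes W: "W = {w}" and Nw: "{u. E w u} = {a0, b0}"
  shows "E u v \<longleftrightarrow> u \<in> A \<and> v \<in> B \<and> E u v \<or> u \<in> B \<and> v \<in> A \<and> E v u \<or>
    u = w \<and> v \<in> {a0, b0} \<or> v = w \<and> u \<in> {a0, b0}"
proof
  assume uv: "E u v"
  then show "u \<in> A \<and> v \<in> B \<and> E u v \<or> u \<in> B \<and> v \<in> A \<and> E v u \<or>
    u = w \<and> v \<in> {a0, b0} \<or> v = w \<and> u \<in> {a0, b0}"
    using adj_cases_single[OF W uv] Nw adj_sym[OF uv] uv by blast
next
  have w: "E w a0" "E w b0" using Nw by blast+
  assume "u \<in> A \<and> v \<in> B \<and> E u v \<or> u \<in> B \<and> v \<in> A \<and> E v u \<or>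
    u = w \<and> v \<in> {a0, b0} \<or> v = w \<and> u \<in> {a0, b0}"
  then show "E u v" using w adj_sym[of v u] adj_sym[OF w(1)] adj_sym[OF w(2)] by auto
qed

text \<open>A neighbour of \<open>w\<close> in one side that is adjacent to two neighbours of
  \<open>w\<close> in the other yields a theta graph. Hence between the neighbours of
  \<open>w\<close> the cross edges form a matching, and each neighbour beyond two forces a missing
  pair.\<close>

lemma bullet_structure:
  assumes nb: nonbip and r': "even r" and l: "real (balanced_product (card V - 1)) \<le> l\<^sup>2"
  obtains w a0 b0 where "W = {w}" "a0 \<in> A" "b0 \<in> B" "card A * card B = balanced_product (card V - 1)"
    "\<And>u v. E u v \<longleftrightarrow> u \<in> A \<and> v \<in> B \<or> u \<in> B \<and> v \<in> A \<or>
       u \<in> {a0, b0, w} \<and> v \<in> {a0, b0, w} \<and> u \<noteq> v"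
proof -
  let ?P = "balanced_product (card V - 1)"
  have cV: "real (card V - 1) = n - 1" using n_big by (subst of_nat_diff) auto
  have "(n - real 1)\<^sup>2 / 4 - 3 \<le> l\<^sup>2" using balanced_product_lower[of "card V - 1"] l cV by simp
  from card_W_le[OF _ this] have "card W \<le> 1" by simp
  then have "card W = 1" using W_nonempty[OF nb] by (simp add: le_Suc_eq)
  then obtain w where W: "W = {w}" by (auto simp: card_1_singleton_iff)
  obtain a0 b0 where ab: "a0 \<in> A" "E w a0" "b0 \<in> B" "E w b0" using W_singleton_nbrs[OF nb W] .
  define S where "S = {a \<in> A. E w a}"
  define T where "T = {b \<in> B. E w b}"
  have fin: "finite S" "finite T" by (simp_all add: S_def T_def)
  have pos: "card S \<ge> 1" "card T \<ge> 1" using ab fin by (auto simp: S_def T_def Suc_le_eq card_gt_0_iff)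
  define d where "d = card {u. E w u}"
  have d: "d = card S + card T" unfolding d_def S_def T_def by (rule degree_single_W[OF W])
  have no: "\<not> (E a b \<and> E a b')" if "a \<in> A" "E w a" "b \<in> B" "E w b" "b' \<in> B" "E w b'" "b \<noteq> b'" for a b b'
    using near.theta_even_branch[OF that(2,4,6,7) rich_A(1)[OF that(1)] rich_B(2)[OF that(3)] rich_B(2)[OF that(5)] _ _ q r' r]
      theta_free that A_B_disjoint by auto
  have no': "\<not> (E b a \<and> E b a')" if "b \<in> B" "E w b" "a \<in> A" "E w a" "a' \<in> A" "E w a'" "a \<noteq> a'" for a b a'
  proof -
    interpret sw: near_complete E Y X h K by (rule near.near_complete_swap)
    show ?thesis
      using sw.theta_even_branch[OF that(2,4,6,7) rich_B(1)[OF that(1)] rich_A(2)[OF that(3)] rich_A(2)[OF that(5)] _ _ q r' r]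
        theta_free that A_B_disjoint by auto
  qed
  have "card S * (card T - 1) \<le> M"
  proof (rule M_ge_almost_independent)
    show "card {b \<in> T. E a b} \<le> 1" if "a \<in> S" for a
      using fin no that by (subst card_le_Suc0_iff_eq[unfolded One_nat_def[symmetric]]) (auto simp: S_def T_def)
  qed (auto simp: S_def T_def)
  moreover have "card T * (card S - 1) \<le> M"
  proof -
    have "card T * (card S - 1) \<le> stable_graph.M V E Y X"
    proof (rule stable_graph.M_ge_almost_independent[OF swap, unfolded swap_A swap_B])
      show "card {a \<in> S. E b a} \<le> 1" if "b \<in> T" for b
        using fin no' that by (subst card_le_Suc0_iff_eq[unfolded One_nat_def[symmetric]]) (auto simp: S_def T_def)
    qed (auto simp: S_def T_def)
    then show ?thesis by (simp only: swap_M)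
  qed
  \<comment> \<open>If \<open>card T = 1\<close>, the second bound says
    \<open>card S - 1 \<le> M\<close>. Otherwise
    \<open>card S * (card T - 1) \<ge> card S + card T - 2\<close> and the first one
    applies.\<close>
  ultimately have dM: "d \<le> M + 2"
  proof -
    assume 1: "card S * (card T - 1) \<le> M" and 2: "card T * (card S - 1) \<le> M"
    show ?thesis
    proof (cases "card T = 1")
      case True
      then show ?thesis using 2 d by simp
    next
      case False
      then have "card S = Suc (card S - 1)" "card T = Suc (Suc (card T - 2))" using pos by linarith+
      then obtain i j where ij: "card S = Suc i" "card T = Suc (Suc j)" by blast
      show ?thesis using 1 d unfolding ij by simp
    qed
  qed
  note bound = single_W_bound[OF W, of ?P 0, folded d_def]
  have AB: "card A + card B = card V - 1" using card_V W by simp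
  have le: "card A * card B \<le> ?P" by (rule balanced_product_ge[OF AB])
  then have leR: "real (card A * card B) \<le> real ?P" by (simp only: of_nat_le_iff)
  have b1: "real M + (real ?P - real (card A * card B)) \<le> 205 / 100 * (real d * d / n)"
    using bound(1) l by simp
  \<comment> \<open>Together with \<open>d \<le> M + 2\<close> this bounds \<open>d\<close> by a
    constant.\<close>
  have "real M \<le> 54 / 100 * d" using b1 leR linear_defect[of d] bound(2) l by simp
  then have "real d \<le> 100" using dM by linarith
  then have "real M + (real ?P - real (card A * card B)) < 1 / 10"
    using b1 small_defect[of d] by simp
  then have "real M < 1" "real ?P < real (card A * card B) + 1" using leR by linarith+
  then have M0: "M = 0" and P: "card A * card B = ?P" using le by linarith+
  have full: "E a b" if "a \<in> A" "b \<in> B" for a b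
    using M_ge[of "{(a, b)}"] that M0 by (cases "E a b") auto
  have "card {u. E w u} \<le> 2" using dM M0 by (simp add: d_def)
  moreover have "a0 \<noteq> b0" using ab A_B_disjoint by blast
  then have "{a0, b0} \<subseteq> {u. E w u}" "card {a0, b0} = 2" using ab by auto
  ultimately have Nw: "{u. E w u} = {a0, b0}" by (metis card_seteq finite_nbrs(1))
  have wAB: "w \<notin> A" "w \<notin> B" using W W_disjoint by auto
  show ?thesis
  proof (rule that[OF W ab(1,3) P])
    show "E u v \<longleftrightarrow> u \<in> A \<and> v \<in> B \<or> u \<in> B \<and> v \<in> A \<or>
       u \<in> {a0, b0, w} \<and> v \<in> {a0, b0, w} \<and> u \<noteq> v" for u v
      using adj_iff_single_W[OF W Nw, of u v] full ab(1,3) wAB A_B_disjoint by blast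
  qed
qed

text \<open>With at most two missing pairs, \<open>a\<close> is adjacent to almost all of
  \<open>B\<close>, and its neighbours lose at most the total defect \<open>0.004 * n\<close>. So
  \<open>l * x a\<close> is at least \<open>0.494 * n - 2\<close>, to be compared with
  \<open>l \<le> 0.502 * n\<close>.\<close>

lemma x_A_lower:
  assumes "a \<in> A" "M \<le> 2"
  shows "98 / 100 \<le> x a"
proof -
  have "card {b \<in> B. \<not> E a b} \<le> M"
  proof -
    have "card (Pair a ` {b \<in> B. \<not> E a b}) \<le> M" using assms(1) by (intro M_ge) auto
    then show ?thesis by (simp add: card_image inj_on_def)
  qed
  then have "real (card {b \<in> B. E a b}) \<ge> 498 / 1000 * n - 2"
    using card_filter_split[of B "E a"] card_A_B assms(2) by simp
  moreover have "card {b \<in> B. E a b} \<le> card {u. E a u}" by (intro card_mono) auto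
  ultimately have deg: "498 / 1000 * n - 2 \<le> card {u. E a u}" by linarith
  have "(\<Sum>u | E a u. 1 - x u) \<le> (\<Sum>v\<in>V. 1 - x v)"
    using finV x_le_1 adj_V by (intro sum_mono2) auto
  moreover have "(\<Sum>u | E a u. 1 - x u) = card {u. E a u} - l * x a"
    using eigen[of a] assms(1) AV by (auto simp: sum_subtractf)
  ultimately have "494 / 1000 * n - 2 \<le> l * x a" using deg defect by linarith
  also have "\<dots> \<le> 502 / 1000 * n * x a" using l_up x_nonneg by (intro mult_right_mono)
  also have "\<dots> = 502 / 1000 * (x a * n)" by simp
  finally have "98 / 100 * n \<le> x a * n" using n_big by linarith
  then show ?thesis by (rule mult_right_le_imp_le) (use n_big in simp)
qed

lemma x_B_lower:
  assumes "b \<in> B" "M \<le> 2"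
  shows "98 / 100 \<le> x b"
  using stable_graph.x_A_lower[OF swap, unfolded swap_A swap_M] assms .

text \<open>The missing pairs are subtracted from the full product of the two weight sums, and each
  has weight at least \<open>0.98^2 > 0.96\<close>. A missing pair thus costs \<open>1.92\<close>,
  whereas \<open>sqrt e\<close> in \<open>cross_le\<close> charges only about
  \<open>N / (2 * sqrt (card A * card B))\<close>, which is close to \<open>1\<close>.\<close>

lemma cross_missing:
  assumes "M \<le> 2"
  shows "2 * cross \<le> sqrt (card A * card B) * (N - NW) - 192 / 100 * M"
proof -
  define p where "p = (\<Sum>v\<in>A. (x v)\<^sup>2)"
  define s where "s = (\<Sum>v\<in>B. (x v)\<^sup>2)"
  let ?S = "{(a, b) \<in> A \<times> B. E a b}" and ?T = "{(a, b) \<in> A \<times> B. \<not> E a b}"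
  have ps: "p \<ge> 0" "s \<ge> 0" by (simp_all add: p_def s_def sum_nonneg)
  have fT: "finite ?S" "finite ?T" by (rule finite_subset[of _ "A \<times> B"], auto)+
  have "(\<Sum>i\<in>?T. 96 / 100) \<le> (\<Sum>(a, b)\<in>?T. x a * x b)"
  proof (rule sum_mono, clarify)
    fix a b assume "a \<in> A" "b \<in> B"
    then have "98 / 100 * (98 / 100) \<le> x a * x b"
      using x_A_lower x_B_lower assms x_nonneg by (intro mult_mono) auto
    then show "96 / 100 \<le> x a * x b" by simp
  qed
  then have T: "96 / 100 * M \<le> (\<Sum>(a, b)\<in>?T. x a * x b)" by (simp add: M_def)
  have "(\<Sum>(a, b)\<in>A \<times> B. x a * x b) = (\<Sum>(a, b)\<in>?S \<union> ?T. x a * x b)"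
    by (rule sum.cong) auto
  also have "\<dots> = cross + (\<Sum>(a, b)\<in>?T. x a * x b)"
    unfolding cross_def using fT by (intro sum.union_disjoint) auto
  finally have c: "cross = (\<Sum>a\<in>A. x a) * (\<Sum>b\<in>B. x b) - (\<Sum>(a, b)\<in>?T. x a * x b)"
    by (simp add: sum_product sum.cartesian_product)
  have SA: "(\<Sum>a\<in>A. x a)\<^sup>2 \<le> card A * p"
    using Cauchy_Schwarz_ineq_sum[of "\<lambda>_. 1" x A] by (simp add: p_def)
  have SB: "(\<Sum>b\<in>B. x b)\<^sup>2 \<le> card B * s"
    using Cauchy_Schwarz_ineq_sum[of "\<lambda>_. 1" x B] by (simp add: s_def)
  have "((\<Sum>a\<in>A. x a) * (\<Sum>b\<in>B. x b))\<^sup>2 \<le> (card A * p) * (card B * s)"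
    unfolding power_mult_distrib using SA SB ps by (intro mult_mono) auto
  then have "(\<Sum>a\<in>A. x a) * (\<Sum>b\<in>B. x b) \<le> sqrt ((card A * p) * (card B * s))" by (rule real_le_rsqrt)
  also have "\<dots> = sqrt (card A * card B) * sqrt (p * s)" by (simp add: real_sqrt_mult mult_ac)
  also have "\<dots> \<le> sqrt (card A * card B) * ((p + s) / 2)"
    using arith_geo_mean_sqrt[OF ps] by (intro mult_left_mono) auto
  also have "p + s = N - NW" using N_split by (simp add: p_def s_def)
  finally have "2 * ((\<Sum>a\<in>A. x a) * (\<Sum>b\<in>B. x b)) \<le> sqrt (card A * card B) * (N - NW)" by simp
  then show ?thesis using c T by linarith
qed

end

section \<open>Structure of the candidates for odd \<open>r\<close>\<close>

context stable_graph
begin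

text \<open>The candidate concedes \<open>1 / p\<close> in \<open>l\<close>, hence a budget of
  \<open>N / p\<close>, close to \<open>2\<close>. It pays for one missing pair at price
  \<open>1.92\<close>, but not for two; and the neighbours of \<open>w\<close> always force
  one.\<close>

lemma SK_structure:
  assumes nb: nonbip and q2: "q = 2" and r': "odd r"
    and l: "sqrt (balanced_product (card V - 1)) - 1 / sqrt (balanced_product (card V - 1)) \<le> l"
  obtains w a0 b0 where "W = {w}" "a0 \<in> A" "b0 \<in> B" "card A * card B = balanced_product (card V - 1)"
    "\<And>u v. E u v \<longleftrightarrow> (u \<in> A \<and> v \<in> B \<or> u \<in> B \<and> v \<in> A) \<and> {u, v} \<noteq> {a0, b0} \<or>
       u = w \<and> v \<in> {a0, b0} \<or> v = w \<and> u \<in> {a0, b0}"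
proof -
  let ?P = "balanced_product (card V - 1)"
  define p where "p = sqrt ?P"
  have cV: "real (card V - 1) = n - 1" using n_big by (subst of_nat_diff) auto
  have Pn: "(498 / 1000 * n)\<^sup>2 \<le> real ?P"
  proof -
    have "4 * (498 / 1000 * n)\<^sup>2 \<le> (n - 1)\<^sup>2 - 1"
    proof -
      have "4 * (498 / 1000 * n)\<^sup>2 = 992016 / 1000000 * (n * n)" "(n - 1)\<^sup>2 = n * n - 2 * n + 1"
        by (simp_all add: power2_eq_square algebra_simps)
      moreover have "1000000000 * n \<le> n * n" using n_big by (intro mult_right_mono) auto
      ultimately show ?thesis using n_big by linarith
    qed
    then show ?thesis using balanced_product_lower[of "card V - 1"] cV by simp
  qed
  have p: "498 / 1000 * n \<le> p" unfolding p_def by (rule real_le_rsqrt[OF Pn])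
  then have p1: "p \<ge> 1" using n_big by linarith
  have pp: "p * p = real ?P" by (simp add: p_def)
  have lp: "p - 1 / p \<le> l" using l by (simp add: p_def)
  have l2: "real ?P - 2 \<le> l\<^sup>2" using sub_inverse_square_le[OF p1 lp] pp by simp
  have "(n - real 1)\<^sup>2 / 4 - 3 \<le> l\<^sup>2" using balanced_product_lower[of "card V - 1"] l2 cV by simp
  from card_W_le[OF _ this] have "card W \<le> 1" by simp
  then have "card W = 1" using W_nonempty[OF nb] by (simp add: le_Suc_eq)
  then obtain w where W: "W = {w}" by (auto simp: card_1_singleton_iff)
  obtain a0 b0 where ab: "a0 \<in> A" "E w a0" "b0 \<in> B" "E w b0" using W_singleton_nbrs[OF nb W] .
  define S where "S = {a \<in> A. E w a}"
  define T where "T = {b \<in> B. E w b}"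
  have fin: "finite S" "finite T" by (simp_all add: S_def T_def)
  have pos: "card S \<ge> 1" "card T \<ge> 1" using ab fin by (auto simp: S_def T_def Suc_le_eq card_gt_0_iff)
  define d where "d = card {u. E w u}"
  have d: "d = card S + card T" unfolding d_def S_def T_def by (rule degree_single_W[OF W])
  have no: "\<not> E a b" if "a \<in> A" "E w a" "b \<in> B" "E w b" for a b
    using near.theta_triangle[OF that(2,4) _ rich_A(1)[OF that(1)] rich_B(2)[OF that(3)] r' r]
      theta_free adj_sym[of a b] q2 by auto
  \<comment> \<open>A cross edge between neighbours of \<open>w\<close> would close a triangle, so
    all pairs in \<open>S \<times> T\<close> are missing.\<close>
  have "card (S \<times> T) \<le> M" using no by (intro M_ge) (auto simp: S_def T_def)
  then have STM: "card S * card T \<le> M" by (simp add: card_cartesian_product)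
  have "card S + card T \<le> card S * card T + 1"
  proof -
    have "card S = Suc (card S - 1)" "card T = Suc (card T - 1)" using pos by linarith+
    then obtain i j where ij: "card S = Suc i" "card T = Suc j" by blast
    show ?thesis unfolding ij by simp
  qed
  then have dM: "d \<le> M + 1" using d STM by linarith
  have AB: "card A + card B = card V - 1" using card_V W by simp
  have le: "card A * card B \<le> ?P" by (rule balanced_product_ge[OF AB])
  then have leR: "real (card A * card B) \<le> real ?P" by (simp only: of_nat_le_iff)
  note bound = single_W_bound[OF W l2, folded d_def]
  have "real M \<le> 2 + 54 / 100 * d" using bound(1) leR linear_defect[of d] bound(2) by linarith
  then have d100: "real d \<le> 100" using dM by linarith
  then have "real M + (real ?P - real (card A * card B)) < 3"
    using bound(1) small_defect[of d] by linarith
  then have M2: "M \<le> 2" using leR by linarith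
  define c where "c = sqrt (card A * card B)"
  have "l * N \<le> c * (N - NW) - 192 / 100 * M + 2 * (l * NW)"
    using rayleigh_cross cross_missing[OF M2] by (simp add: c_def)
  moreover have "0 \<le> c * NW" using NW_nonneg by (simp add: c_def)
  ultimately have key: "(l - c) * N \<le> - 192 / 100 * M + 2 * (l * NW)" by (simp add: algebra_simps)
  \<comment> \<open>As \<open>l * x w\<close> is at most the degree of \<open>w\<close>,
    \<open>l\<^sup>2 * NW\<close> is bounded by a constant, and \<open>l\<close> is huge.\<close>
  have "l * NW \<le> 1 / 1000"
  proof -
    have lx: "l * x w \<le> 100" using x_le_degree[of w] W WV d100 by (auto simp: d_def)
    have "NW = x w * x w" using W by (simp add: NW_def power2_eq_square)
    then have "l * (l * NW) = (l * x w) * (l * x w)" by simp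
    also have "\<dots> \<le> 100 * 100" using lx l_nonneg x_nonneg by (intro mult_mono) auto
    also have "\<dots> \<le> l * (1 / 1000)" using l_low n_big by simp
    finally show ?thesis using l_pos by (simp only: mult_le_cancel_left_pos)
  qed
  then have key': "(l - c) * N \<le> - 192 / 100 * M + 2 / 1000" using key by linarith
  define g where "g = N / p"
  \<comment> \<open>\<open>N \<le> n\<close> and \<open>p \<ge> 0.498 * n\<close>.\<close>
  have Np: "g \<le> 2009 / 1000"
  proof -
    have "N \<le> 2009 / 1000 * p" using N_bounds(2) p n_big by linarith
    then show ?thesis using p1 by (simp add: g_def divide_le_eq)
  qed
  have M1: "M \<ge> 1" using STM pos by (metis le_trans mult_le_mono nat_mult_1)
  then have M1r: "1 \<le> real M" by simp
  have N0: "N \<ge> 0" using N_bounds(1) n_big by linarith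
  \<comment> \<open>An unbalanced product costs at least \<open>1\<close> in
    \<open>c\<^sup>2\<close>, so \<open>c \<le> p - 1 / (2 * p)\<close>. This halves the budget to
    about \<open>1\<close>, too little for a single missing pair.\<close>
  have full: "card A * card B = ?P"
  proof (rule ccontr)
    assume "\<not> ?thesis"
    then have "card A * card B \<le> ?P - 1" "?P \<ge> 1" using le by linarith+
    then have "card A * card B + 1 \<le> ?P" by linarith
    then have "real (card A * card B + 1) \<le> real ?P" by (simp only: of_nat_le_iff)
    then have "c * c + 1 \<le> p * p" using pp by (simp add: c_def)
    moreover have "(p - 1 / (2 * p)) * (p - 1 / (2 * p)) = p * p - 1 + 1 / (2 * p) * (1 / (2 * p))"
      using p1 by (simp add: algebra_simps)
    moreover have "0 \<le> 1 / (2 * p) * (1 / (2 * p))" by simp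
    ultimately have "c * c \<le> (p - 1 / (2 * p)) * (p - 1 / (2 * p))" by linarith
    moreover have "1 / (2 * p) \<le> 1" using p1 by simp
    then have "0 \<le> p - 1 / (2 * p)" using p1 by linarith
    ultimately have "c \<le> p - 1 / (2 * p)"
      using power2_le_imp_le[of c "p - 1 / (2 * p)"] by (simp add: power2_eq_square)
    moreover have "1 / p = 2 * (1 / (2 * p))" using p1 by simp
    ultimately have "- (1 / (2 * p)) \<le> l - c" using lp by linarith
    then have "- (1 / (2 * p)) * N \<le> (l - c) * N" using N0 by (rule mult_right_mono)
    moreover have "- (1 / (2 * p)) * N = - g / 2" by (simp add: g_def)
    ultimately have "- g / 2 \<le> (l - c) * N" by metis
    then show False using key' Np M1r by linarith
  qed
  have "c = p" using arg_cong[OF full, of real] by (simp add: c_def p_def)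
  then have "- (1 / p) \<le> l - c" using lp by simp
  then have "- (1 / p) * N \<le> (l - c) * N" using N0 by (rule mult_right_mono)
  moreover have "- (1 / p) * N = - g" by (simp add: g_def)
  ultimately have "- g \<le> (l - c) * N" by metis
  then have "- g \<le> - 192 / 100 * M + 2 / 1000" using key' by linarith
  then have Meq: "M = 1" using Np M1 by linarith
  then have "card S = 1" "card T = 1" using STM pos by (auto simp: le_Suc_eq)
  then have "d = 2" using d by simp
  moreover have "a0 \<noteq> b0" using ab A_B_disjoint by blast
  then have "{a0, b0} \<subseteq> {u. E w u}" "card {a0, b0} = 2" using ab by auto
  ultimately have Nw: "{u. E w u} = {a0, b0}" unfolding d_def by (metis card_subset_eq finite_nbrs(1))
  have miss: "E a b \<longleftrightarrow> \<not> (a = a0 \<and> b = b0)" if "a \<in> A" "b \<in> B" for a b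
  proof
    show "\<not> (a = a0 \<and> b = b0)" if "E a b" using that no[OF ab] by blast
    show "E a b" if ne: "\<not> (a = a0 \<and> b = b0)"
    proof (rule ccontr)
      assume "\<not> E a b"
      then have "card {(a, b), (a0, b0)} \<le> M" using no[OF ab] ab \<open>a \<in> A\<close> \<open>b \<in> B\<close> by (intro M_ge) auto
      moreover have "card {(a, b), (a0, b0)} = 2" using ne by (subst card_2_iff) blast
      ultimately show False using Meq by simp
    qed
  qed
  have wAB: "w \<notin> A" "w \<notin> B" using W W_disjoint by blast+
  show ?thesis
  proof (rule that[OF W ab(1,3) full])
    fix u v
    have 1: "{u, v} \<noteq> {a0, b0} \<longleftrightarrow> \<not> (u = a0 \<and> v = b0)" if "u \<in> A" "v \<in> B"
      using that ab(1,3) A_B_disjoint by (auto simp: doubleton_eq_iff)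
    have 2: "{u, v} \<noteq> {a0, b0} \<longleftrightarrow> \<not> (v = a0 \<and> u = b0)" if "u \<in> B" "v \<in> A"
      using that ab(1,3) A_B_disjoint by (auto simp: doubleton_eq_iff)
    show "E u v \<longleftrightarrow> (u \<in> A \<and> v \<in> B \<or> u \<in> B \<and> v \<in> A) \<and> {u, v} \<noteq> {a0, b0} \<or>
       u = w \<and> v \<in> {a0, b0} \<or> v = w \<and> u \<in> {a0, b0}"
      using adj_iff_single_W[OF W Nw, of u v] miss[of u v] miss[of v u] 1 2 by argo
  qed
qed

lemma two_sided_W:
  assumes q4: "q \<ge> 4" and r': "odd r" and "E w a" "a \<in> A" "E w b" "b \<in> B"
  shows False
proof -
  have "a \<noteq> b" using assms A_B_disjoint by blast
  then show False
    using near.theta_long_bridge[OF assms(3,5) _ rich_A(1)[OF assms(4)] rich_B(2)[OF assms(6)] q(1) q4 r' r]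
      theta_free by auto
qed

text \<open>Distinct attachments \<open>y\<close> and \<open>y'\<close> of \<open>w\<close> and
  \<open>w'\<close> would give the theta graph of \<open>theta_handle\<close>, and neighbours in
  \<open>B\<close> are excluded by \<open>two_sided_W\<close>. So both vertices have one and the
  same further neighbour.\<close>

lemma handle_structure:
  assumes q4: "q \<ge> 4" and r': "odd r" and W: "W = {w, w'}" "w \<noteq> w'"
    and e: "E w w'" and a: "E w a" "a \<in> A" "E w' a'" "a' \<in> A"
  shows "{u. E w u} = {w', a} \<and> {u. E w' u} = {w, a}"
proof -
  have same: "y = y'" if "E w y" "y \<in> A" "E w' y'" "y' \<in> A" for y y'
  proof (rule ccontr)
    assume "y \<noteq> y'"
    moreover have "w \<noteq> y'" "w' \<noteq> y" using that W W_disjoint by auto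
    ultimately have "has_theta E q r"
      using near.theta_handle[OF that(1) e that(3) _ _ _ common_A[OF that(2,4)] q(1) q4 r' r] by auto
    then show False using theta_free by blast
  qed
  have nb: "u \<in> A" if "E z u" "z \<in> {w, w'}" "u \<notin> {w, w'}" for z u
  proof -
    have "u \<notin> B" using two_sided_W[OF q4 r', of z _ u] that a by blast
    then show ?thesis using adj_V[OF that(1)] V_eq W that(3) by blast
  qed
  have ww: "E w' w" using e by (rule adj_sym)
  have aa: "a' = a" using same a by blast
  have "u \<in> {w', a}" if u: "E w u" for u
  proof (cases "u = w'")
    case False
    moreover have "u \<noteq> w" using u adj_irrefl by blast
    ultimately have "u \<in> A" using nb[of w u] u by blast
    then show ?thesis using same[OF u _ a(3,4)] aa by blast
  qed simp
  moreover have "u \<in> {w, a}" if u: "E w' u" for u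
  proof (cases "u = w")
    case False
    moreover have "u \<noteq> w'" using u adj_irrefl by blast
    ultimately have "u \<in> A" using nb[of w' u] u by blast
    then show ?thesis using same[OF a(1,2) u] by blast
  qed simp
  ultimately show ?thesis using a e ww aa by blast
qed


text \<open>Neither vertex has neighbours on both sides, so each can be coloured against its
  neighbours in \<open>A \<union> B\<close>. Such a colouring fails only if \<open>w\<close> and
  \<open>w'\<close> are adjacent and attached to the same side.\<close>

lemma W_pair_common_side:
  assumes nb: nonbip and q4: "q \<ge> 4" and r': "odd r" and W: "W = {w, w'}" "w \<noteq> w'"
  shows "E w w'"
    "(\<exists>a\<in>A. E w a) \<and> (\<exists>a\<in>A. E w' a) \<or> (\<exists>b\<in>B. E w b) \<and> (\<exists>b\<in>B. E w' b)"
proof -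
  note two = two_sided_W[OF q4 r']
  have wAB: "w \<notin> A" "w \<notin> B" "w' \<notin> A" "w' \<notin> B" using W W_disjoint by blast+
  have in3: "v \<in> A \<or> v \<in> B \<or> v = w \<or> v = w'" if "v \<in> V" for v using that V_eq W by blast
  \<comment> \<open>\<open>D\<close> consists of the vertices of \<open>W\<close> that receive the
    colour of \<open>A\<close>.\<close>
  have bad: False if U: "U = A \<union> D" "D \<subseteq> {w, w'}"
    and D: "\<And>z. z \<in> D \<Longrightarrow> \<not> (\<exists>a\<in>A. E z a)" "\<And>z. z \<in> {w, w'} \<Longrightarrow> z \<notin> D \<Longrightarrow> \<not> (\<exists>b\<in>B. E z b)"
    and ww: "E w w' \<Longrightarrow> w \<in> D \<longleftrightarrow> w' \<notin> D" for U D
  proof -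
    obtain u v where uv: "E u v" "u \<in> U \<longleftrightarrow> v \<in> U" using nb unfolding nonbip_def by blast
    have vu: "E v u" using uv(1) by (rule adj_sym)
    have uvV: "u \<in> V" "v \<in> V" using adj_ends[OF uv(1)] by blast+
    have UA: "z \<in> U" if "z \<in> A" for z using that U by blast
    have UB: "z \<notin> U" if "z \<in> B" for z using that U A_B_disjoint wAB by blast
    have UW: "z \<in> U \<longleftrightarrow> z \<in> D" if "z \<in> {w, w'}" for z using that U wAB by blast
    consider "u \<in> A" "v \<in> A" | "u \<in> B" "v \<in> B" | "u \<in> A" "v \<in> B" | "u \<in> B" "v \<in> A"
      | "u \<in> {w, w'}" "v \<in> A" | "u \<in> {w, w'}" "v \<in> B" | "v \<in> {w, w'}" "u \<in> A" | "v \<in> {w, w'}" "u \<in> B"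
      | "u \<in> {w, w'}" "v \<in> {w, w'}"
      using in3[OF uvV(1)] in3[OF uvV(2)] by blast
    then show False
    proof cases
      case 1 then show ?thesis using A_independent uv(1) by blast
    next
      case 2 then show ?thesis using B_independent uv(1) by blast
    next
      case 3 then show ?thesis using UA UB uv(2) by blast
    next
      case 4 then show ?thesis using UA UB uv(2) by blast
    next
      case 5 then show ?thesis using UA UW uv D(1)[of u] by blast
    next
      case 6 then show ?thesis using UB UW uv D(2)[of u] by blast
    next
      case 7 then show ?thesis using UA UW uv(2) vu D(1)[of v] by blast
    next
      case 8 then show ?thesis using UB UW uv(2) vu D(2)[of v] by blast
    next
      case 9
      have "u \<noteq> v" using uv(1) adj_irrefl by blast
      then have "u = w \<and> v = w' \<or> u = w' \<and> v = w" using 9 by blast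
      then have "E w w'" using uv(1) vu by blast
      then show ?thesis using ww UW uv(2) 9 \<open>u = w \<and> v = w' \<or> u = w' \<and> v = w\<close> by blast
    qed
  qed
  show e: "E w w'"
  proof (rule ccontr)
    assume no: "\<not> E w w'"
    show False
      by (rule bad[of _ "{z \<in> {w, w'}. \<not> (\<exists>a\<in>A. E z a)}", OF refl]) (use no two in blast)+
  qed
  show "(\<exists>a\<in>A. E w a) \<and> (\<exists>a\<in>A. E w' a) \<or> (\<exists>b\<in>B. E w b) \<and> (\<exists>b\<in>B. E w' b)"
  proof (rule ccontr)
    assume no: "\<not> ?thesis"
    show False
    proof (cases "(\<exists>a\<in>A. E w a) \<or> (\<exists>b\<in>B. E w' b)")
      case True
      show False by (rule bad[of _ "{w'}", OF refl]) (use no True two W(2) in blast)+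
    next
      case False
      show False by (rule bad[of _ "{w}", OF refl]) (use no False two W(2) in blast)+
    qed
  qed
qed

text \<open>A single exceptional vertex would see both sides, so there are two, each of degree two.
  Their weights are at most \<open>2 / l\<close>, and deleting them costs less than one edge; hence
  the cross edges are complete and balanced.\<close>

lemma circ_structure:
  assumes nb: nonbip and q4: "q \<ge> 4" and r': "odd r"
    and l: "real (balanced_product (card V - 2)) \<le> l\<^sup>2"
  obtains w w' u where "W = {w, w'}" "w \<noteq> w'" "u \<in> A \<or> u \<in> B"
    "card A + card B = card V - 2" "card A * card B = balanced_product (card V - 2)"
    "\<And>y z. E y z \<longleftrightarrow> y \<in> A \<and> z \<in> B \<or> y \<in> B \<and> z \<in> A \<or>
       y \<in> {u, w, w'} \<and> z \<in> {u, w, w'} \<and> y \<noteq> z"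
proof -
  let ?P = "balanced_product (card V - 2)"
  have cV: "real (card V - 2) = n - 2" using n_big by (subst of_nat_diff) auto
  have P: "((n - 2)\<^sup>2 - 1) / 4 \<le> real ?P" using balanced_product_lower[of "card V - 2"] cV by simp
  then have "(n - real 2)\<^sup>2 / 4 - 3 \<le> l\<^sup>2" using l by simp
  from card_W_le[OF _ this] have "card W \<le> 2" by simp
  moreover have "card W \<noteq> 0" using W_nonempty[OF nb] by simp
  moreover have "card W \<noteq> 1"
  proof
    assume "card W = 1"
    then obtain w where W: "W = {w}" by (auto simp: card_1_singleton_iff)
    obtain a b where "a \<in> A" "E w a" "b \<in> B" "E w b" using W_singleton_nbrs[OF nb W] .
    then show False using two_sided_W[OF q4 r'] by blast
  qed
  ultimately have "card W = 2" by linarith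
  then obtain w w' where W: "W = {w, w'}" "w \<noteq> w'" by (auto simp: card_2_iff)
  have e: "E w w'" by (rule W_pair_common_side(1)[OF nb q4 r' W])
  obtain u where u: "u \<in> A \<or> u \<in> B" "{v. E w v} = {w', u}" "{v. E w' v} = {w, u}"
  proof (cases "(\<exists>a\<in>A. E w a) \<and> (\<exists>a\<in>A. E w' a)")
    case True
    then obtain a a' where a: "a \<in> A" "E w a" "a' \<in> A" "E w' a'" by blast
    have hs: "{u. E w u} = {w', a} \<and> {u. E w' u} = {w, a}"
      by (rule handle_structure[OF q4 r' W e a(2,1,4,3)])
    show ?thesis by (rule that[OF disjI1[OF a(1)] conjunct1[OF hs] conjunct2[OF hs]])
  next
    case False
    then obtain b b' where b: "b \<in> B" "E w b" "b' \<in> B" "E w' b'"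
      using W_pair_common_side(2)[OF nb q4 r' W] by blast
    have hs: "{u. E w u} = {w', b} \<and> {u. E w' u} = {w, b}"
      by (rule stable_graph.handle_structure[OF swap q4 r' _ W(2) e, unfolded swap_W swap_A, OF W(1) b(2,1,4,3)])
    show ?thesis by (rule that[OF disjI2[OF b(1)] conjunct1[OF hs] conjunct2[OF hs]])
  qed
  have wAB: "w \<notin> A" "w \<notin> B" "w' \<notin> A" "w' \<notin> B" using W W_disjoint by blast+
  have "u \<noteq> w" "u \<noteq> w'" using u(1) wAB by blast+
  have "l * x w \<le> 2" "l * x w' \<le> 2"
  proof -
    have "card {v. E w v} \<le> 2" "card {v. E w' v} \<le> 2" unfolding u(2,3) by (simp_all add: card_insert_if)
    then show "l * x w \<le> 2" "l * x w' \<le> 2"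
      using x_le_degree[of w] x_le_degree[of w'] W WV by auto
  qed
  then have "(l * x w) * (l * x w) \<le> 2 * 2" "(l * x w') * (l * x w') \<le> 2 * 2"
    using l_nonneg x_nonneg by (intro mult_mono; simp)+
  moreover have "NW = x w * x w + x w' * x w'" using W by (simp add: NW_def power2_eq_square)
  ultimately have "l * l * NW \<le> 8" by (simp add: algebra_simps)
  have ln: "2 / 10 * n * n \<le> l * l"
  proof -
    have "(499 / 1000 * n) * (499 / 1000 * n) \<le> l * l" using l_low n_big l_nonneg by (intro mult_mono) auto
    moreover have "(499 / 1000 * n) * (499 / 1000 * n) = 249001 / 1000000 * (n * n)" by simp
    moreover have "0 \<le> n * n" by simp
    ultimately show ?thesis by linarith
  qed
  have "2 / 10 * n * n * NW \<le> 8"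
    using mult_right_mono[OF ln NW_nonneg] \<open>l * l * NW \<le> 8\<close> by linarith
  then have nNW: "n * (n * NW) \<le> 40" by (simp add: mult.assoc)
  have "n * (n * NW) \<le> n * (1 / 10)" using nNW n_big by linarith
  then have small: "n * NW \<le> 1 / 10" by (rule mult_left_le_imp_le) (use n_big in simp)
  have "NW \<le> 1 / 1000 * n" using NW_W W n_big card_W by simp
  from e_lower[OF this] have el: "real ?P - 51 / 1000 \<le> real e" using l small by (simp add: mult.assoc)
  have AB: "card A + card B = card V - 2" using card_V \<open>card W = 2\<close> by simp
  have le: "card A * card B \<le> ?P" by (rule balanced_product_ge[OF AB])
  have "real ?P < real (e + 1)" using el by simp
  then have "?P < e + 1" by (simp only: of_nat_less_iff)
  then have M0: "M = 0" "card A * card B = ?P" using e_M le by linarith+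
  have full: "E a b" if "a \<in> A" "b \<in> B" for a b
    using M_ge[of "{(a, b)}"] that M0 by (cases "E a b") auto
  have full': "E b a" if "a \<in> A" "b \<in> B" for a b using full[OF that] by (rule adj_sym)
  have Ew: "E w v \<longleftrightarrow> v = w' \<or> v = u" "E w' v \<longleftrightarrow> v = w \<or> v = u" for v
    using u(2,3) by blast+
  have sym: "E v z \<longleftrightarrow> E z v" for v z by (rule iffI; rule adj_sym)
  show ?thesis
  proof (rule that[OF W u(1) AB M0(2)])
    fix y z
    show "E y z \<longleftrightarrow> y \<in> A \<and> z \<in> B \<or> y \<in> B \<and> z \<in> A \<or>
       y \<in> {u, w, w'} \<and> z \<in> {u, w, w'} \<and> y \<noteq> z"
    proof (cases "y \<in> W \<or> z \<in> W")
      case True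
      then consider "y = w" | "y = w'" | "z = w" | "z = w'" using W by blast
      then show ?thesis
      proof cases
        case 1
        then show ?thesis using Ew(1)[of z] wAB \<open>u \<noteq> w\<close> W(2) by blast
      next
        case 2
        then show ?thesis using Ew(2)[of z] wAB \<open>u \<noteq> w'\<close> W(2) by blast
      next
        case 3
        then show ?thesis using Ew(1)[of y] sym[of y z] wAB \<open>u \<noteq> w\<close> W(2) by blast
      next
        case 4
        then show ?thesis using Ew(2)[of y] sym[of y z] wAB \<open>u \<noteq> w'\<close> W(2) by blast
      qed
    next
      case False
      have "E y z \<longleftrightarrow> y \<in> A \<and> z \<in> B \<or> y \<in> B \<and> z \<in> A"
      proof
        assume yz: "E y z"
        have "y \<in> A \<or> y \<in> B" "z \<in> A \<or> z \<in> B" using adj_ends[OF yz] V_eq False by blast+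
        then show "y \<in> A \<and> z \<in> B \<or> y \<in> B \<and> z \<in> A"
          using A_independent[of y z] B_independent[of y z] yz by blast
      next
        assume "y \<in> A \<and> z \<in> B \<or> y \<in> B \<and> z \<in> A"
        then show "E y z" using full full' by blast
      qed
      moreover have "\<not> (y \<in> {u, w, w'} \<and> z \<in> {u, w, w'} \<and> y \<noteq> z)" using False W by blast
      ultimately show ?thesis by blast
    qed
  qed
qed

end

section \<open>The three cases\<close>

lemma stable_graphI:
  fixes G :: "'a::linorder pair_pre_digraph"
  assumes G: "pair_graph G" "\<not> bipartite G" "free_of (theta_graph [1, q, r]) G"
    and hq: "even q" "q \<ge> 2" and hr: "r \<ge> 2"
    and big: "100000000 * (real (q + r) + 10) \<le> card (pverts G)"
    and l: "(real (card (pverts G)))\<^sup>2 / 4 - 2 * real (card (pverts G)) \<le> (graph_spectral_radius G)\<^sup>2"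
  obtains x X Y where
    "stable_graph (pverts G) (\<lambda>u v. (u, v) \<in> parcs G) (graph_spectral_radius G) x X Y q r"
    "stable_graph.nonbip (\<lambda>u v. (u, v) \<in> parcs G)"
proof -
  interpret G: pair_graph G by fact
  let ?V = "pverts G" and ?E = "\<lambda>u v. (u, v) \<in> parcs G" and ?l = "graph_spectral_radius G"
  have ne: "?V \<noteq> {}" using big by auto
  obtain y :: "'a \<Rightarrow> real" where y: "\<And>v. y v \<ge> 0" "(\<Sum>v\<in>?V. (y v)\<^sup>2) = 1"
    "\<And>v. v \<in> ?V \<Longrightarrow> (\<Sum>u | (v, u) \<in> parcs G. y u) = ?l * y v"
    using graph_spectral_radius_perron[OF G(1) ne] by metis
  define m where "m = Max (y ` ?V)"
  have fin: "finite (y ` ?V)" "y ` ?V \<noteq> {}" using ne G.pair_finite_verts by auto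
  have ym: "y v \<le> m" if "v \<in> ?V" for v unfolding m_def using that fin by (intro Max_ge) auto
  have "m \<in> y ` ?V" unfolding m_def using fin by (rule Max_in)
  then obtain v0 where v0: "v0 \<in> ?V" "y v0 = m" by blast
  have m: "m > 0"
  proof (rule ccontr)
    assume "\<not> m > 0"
    then have "y v = 0" if "v \<in> ?V" for v using ym[OF that] y(1)[of v] by simp
    then show False using y(2) by simp
  qed
  have perron: "perron_graph ?V ?E ?l (\<lambda>v. y v / m)"
  proof
    show "finite ?V" by (rule G.pair_finite_verts)
    show "v \<in> ?V" if "?E u v" for u v using G.wellformed'[OF that] by blast
    show "?E v u" if "?E u v" for u v using that G.arcs_symmetric by blast
    show "\<not> ?E v v" for v using G.pair_no_loops[of "(v, v)"] by auto
    show "0 \<le> y v / m" for v using y(1) m by simp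
    show "y v / m \<le> 1" if "v \<in> ?V" for v using ym[OF that] m by simp
    show "\<exists>v\<in>?V. y v / m = 1" using v0 m by (intro bexI[of _ v0]) simp_all
    show "(\<Sum>u | ?E v u. y u / m) = ?l * (y v / m)" if "v \<in> ?V" for v
      using y(3)[OF that] by (simp add: sum_divide_distrib[symmetric])
  qed
  have free: "\<not> has_theta ?E q r" using G(3) free_of_theta_iff[OF G(1) hq(2) hr] by blast
  interpret perron_graph ?V ?E ?l "\<lambda>v. y v / m" by (rule perron)
  obtain X Y where "X \<subseteq> ?V" "Y \<subseteq> ?V" "X \<inter> Y = {}"
    "\<And>a. a \<in> X \<Longrightarrow> card {b \<in> Y. \<not> ?E a b} \<le> card ?V / 1000"
    "\<And>b. b \<in> Y \<Longrightarrow> card {a \<in> X. \<not> ?E b a} \<le> card ?V / 1000"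
    "498 / 1000 * card ?V \<le> card X" "card X \<le> 502 / 1000 * card ?V"
    "498 / 1000 * card ?V \<le> card Y" "card Y \<le> 502 / 1000 * card ?V"
    "card (?V - X - Y) \<le> 1 / 10000 * card ?V" "(\<Sum>v\<in>?V. 1 - y v / m) \<le> 4 / 1000 * card ?V"
    "499 / 1000 * card ?V \<le> ?l" "?l \<le> 502 / 1000 * card ?V"
    by (rule stable_partition[OF hq(2) hr free big l]) (rule that)
  then have st: "stable_graph ?V ?E ?l (\<lambda>v. y v / m) X Y q r"
    by (intro stable_graph.intro[OF perron] stable_graph_axioms.intro hq hr free big)
  have "stable_graph.nonbip ?E"
    unfolding stable_graph.nonbip_def[OF st]
  proof (rule ccontr)
    assume "\<not> (\<forall>U. \<exists>u v. ?E u v \<and> (u \<in> U \<longleftrightarrow> v \<in> U))"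
    then obtain U where U: "\<And>u v. ?E u v \<Longrightarrow> u \<in> U \<longleftrightarrow> v \<notin> U" by blast
    have "parcs G \<subseteq> (?V \<inter> U) \<times> (?V - U) \<union> (?V - U) \<times> (?V \<inter> U)"
    proof (rule subrelI)
      fix u v assume uv: "(u, v) \<in> parcs G"
      show "(u, v) \<in> (?V \<inter> U) \<times> (?V - U) \<union> (?V - U) \<times> (?V \<inter> U)"
        using U[OF uv] G.wellformed'[OF uv] by auto
    qed
    moreover have "?V = (?V \<inter> U) \<union> (?V - U)" "(?V \<inter> U) \<inter> (?V - U) = {}" by blast+
    ultimately have "bipartite G" unfolding bipartite_def by blast
    then show False using G(2) by blast
  qed
  then show ?thesis by (rule that[OF st])
qed

text \<open>The bound \<open>c\<close> links candidate and stability: it is at most the square of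
  the radius of every graph that competes with a copy of \<open>K\<close>, and it lies above the
  threshold at which the stability argument starts.\<close>

lemma SPEX3_eq_copies_stableI:
  assumes hq: "even q" "q \<ge> 2" and hr: "r \<ge> 2" and big: "100000000 * (real (q + r) + 10) \<le> n"
    and K: "pair_graph K" "card (pverts K) = n" "\<not> bipartite K"
      "\<not> has_theta (\<lambda>u v. (u, v) \<in> parcs K) q r"
    and L: "(real n)\<^sup>2 / 4 - 2 * real n \<le> c"
      "\<And>G0 l. pair_graph G0 \<Longrightarrow> graph_iso K G0 \<Longrightarrow> graph_spectral_radius (G0 :: nat pair_pre_digraph) \<le> l \<Longrightarrow> c \<le> l\<^sup>2"
    and key: "\<And>G G0 x X Y. pair_graph G \<Longrightarrow> card (pverts G) = n \<Longrightarrow> pair_graph G0 \<Longrightarrow> graph_iso K G0 \<Longrightarrow>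
      graph_spectral_radius (G0 :: nat pair_pre_digraph) \<le> graph_spectral_radius (G :: nat pair_pre_digraph) \<Longrightarrow>
      stable_graph (pverts G) (\<lambda>u v. (u, v) \<in> parcs G) (graph_spectral_radius G) x X Y q r \<Longrightarrow>
      stable_graph.nonbip (\<lambda>u v. (u, v) \<in> parcs G) \<Longrightarrow> graph_iso K G"
  shows "SPEX3 n (theta_graph [1, q, r]) = copies K"
proof (rule SPEX3_eq_copiesI[OF K(1,2)])
  let ?H = "theta_graph [1, q, r]"
  show "pverts K \<noteq> {}" using K(2) big by auto
  show "free_of ?H K" unfolding free_of_theta_iff[OF K(1) hq(2) hr] by (rule K(4))
  show "\<not> bipartite K" by (rule K(3))
  show "pair_graph ?H" by (rule pair_graph_theta_graph)
  fix G G0 assume G0: "G0 \<in> copies K" and G: "G \<in> nonbipartite_free_graphs n ?H"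
    and le: "graph_spectral_radius G0 \<le> graph_spectral_radius G"
  have G': "pair_graph G" "card (pverts G) = n" "free_of ?H G" "\<not> bipartite G"
    using G by (auto simp: nonbipartite_free_graphs_def)
  have G0': "pair_graph G0" "graph_iso K G0" using G0 by (auto simp: copies_def)
  have l: "(real (card (pverts G)))\<^sup>2 / 4 - 2 * real (card (pverts G)) \<le> (graph_spectral_radius G)\<^sup>2"
    using L(1) L(2)[OF G0' le] unfolding G'(2) by linarith
  obtain x X Y where
    "stable_graph (pverts G) (\<lambda>u v. (u, v) \<in> parcs G) (graph_spectral_radius G) x X Y q r"
    "stable_graph.nonbip (\<lambda>u v. (u, v) \<in> parcs G)"
    using stable_graphI[OF G'(1,4,3) hq hr _ l] big G'(2) by auto
  then have "graph_iso K G" by (rule key[OF G'(1,2) G0' le])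
  then show "G \<in> copies K" using G'(1) by (simp add: copies_def)
qed

lemma nat_floor_half: "nat \<lfloor>real m / 2\<rfloor> = m div 2"
proof -
  have "\<lfloor>real m / real 2\<rfloor> = int (m div 2)" by (rule floor_divide_of_nat_eq)
  then show ?thesis by simp
qed

lemma nat_ceiling_half: "nat \<lceil>real m / 2\<rceil> = m - m div 2"
proof -
  have "\<lceil>real m / 2\<rceil> = int (m - m div 2)"
  proof (rule ceiling_unique)
    have "m \<le> 2 * (m - m div 2)" "2 * (m - m div 2) \<le> m + 1" by linarith+
    then have "real m \<le> real (2 * (m - m div 2))" "real (2 * (m - m div 2)) \<le> real (m + 1)"
      by (simp_all only: of_nat_le_iff)
    then show "real_of_int (int (m - m div 2)) - 1 < real m / 2"
      "real m / 2 \<le> real_of_int (int (m - m div 2))" by simp_all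
  qed
  then show ?thesis by simp
qed

lemma SPEX3_bullet:
  assumes hq: "even q" "q \<ge> 2" and hr: "even r" "r \<ge> 2"
    and big: "100000000 * (real (q + r) + 10) \<le> n"
  shows "SPEX3 n (theta_graph [1, q, r]) = copies (K_bullet_K3 ((n - 1) - (n - 1) div 2) ((n - 1) div 2))"
proof -
  define b where "b = (n - 1) div 2"
  define a where "a = (n - 1) - b"
  have n: "real n \<ge> 1000000000" using big by simp
  then have n': "n \<ge> 100" by simp
  have ab: "a > 0" "b > 0" "a + b = n - 1" using n' by (auto simp: a_def b_def)
  have P: "a * b = balanced_product (n - 1)" by (simp add: balanced_product_def a_def b_def)
  let ?K = "K_bullet_K3 a b"
  have cardK: "card (pverts ?K) = n"
    using card_ext_verts[of a b 1] ab n' by (simp add: pverts_K_bullet_K3 lessThan_Suc)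
  have lower: "real (a * b) \<le> l\<^sup>2" if "pair_graph G0" "graph_iso ?K G0" "graph_spectral_radius G0 \<le> l"
    for G0 :: "nat pair_pre_digraph" and l
  proof -
    have "sqrt (a * b) \<le> graph_spectral_radius G0"
      using ab that(1,2) by (intro spectral_radius_ge_complete_bipartite[OF pair_graph_K_bullet_K3])
        (auto simp: pverts_K_bullet_K3 pverts_complete_bipartite parcs_K_bullet_K3)
    then have "(sqrt (a * b))\<^sup>2 \<le> l\<^sup>2" using that(3) by (intro power_mono) auto
    moreover have "(sqrt (a * b))\<^sup>2 = real (a * b)" by simp
    ultimately show ?thesis by linarith
  qed
  have "(real n)\<^sup>2 / 4 - 2 * n \<le> ((real (n - 1))\<^sup>2 - 1) / 4"
    using n' by (simp add: of_nat_diff power2_eq_square algebra_simps)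
  then have base: "(real n)\<^sup>2 / 4 - 2 * real n \<le> real (a * b)"
    using balanced_product_lower[of "n - 1"] unfolding P by linarith
  have "SPEX3 n (theta_graph [1, q, r]) = copies ?K"
  proof (rule SPEX3_eq_copies_stableI[OF hq hr(2) big pair_graph_K_bullet_K3 cardK
        not_bipartite_K_bullet_K3 theta_free_K_bullet_K3[OF hq(1) hr(1) hq(2) hr(2)] base lower])
    fix G G0 :: "nat pair_pre_digraph" and x X Y
    let ?V = "pverts G" and ?E = "\<lambda>u v. (u, v) \<in> parcs G" and ?l = "graph_spectral_radius G"
    assume G': "pair_graph G" "card ?V = n" and G0: "pair_graph G0" "graph_iso ?K G0" "graph_spectral_radius G0 \<le> ?l"
      and st: "stable_graph ?V ?E ?l x X Y q r" and nb: "stable_graph.nonbip ?E"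
    interpret stable_graph ?V ?E ?l x X Y q r by (rule st)
    have l: "real (balanced_product (card ?V - 1)) \<le> ?l\<^sup>2"
      using lower[OF G0] unfolding G'(2) P .
    obtain w a0 b0 where W: "W = {w}" and ab0: "a0 \<in> A" "b0 \<in> B"
      and prod: "card A * card B = balanced_product (card ?V - 1)"
      and arcs: "\<And>u v. ?E u v \<longleftrightarrow> u \<in> A \<and> v \<in> B \<or> u \<in> B \<and> v \<in> A \<or>
        u \<in> {a0, b0, w} \<and> v \<in> {a0, b0, w} \<and> u \<noteq> v"
      by (rule bullet_structure[OF nb hr(1) l]) (rule that)
    have Veq: "?V = A \<union> B \<union> {w}" "?V = B \<union> A \<union> {w}" using V_eq W by blast+
    have w: "w \<notin> A" "w \<notin> B" using W W_disjoint by blast+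
    have BA: "B \<inter> A = {}" using A_B_disjoint by blast
    have "{b0, a0, w} = {a0, b0, w}" by blast
    then have arcs': "?E u v \<longleftrightarrow> u \<in> B \<and> v \<in> A \<or> u \<in> A \<and> v \<in> B \<or>
        u \<in> {b0, a0, w} \<and> v \<in> {b0, a0, w} \<and> u \<noteq> v" for u v
      unfolding arcs[of u v] by blast
    have "card A + card B = n - 1" using card_V W G'(2) by simp
    from balanced_product_eqD[OF this] prod G'(2)
    have "card A = b \<and> card B = a \<or> card B = b \<and> card A = a" by (simp add: a_def b_def)
    then show "graph_iso ?K G"
    proof (elim disjE conjE)
      assume c: "card A = b" "card B = a"
      show ?thesis unfolding c[symmetric]
        by (rule graph_iso_K_bullet_K3[OF G'(1) Veq(2) ab0(2,1) BA w(2,1) fin_ABW(2,1) arcs'])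
    next
      assume c: "card B = b" "card A = a"
      show ?thesis unfolding c[symmetric]
        by (rule graph_iso_K_bullet_K3[OF G'(1) Veq(1) ab0 A_B_disjoint w fin_ABW(1,2) arcs])
    qed
  qed
  then show ?thesis by (simp only: a_def b_def)
qed

lemma SPEX3_SK:
  assumes hr: "odd r" "r \<ge> 2" and big: "100000000 * (real (2 + r) + 10) \<le> n"
  shows "SPEX3 n (theta_graph [1, 2, r]) = copies (SK ((n - 1) - (n - 1) div 2) ((n - 1) div 2))"
proof -
  define b where "b = (n - 1) div 2"
  define a where "a = (n - 1) - b"
  have n: "real n \<ge> 1000000000" using big by simp
  then have n': "n \<ge> 100" by simp
  have ab: "a > 0" "b > 0" "a + b = n - 1" "a \<ge> 2" "b \<ge> 2" using n' by (auto simp: a_def b_def)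
  have P: "a * b = balanced_product (n - 1)" by (simp add: balanced_product_def a_def b_def)
  have hq: "even (2::nat)" "(2::nat) \<ge> 2" by simp_all
  let ?K = "SK a b"
  note pgK = pair_graph_SK[OF ab(1,2)]
  have cardK: "card (pverts ?K) = n"
    using card_ext_verts[of a b 1] ab n' by (simp add: pverts_SK lessThan_Suc)
  have lower': "sqrt (real (a * b)) - 1 / sqrt (real (a * b)) \<le> l"
    if "pair_graph G0" "graph_iso ?K G0" "graph_spectral_radius G0 \<le> l" for G0 :: "nat pair_pre_digraph" and l
    using spectral_radius_ge_SK[OF that(1,2) ab(1,2)] that(3) by simp
  have "1 \<le> a * b" using ab by (simp add: Suc_le_eq)
  then have "real 1 \<le> real (a * b)" by (simp only: of_nat_le_iff)
  then have "1 \<le> sqrt (real (a * b))" by simp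
  note lower = sub_inverse_square_le[OF this lower']
  have "(real n)\<^sup>2 / 4 - 2 * n \<le> ((real (n - 1))\<^sup>2 - 1) / 4 - 2"
    using n' by (simp add: of_nat_diff power2_eq_square algebra_simps)
  then have base: "(real n)\<^sup>2 / 4 - 2 * real n \<le> sqrt (real (a * b)) * sqrt (real (a * b)) - 2"
    using balanced_product_lower[of "n - 1"] unfolding P real_sqrt_mult_self abs_of_nat by linarith
  have "SPEX3 n (theta_graph [1, 2, r]) = copies ?K"
  proof (rule SPEX3_eq_copies_stableI[OF hq hr(2) big pgK cardK
        not_bipartite_SK[OF ab(4,5)] theta_free_SK[OF ab(1,2) hr(2)] base lower])
    fix G G0 :: "nat pair_pre_digraph" and x X Y
    let ?V = "pverts G" and ?E = "\<lambda>u v. (u, v) \<in> parcs G" and ?l = "graph_spectral_radius G"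
    assume G': "pair_graph G" "card ?V = n" and G0: "pair_graph G0" "graph_iso ?K G0" "graph_spectral_radius G0 \<le> ?l"
      and st: "stable_graph ?V ?E ?l x X Y 2 r" and nb: "stable_graph.nonbip ?E"
    interpret stable_graph ?V ?E ?l x X Y 2 r by (rule st)
    have l: "sqrt (balanced_product (card ?V - 1)) - 1 / sqrt (balanced_product (card ?V - 1)) \<le> ?l"
      using lower'[OF G0] unfolding G'(2) P .
    obtain w a0 b0 where W: "W = {w}" and ab0: "a0 \<in> A" "b0 \<in> B"
      and prod: "card A * card B = balanced_product (card ?V - 1)"
      and arcs: "\<And>u v. ?E u v \<longleftrightarrow> (u \<in> A \<and> v \<in> B \<or> u \<in> B \<and> v \<in> A) \<and> {u, v} \<noteq> {a0, b0} \<or>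
        u = w \<and> v \<in> {a0, b0} \<or> v = w \<and> u \<in> {a0, b0}"
      by (rule SK_structure[OF nb refl hr(1) l]) (rule that)
    have Veq: "?V = A \<union> B \<union> {w}" "?V = B \<union> A \<union> {w}" using V_eq W by blast+
    have w: "w \<notin> A" "w \<notin> B" using W W_disjoint by blast+
    have BA: "B \<inter> A = {}" using A_B_disjoint by blast
    have "{b0, a0} = {a0, b0}" by blast
    then have arcs': "?E u v \<longleftrightarrow> (u \<in> B \<and> v \<in> A \<or> u \<in> A \<and> v \<in> B) \<and> {u, v} \<noteq> {b0, a0} \<or>
        u = w \<and> v \<in> {b0, a0} \<or> v = w \<and> u \<in> {b0, a0}" for u v
      using arcs[of u v] by metis
    have "card A + card B = n - 1" using card_V W G'(2) by simp
    from balanced_product_eqD[OF this] prod G'(2)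
    have "card A = b \<and> card B = a \<or> card B = b \<and> card A = a" by (simp add: a_def b_def)
    then show "graph_iso ?K G"
    proof (elim disjE conjE)
      assume c: "card A = b" "card B = a"
      show ?thesis unfolding c[symmetric]
        by (rule graph_iso_SK[OF G'(1) Veq(2) ab0(2,1) BA w(2,1) fin_ABW(2,1) arcs'])
    next
      assume c: "card B = b" "card A = a"
      show ?thesis unfolding c[symmetric]
        by (rule graph_iso_SK[OF G'(1) Veq(1) ab0 A_B_disjoint w fin_ABW(1,2) arcs])
    qed
  qed
  then show ?thesis by (simp only: a_def b_def)
qed

text \<open>Exchanging the sides is harmless for the other two candidates, but here it moves the
  triangle. The structure theorem leaves \<open>K_circ_K3 a b\<close> and
  \<open>K_circ_K3 b a\<close>; in the second case the spectral equations give
  \<open>a \<le> b\<close>, and with \<open>b \<le> a\<close> the two graphs coincide.\<close>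

lemma SPEX3_circ:
  assumes hq: "even q" "q \<ge> 4" and hr: "odd r" "r \<ge> 2"
    and big: "100000000 * (real (q + r) + 10) \<le> n"
  shows "SPEX3 n (theta_graph [1, q, r]) = copies (K_circ_K3 ((n - 2) - (n - 2) div 2) ((n - 2) div 2))"
proof -
  define b where "b = (n - 2) div 2"
  define a where "a = (n - 2) - b"
  have n: "real n \<ge> 1000000000" using big by simp
  then have n': "n \<ge> 100" by simp
  have ab: "a > 0" "b > 0" "a + b = n - 2" using n' by (auto simp: a_def b_def)
  have P: "a * b = balanced_product (n - 2)" by (simp add: balanced_product_def a_def b_def)
  have q2: "q \<ge> 2" using hq by simp
  let ?K = "K_circ_K3 a b"
  have "{..<2} = {0, 1::nat}" by auto
  then have cardK: "card (pverts ?K) = n"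
    using card_ext_verts[of a b 2] ab n' by (simp add: pverts_K_circ_K3)
  have l0: "sqrt (a * b) \<le> graph_spectral_radius G0" if "pair_graph G0" "graph_iso ?K G0"
    for G0 :: "nat pair_pre_digraph"
    using ab that by (intro spectral_radius_ge_complete_bipartite[OF pair_graph_K_circ_K3])
      (auto simp: pverts_K_circ_K3 pverts_complete_bipartite parcs_K_circ_K3)
  have lower: "real (a * b) \<le> l\<^sup>2" if "pair_graph G0" "graph_iso ?K G0" "graph_spectral_radius G0 \<le> l"
    for G0 :: "nat pair_pre_digraph" and l
  proof -
    have "(sqrt (a * b))\<^sup>2 \<le> l\<^sup>2" using l0[OF that(1,2)] that(3) by (intro power_mono) auto
    moreover have "(sqrt (a * b))\<^sup>2 = real (a * b)" by simp
    ultimately show ?thesis by linarith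
  qed
  have "(real n)\<^sup>2 / 4 - 2 * n \<le> ((real (n - 2))\<^sup>2 - 1) / 4"
    using n' by (simp add: of_nat_diff power2_eq_square algebra_simps)
  then have base: "(real n)\<^sup>2 / 4 - 2 * real n \<le> real (a * b)"
    using balanced_product_lower[of "n - 2"] unfolding P by linarith
  have "SPEX3 n (theta_graph [1, q, r]) = copies ?K"
  proof (rule SPEX3_eq_copies_stableI[OF hq(1) q2 hr(2) big pair_graph_K_circ_K3 cardK
        not_bipartite_K_circ_K3 theta_free_K_circ_K3[OF hq] base lower])
    fix G G0 :: "nat pair_pre_digraph" and x X Y
    let ?V = "pverts G" and ?E = "\<lambda>u v. (u, v) \<in> parcs G" and ?l = "graph_spectral_radius G"
    assume G': "pair_graph G" "card ?V = n" and G0: "pair_graph G0" "graph_iso ?K G0" "graph_spectral_radius G0 \<le> ?l"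
      and st: "stable_graph ?V ?E ?l x X Y q r" and nb: "stable_graph.nonbip ?E"
    interpret stable_graph ?V ?E ?l x X Y q r by (rule st)
    have l: "real (balanced_product (card ?V - 2)) \<le> ?l\<^sup>2"
      using lower[OF G0] unfolding G'(2) P .
    obtain w w' u where W: "W = {w, w'}" "w \<noteq> w'" and u: "u \<in> A \<or> u \<in> B"
      and sum: "card A + card B = card ?V - 2"
      and prod: "card A * card B = balanced_product (card ?V - 2)"
      and arcs: "\<And>y z. ?E y z \<longleftrightarrow> y \<in> A \<and> z \<in> B \<or> y \<in> B \<and> z \<in> A \<or>
        y \<in> {u, w, w'} \<and> z \<in> {u, w, w'} \<and> y \<noteq> z"
      by (rule circ_structure[OF nb hq(2) hr(1) l]) (rule that)
    have Veq: "?V = A \<union> B \<union> {w, w'}" "?V = B \<union> A \<union> {w, w'}" using V_eq W by blast+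
    have w: "w \<notin> A" "w \<notin> B" "w' \<notin> A" "w' \<notin> B" using W W_disjoint by blast+
    have BA: "B \<inter> A = {}" using A_B_disjoint by blast
    have arcs': "?E y z \<longleftrightarrow> y \<in> B \<and> z \<in> A \<or> y \<in> A \<and> z \<in> B \<or>
        y \<in> {u, w, w'} \<and> z \<in> {u, w, w'} \<and> y \<noteq> z" for y z
      using arcs[of y z] by argo
    have cards: "card A = b \<and> card B = a \<or> card B = b \<and> card A = a"
      using balanced_product_eqD[of "card A" "card B" "n - 2"] sum prod G'(2) by (simp add: a_def b_def)
    have "graph_iso (K_circ_K3 a b) G \<or> graph_iso (K_circ_K3 b a) G"
      using u
    proof
      assume "u \<in> B"
      then have "graph_iso (K_circ_K3 (card A) (card B)) G"
        by (rule graph_iso_K_circ_K3[OF G'(1) Veq(1) _ A_B_disjoint w(1,2,3,4) W(2) fin_ABW(1,2) arcs])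
      then show ?thesis using cards by auto
    next
      assume "u \<in> A"
      then have "graph_iso (K_circ_K3 (card B) (card A)) G"
        by (rule graph_iso_K_circ_K3[OF G'(1) Veq(2) _ BA w(2,1,4,3) W(2) fin_ABW(2,1) arcs'])
      then show ?thesis using cards by auto
    qed
    moreover have "a = b" if iso: "graph_iso (K_circ_K3 b a) G"
    proof -
      \<comment> \<open>This puts the radius at \<open>3\<close> or more, so that the denominator in
        the spectral equation is positive.\<close>
      have "9 \<le> a * b" using ab n' by (intro order_trans[OF _ mult_le_mono[of 3 a 3 b]]) (auto simp: a_def b_def)
      then have "sqrt 9 \<le> sqrt (a * b)" by (intro real_sqrt_le_mono) (simp flip: of_nat_mult)
      moreover have "sqrt (9::real) = 3" using real_sqrt_abs[of 3] by simp
      ultimately have gt: "graph_spectral_radius G0 > 2" using l0[OF G0(1,2)] by linarith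
      have e0: "(graph_spectral_radius G0)\<^sup>2 =
        real a * b + 2 * real a / ((graph_spectral_radius G0 - 2) * (graph_spectral_radius G0 + 1))"
        by (rule K_circ_K3_equation[OF G0(1,2) ab(1,2) gt])
      have "?l\<^sup>2 = real b * a + 2 * real b / ((?l - 2) * (?l + 1))"
        by (rule K_circ_K3_equation[OF G'(1) iso ab(2,1)]) (use gt G0(3) in linarith)
      then have e1: "?l\<^sup>2 = real a * b + 2 * real b / ((?l - 2) * (?l + 1))" by (simp add: mult.commute)
      have "real a \<le> real b" using K_circ_K3_side[OF e0 e1 gt G0(3)] by simp
      moreover have "b \<le> a" by (simp add: a_def b_def)
      ultimately show ?thesis by simp
    qed
    ultimately show "graph_iso ?K G" by auto
  qed
  then show ?thesis by (simp only: a_def b_def)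
qed

theorem theorem1p3:
  fixes q r :: nat
  assumes "q \<ge> 2" and "r \<ge> 2" and "even q"
  shows "\<exists>n0. \<forall>n\<ge>n0.
    SPEX3 n (theta_graph [1, q, r]) = copies
      (if even r then
         K_bullet_K3 (nat \<lceil>(real n - 1) / 2\<rceil>) (nat \<lfloor>(real n - 1) / 2\<rfloor>)
       else if q = 2 then
         SK (nat \<lceil>(real n - 1) / 2\<rceil>) (nat \<lfloor>(real n - 1) / 2\<rfloor>)
       else
         K_circ_K3 (nat \<lceil>(real n - 2) / 2\<rceil>) (nat \<lfloor>(real n - 2) / 2\<rfloor>))"
proof (intro exI[of _ "100000000 * (q + r + 10)"] allI impI)
  fix n assume n: "100000000 * (q + r + 10) \<le> n"
  then have "real (100000000 * (q + r + 10)) \<le> real n" by (simp only: of_nat_le_iff)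
  then have big: "100000000 * (real (q + r) + 10) \<le> n" by simp
  have n1: "real n - 1 = real (n - 1)" "real n - 2 = real (n - 2)" using n by (simp_all add: of_nat_diff)
  show "SPEX3 n (theta_graph [1, q, r]) = copies
      (if even r then
         K_bullet_K3 (nat \<lceil>(real n - 1) / 2\<rceil>) (nat \<lfloor>(real n - 1) / 2\<rfloor>)
       else if q = 2 then
         SK (nat \<lceil>(real n - 1) / 2\<rceil>) (nat \<lfloor>(real n - 1) / 2\<rfloor>)
       else
         K_circ_K3 (nat \<lceil>(real n - 2) / 2\<rceil>) (nat \<lfloor>(real n - 2) / 2\<rfloor>))"
    unfolding n1 nat_floor_half nat_ceiling_half
  proof (cases "even r")
    case True
    then show "SPEX3 n (theta_graph [1, q, r]) = copies
      (if even r then K_bullet_K3 (n - 1 - (n - 1) div 2) ((n - 1) div 2)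
       else if q = 2 then SK (n - 1 - (n - 1) div 2) ((n - 1) div 2)
       else K_circ_K3 (n - 2 - (n - 2) div 2) ((n - 2) div 2))"
      using SPEX3_bullet[OF assms(3,1) True assms(2) big] by simp
  next
    case False
    show "SPEX3 n (theta_graph [1, q, r]) = copies
      (if even r then K_bullet_K3 (n - 1 - (n - 1) div 2) ((n - 1) div 2)
       else if q = 2 then SK (n - 1 - (n - 1) div 2) ((n - 1) div 2)
       else K_circ_K3 (n - 2 - (n - 2) div 2) ((n - 2) div 2))"
    proof (cases "q = 2")
      case True
      then show ?thesis using SPEX3_SK[OF False assms(2)] big False by simp
    next
      case q2: False
      have "q \<ge> 4"
      proof -
        from assms(3) obtain k where "q = 2 * k" by (rule evenE)
        then show ?thesis using assms(1) q2 by (cases "k = 1") auto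
      qed
      then show ?thesis using SPEX3_circ[OF assms(3) _ False assms(2) big] False q2 by simp
    qed
  qed
qed

end
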